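(* Let $m>n$ be non-negative integers, and let $G$ be a non-trivial zero-dimensional compact group acting freely and continuously on the Menger compacta $\mu^m$ and $\mu^n$ so that $\dim(\mu^n/G)\le m$. Suppose that there are no continuous $G$-equivariant maps $\mu^n*G\to\mu^n$, where the join $\mu^n*G$ carries the diagonal $G$-action. Then there are no continuous $G$-equivariant maps $\mu^m\to\mu^n$.
   Context: $\mu^n$ denotes the universal $n$-dimensional Menger compactum, unique up to homeomorphism; concretely, it is the subset of the cube $[0,1]^{2n+1}$ obtained as the intersection of the following decreasing sequence: start with $[0,1]^{2n+1}$; at each step subdivide every remaining cube into $3^{2n+1}$ congruent subcubes and keep only those that meet the union of the $n$-dimensional faces of the cube being subdivided. Topological groups are Hausdorff; spaces are separable and metrizable; $\dim$ denotes covering dimension (which agrees with the inductive dimensions on separable metrizable spaces). For compact spaces $X,Y$, the topological join $X*Y$ is the quotient of $X\times Y\times[0,1]$ by the relation which, for each fixed $y_0\in Y$, identifies all points $(x,y_0,0)$ ($x\in X$), and, for each fixed $x_0\in X$, identifies all points $(x_0,y,1)$ ($y\in Y$). The diagonal action on $X*G$ is $[(x,h,t)]\cdot g=[(xg,hg,t)]$. *)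

theory Defs
  imports "HOL-Analysis.Analysis" "HOL-Algebra.Group"
begin

section \<open>Menger compacta\<close>

text \<open>
  As in \<^const>\<open>Euclidean_space\<close>, points of \<open>\<real>\<^sup>N\<close> are functions \<^typ>\<open>nat \<Rightarrow> real\<close> that
  vanish at all indices \<open>i \<ge> N\<close>.
\<close>

definition cube :: "nat \<Rightarrow> (nat \<Rightarrow> real) \<Rightarrow> real \<Rightarrow> (nat \<Rightarrow> real) set" where
  "cube N a s = {x \<in> topspace (Euclidean_space N). \<forall>i<N. a i \<le> x i \<and> x i \<le> a i + s}"

text \<open>
  A face of dimension \<open>d\<close> is given by the set \<open>J\<close> of its \<open>d\<close> free coordinates and by the
  choice \<open>v\<close> of one of the two end values for each other coordinate.
\<close>

definition cube_faces :: "nat \<Rightarrow> nat \<Rightarrow> (nat \<Rightarrow> real) \<Rightarrow> real \<Rightarrow> (nat \<Rightarrow> real) set set" where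
  "cube_faces d N a s =
     {{x \<in> cube N a s. \<forall>i\<in>{..<N} - J. x i = v i} | J v.
        J \<subseteq> {..<N} \<and> card J = d \<and> (\<forall>i\<in>{..<N} - J. v i \<in> {a i, a i + s})}"

definition subcube_corners :: "nat \<Rightarrow> (nat \<Rightarrow> real) \<Rightarrow> real \<Rightarrow> (nat \<Rightarrow> real) set" where
  "subcube_corners N a s =
     {b \<in> topspace (Euclidean_space N). \<forall>i<N. \<exists>e\<in>{0, 1, 2::nat}. b i = a i + real e * (s / 3)}"

text \<open>The lower corners of the cubes of side length \<open>(1/3)^k\<close> remaining after \<open>k\<close> steps.\<close>

primrec menger_corners :: "nat \<Rightarrow> nat \<Rightarrow> (nat \<Rightarrow> real) set" where
  "menger_corners n 0 = {\<lambda>_. 0}"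
| "menger_corners n (Suc k) =
     (\<Union>a\<in>menger_corners n k.
        {b \<in> subcube_corners (2 * n + 1) a ((1/3) ^ k).
           cube (2 * n + 1) b ((1/3) ^ Suc k) \<inter> \<Union> (cube_faces n (2 * n + 1) a ((1/3) ^ k)) \<noteq> {}})"

definition menger_set :: "nat \<Rightarrow> (nat \<Rightarrow> real) set" where
  "menger_set n = (\<Inter>k. \<Union>a\<in>menger_corners n k. cube (2 * n + 1) a ((1/3) ^ k))"

definition menger :: "nat \<Rightarrow> (nat \<Rightarrow> real) topology" where
  "menger n = subtopology (Euclidean_space (2 * n + 1)) (menger_set n)"

lemma zero_in_cube: "s \<ge> 0 \<Longrightarrow> (\<lambda>_. 0) \<in> cube N (\<lambda>_. 0) s"
  by (simp add: cube_def topspace_Euclidean_space)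

lemma zero_in_menger_corners: "(\<lambda>_. 0) \<in> menger_corners n k"
proof (induction k)
  case (Suc k)
  let ?N = "2 * n + 1" and ?s = "(1/3) ^ k :: real"
  have "(\<lambda>_. 0) \<in> {x \<in> cube ?N (\<lambda>_. 0) ?s. \<forall>i\<in>{..<?N} - {..<n}. x i = (\<lambda>_. 0::real) i}"
    using zero_in_cube by simp
  moreover have "{x \<in> cube ?N (\<lambda>_. 0) ?s. \<forall>i\<in>{..<?N} - {..<n}. x i = (\<lambda>_. 0::real) i}
      \<in> cube_faces n ?N (\<lambda>_. 0) ?s"
    unfolding cube_faces_def by (rule CollectI, rule exI[of _ "{..<n}"], rule exI[of _ "\<lambda>_. 0"]) auto
  ultimately have "(\<lambda>_. 0) \<in> \<Union> (cube_faces n ?N (\<lambda>_. 0) ?s)"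
    by blast
  moreover have "(\<lambda>_. 0) \<in> cube ?N (\<lambda>_. 0) ((1/3) ^ Suc k)"
    by (rule zero_in_cube) simp
  moreover have "(\<lambda>_. 0) \<in> subcube_corners ?N (\<lambda>_. 0) ?s"
    by (simp add: subcube_corners_def topspace_Euclidean_space)
  ultimately show ?case
    using Suc.IH unfolding menger_corners.simps by blast
qed simp

lemma zero_in_menger: "(\<lambda>_. 0) \<in> topspace (menger n)"
proof -
  have "(\<lambda>_. 0) \<in> menger_set n"
    unfolding menger_set_def
    by (intro INT_I UN_I[OF zero_in_menger_corners] zero_in_cube) simp
  then show ?thesis
    by (simp add: menger_def topspace_Euclidean_space)
qed


section \<open>Covering dimension\<close>

definition open_cover :: "'a topology \<Rightarrow> 'a set set \<Rightarrow> bool" where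
  "open_cover X \<U> \<longleftrightarrow> (\<forall>U\<in>\<U>. openin X U) \<and> \<Union>\<U> = topspace X"

text \<open>For a nonempty space, \<open>covering_dim_le X 0\<close> says that the covering dimension is exactly 0.\<close>

definition covering_dim_le :: "'a topology \<Rightarrow> nat \<Rightarrow> bool" where
  "covering_dim_le X d \<longleftrightarrow>
     (\<forall>\<U>. finite \<U> \<and> open_cover X \<U> \<longrightarrow>
        (\<exists>\<V>. finite \<V> \<and> open_cover X \<V> \<and> (\<forall>V\<in>\<V>. \<exists>U\<in>\<U>. V \<subseteq> U) \<and>
           (\<forall>x\<in>topspace X. card {V\<in>\<V>. x \<in> V} \<le> d + 1)))"


section \<open>Quotient spaces\<close>

definition quotient_space :: "'a topology \<Rightarrow> ('a \<times> 'a) set \<Rightarrow> 'a set topology" where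
  "quotient_space X r = topology (\<lambda>\<U>. \<U> \<subseteq> topspace X // r \<and> openin X (\<Union>\<U>))"

lemma openin_quotient_space:
  assumes "equiv (topspace X) r"
  shows "openin (quotient_space X r) \<U> \<longleftrightarrow> \<U> \<subseteq> topspace X // r \<and> openin X (\<Union>\<U>)"
proof -
  have "istopology (\<lambda>\<U>. \<U> \<subseteq> topspace X // r \<and> openin X (\<Union>\<U>))"
    unfolding istopology_def
  proof (intro conjI allI impI)
    fix \<U> \<V>
    assume U: "\<U> \<subseteq> topspace X // r \<and> openin X (\<Union>\<U>)"
      and V: "\<V> \<subseteq> topspace X // r \<and> openin X (\<Union>\<V>)"
    then have "\<Union>(\<U> \<inter> \<V>) = \<Union>\<U> \<inter> \<Union>\<V>"
      using quotient_disj[OF assms] by (auto, blast)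
    then show "openin X (\<Union>(\<U> \<inter> \<V>))"
      using U V by (metis openin_Int)
  next
    fix \<K>
    assume K: "\<forall>\<U>\<in>\<K>. \<U> \<subseteq> topspace X // r \<and> openin X (\<Union>\<U>)"
    have "\<Union>(\<Union>\<K>) = (\<Union>\<U>\<in>\<K>. \<Union>\<U>)"
      by blast
    then show "openin X (\<Union>(\<Union>\<K>))"
      using K by auto
  qed auto
  then show ?thesis
    by (simp add: quotient_space_def)
qed

lemma topspace_quotient_space:
  assumes "equiv (topspace X) r"
  shows "topspace (quotient_space X r) = topspace X // r"
proof -
  have "openin (quotient_space X r) (topspace X // r)"
    by (simp add: openin_quotient_space[OF assms] Union_quotient[OF assms])
  moreover have "topspace (quotient_space X r) \<subseteq> topspace X // r"
    using openin_quotient_space[OF assms] openin_topspace by blast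
  ultimately show ?thesis
    by (simp add: openin_subset subset_antisym)
qed

lemma quotient_map_quotient_space:
  assumes "equiv (topspace X) r"
  shows "quotient_map X (quotient_space X r) (\<lambda>x. r `` {x})"
  unfolding quotient_map_def
proof (intro conjI allI impI)
  show "(\<lambda>x. r `` {x}) ` topspace X = topspace (quotient_space X r)"
    unfolding topspace_quotient_space[OF assms] by (auto simp: quotient_def)
next
  fix \<U>
  assume "\<U> \<subseteq> topspace (quotient_space X r)"
  then have U: "\<U> \<subseteq> topspace X // r"
    by (simp add: topspace_quotient_space[OF assms])
  have "{x \<in> topspace X. r `` {x} \<in> \<U>} = \<Union>\<U>"
  proof (intro subset_antisym subsetI)
    fix x assume "x \<in> {x \<in> topspace X. r `` {x} \<in> \<U>}"
    then show "x \<in> \<Union>\<U>"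
      using equiv_class_self[OF assms] by blast
  next
    fix x assume "x \<in> \<Union>\<U>"
    then obtain C where C: "C \<in> \<U>" "x \<in> C" by blast
    then obtain y where y: "y \<in> topspace X" "C = r `` {y}"
      using U by (blast elim: quotientE)
    then have "(y, x) \<in> r"
      using C(2) by simp
    then have "x \<in> topspace X" "C = r `` {x}"
      using y(2) equiv_class_eq[OF assms] equivE[OF assms] by blast+
    then show "x \<in> {x \<in> topspace X. r `` {x} \<in> \<U>}"
      using C(1) by simp
  qed
  then show "openin X {x \<in> topspace X. r `` {x} \<in> \<U>} \<longleftrightarrow> openin (quotient_space X r) \<U>"
    by (simp add: openin_quotient_space[OF assms] U)
qed


section \<open>Topological groups and right actions\<close>

locale topological_group = group G for G (structure) +
  fixes T :: "'a topology"
  assumes topspace_eq_carrier: "topspace T = carrier G"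
    and Hausdorff: "Hausdorff_space T"
    and continuous_mult: "continuous_map (prod_topology T T) T (\<lambda>(g, h). g \<otimes> h)"
    and continuous_inv: "continuous_map T T (\<lambda>g. inv g)"

locale continuous_right_action = topological_group +
  fixes X :: "'x topology" and act :: "'x \<Rightarrow> 'a \<Rightarrow> 'x"
  assumes continuous_act: "continuous_map (prod_topology X T) X (\<lambda>(x, g). act x g)"
    and act_one: "x \<in> topspace X \<Longrightarrow> act x \<one> = x"
    and act_mult: "\<lbrakk>x \<in> topspace X; g \<in> carrier G; h \<in> carrier G\<rbrakk>
      \<Longrightarrow> act x (g \<otimes> h) = act (act x g) h"
begin

lemma act_closed: "\<lbrakk>x \<in> topspace X; g \<in> carrier G\<rbrakk> \<Longrightarrow> act x g \<in> topspace X"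
  using continuous_map_image_subset_topspace[OF continuous_act]
  by (auto simp: topspace_eq_carrier)

end

locale free_right_action = continuous_right_action +
  assumes free: "\<lbrakk>x \<in> topspace X; g \<in> carrier G; act x g = x\<rbrakk> \<Longrightarrow> g = \<one>"

lemma (in topological_group) right_multiplication_action:
  "free_right_action G T T (\<lambda>h g. h \<otimes> g)"
  by unfold_locales
    (use continuous_mult in \<open>auto simp: topspace_eq_carrier m_assoc\<close>)

definition orbit_rel ::
  "('g, 'b) monoid_scheme \<Rightarrow> 'x topology \<Rightarrow> ('x \<Rightarrow> 'g \<Rightarrow> 'x) \<Rightarrow> ('x \<times> 'x) set" where
  "orbit_rel G X act = {(x, y). x \<in> topspace X \<and> (\<exists>g\<in>carrier G. y = act x g)}"

definition orbit_space ::
  "('g, 'b) monoid_scheme \<Rightarrow> 'x topology \<Rightarrow> ('x \<Rightarrow> 'g \<Rightarrow> 'x) \<Rightarrow> 'x set topology" where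
  "orbit_space G X act = quotient_space X (orbit_rel G X act)"

lemma (in continuous_right_action) equiv_orbit_rel: "equiv (topspace X) (orbit_rel G X act)"
proof (rule equivI)
  show "orbit_rel G X act \<subseteq> topspace X \<times> topspace X"
    by (auto simp: orbit_rel_def act_closed)
  show "refl_on (topspace X) (orbit_rel G X act)"
    by (rule refl_onI) (auto simp: orbit_rel_def intro!: bexI[of _ \<one>] simp: act_one)
  show "sym (orbit_rel G X act)"
  proof (rule symI)
    fix x y assume "(x, y) \<in> orbit_rel G X act"
    then obtain g where "x \<in> topspace X" "g \<in> carrier G" "y = act x g"
      by (auto simp: orbit_rel_def)
    moreover from this have "act y (inv g) = x"
      by (metis act_mult act_one inv_closed r_inv)
    ultimately show "(y, x) \<in> orbit_rel G X act"
      by (auto simp: orbit_rel_def act_closed intro!: bexI[of _ "inv g"])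
  qed
  show "trans (orbit_rel G X act)"
  proof (rule transI)
    fix x y z assume "(x, y) \<in> orbit_rel G X act" "(y, z) \<in> orbit_rel G X act"
    then obtain g h where "x \<in> topspace X" "g \<in> carrier G" "h \<in> carrier G" "z = act (act x g) h"
      by (auto simp: orbit_rel_def)
    then show "(x, z) \<in> orbit_rel G X act"
      by (auto simp: orbit_rel_def act_mult intro!: bexI[of _ "g \<otimes> h"])
  qed
qed

definition equivariant_map ::
  "('g, 'b) monoid_scheme \<Rightarrow> 'x topology \<Rightarrow> ('x \<Rightarrow> 'g \<Rightarrow> 'x) \<Rightarrow>
   'y topology \<Rightarrow> ('y \<Rightarrow> 'g \<Rightarrow> 'y) \<Rightarrow> ('x \<Rightarrow> 'y) \<Rightarrow> bool" where
  "equivariant_map G X actX Y actY f \<longleftrightarrow>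
     continuous_map X Y f \<and> (\<forall>x\<in>topspace X. \<forall>g\<in>carrier G. f (actX x g) = actY (f x) g)"


section \<open>Joins\<close>

definition join_cylinder :: "'x topology \<Rightarrow> 'y topology \<Rightarrow> ('x \<times> 'y \<times> real) topology" where
  "join_cylinder X Y = prod_topology X (prod_topology Y (top_of_set {0..1}))"

definition join_rel ::
  "'x topology \<Rightarrow> 'y topology \<Rightarrow> (('x \<times> 'y \<times> real) \<times> ('x \<times> 'y \<times> real)) set" where
  "join_rel X Y =
     {((x, y, t), (x', y', t')).
        (x, y, t) \<in> topspace (join_cylinder X Y) \<and> (x', y', t') \<in> topspace (join_cylinder X Y) \<and>
        ((x, y, t) = (x', y', t') \<or> t = 0 \<and> t' = 0 \<and> y = y' \<or> t = 1 \<and> t' = 1 \<and> x = x')}"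

definition join_space :: "'x topology \<Rightarrow> 'y topology \<Rightarrow> ('x \<times> 'y \<times> real) set topology" where
  "join_space X Y = quotient_space (join_cylinder X Y) (join_rel X Y)"

text \<open>
  A point of the join is an equivalence class. The diagonal action moves it elementwise; by the
  lemma \<open>join_act_class\<close> below this means \<open>[(x, y, t)] \<cdot> g = [(x \<cdot> g, y \<cdot> g, t)]\<close>.
\<close>

definition join_act ::
  "('x \<Rightarrow> 'g \<Rightarrow> 'x) \<Rightarrow> ('y \<Rightarrow> 'g \<Rightarrow> 'y) \<Rightarrow> ('x \<times> 'y \<times> real) set \<Rightarrow> 'g \<Rightarrow> ('x \<times> 'y \<times> real) set" where
  "join_act actX actY c g = (\<lambda>(x, y, t). (actX x g, actY y g, t)) ` c"

lemma equiv_join_rel: "equiv (topspace (join_cylinder X Y)) (join_rel X Y)"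
  by (rule equivI) (auto simp: join_rel_def refl_on_def sym_def trans_def)

lemma join_act_class:
  assumes X: "continuous_right_action G T X actX" and Y: "continuous_right_action G T Y actY"
    and p: "(x, y, t) \<in> topspace (join_cylinder X Y)" and g: "g \<in> carrier G"
  shows "join_act actX actY (join_rel X Y `` {(x, y, t)}) g =
         join_rel X Y `` {(actX x g, actY y g, t)}"
proof -
  interpret X: continuous_right_action G T X actX by (rule X)
  interpret Y: continuous_right_action G T Y actY by (rule Y)
  let ?h = "inv\<^bsub>G\<^esub> g"
  have hX: "actX (actX u ?h) g = u" "actX (actX u g) ?h = u" if "u \<in> topspace X" for u
    using that g by (metis X.act_mult X.act_one X.inv_closed X.l_inv X.r_inv)+
  have hY: "actY (actY u ?h) g = u" "actY (actY u g) ?h = u" if "u \<in> topspace Y" for u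
    using that g by (metis Y.act_mult Y.act_one X.inv_closed X.l_inv X.r_inv)+
  have xy: "x \<in> topspace X" "y \<in> topspace Y" "t \<in> {0..1}"
    using p by (auto simp: join_cylinder_def)
  show ?thesis
  proof (intro subset_antisym subsetI)
    fix q assume "q \<in> join_act actX actY (join_rel X Y `` {(x, y, t)}) g"
    then show "q \<in> join_rel X Y `` {(actX x g, actY y g, t)}"
      using g by (auto simp: join_act_def join_rel_def join_cylinder_def X.act_closed Y.act_closed)
  next
    fix q assume q: "q \<in> join_rel X Y `` {(actX x g, actY y g, t)}"
    obtain u v s where [simp]: "q = (u, v, s)" by (cases q)
    have uv: "u \<in> topspace X" "v \<in> topspace Y" "s \<in> {0..1}"
      using q by (auto simp: join_rel_def join_cylinder_def)
    have "((x, y, t), (actX u ?h, actY v ?h, s)) \<in> join_rel X Y"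
      using q xy uv g
      by (auto simp: join_rel_def join_cylinder_def X.act_closed Y.act_closed hX hY)
    then show "q \<in> join_act actX actY (join_rel X Y `` {(x, y, t)}) g"
      unfolding join_act_def
      by (intro image_eqI[of _ _ "(actX u ?h, actY v ?h, s)"]) (auto simp: hX hY uv)
  qed
qed

end

theory Submission
  imports Defs
begin

text \<open>
  Suppose that \<open>f : \<mu>\<^sup>m \<rightarrow> \<mu>\<^sup>n\<close> is equivariant. An equivariant map \<open>\<mu>\<^sup>n * G \<rightarrow> \<mu>\<^sup>m\<close> amounts to an
  equivariant map \<open>\<psi> : \<mu>\<^sup>n \<rightarrow> \<mu>\<^sup>m\<close> together with a (not equivariant) homotopy \<open>H\<close> from a constant
  to \<open>\<psi>\<close>: put \<open>[(x, h, t)] \<mapsto> H (x h\<^sup>-\<^sup>1, t) h\<close>; composing with \<open>f\<close> gives a contradiction.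

  A point of the cube lies in \<open>\<mu>\<^sup>m\<close> iff at each ternary level at most \<open>m\<close> of its \<open>2m + 1\<close>
  coordinates lie in an open middle third. A map from a space of dimension at most \<open>m\<close> can be
  perturbed so that at no point \<open>m + 1\<close> coordinates are centres of cells, and stretching the
  cells away from the centres then improves it by one level. In the limit this shows that
  \<open>\<mu>\<^sup>m\<close> is an absolute extensor for such spaces, also with control; as \<open>\<mu>\<^sup>n \<times> [0,1]\<close> has dimension
  \<open>n + 1 \<le> m\<close>, this yields \<open>H\<close>.

  For \<open>\<psi>\<close>, cover \<open>\<mu>\<^sup>n/G\<close> by \<open>m + 1\<close> disjoint families of small closed sets over which the
  action has slices modulo a small open normal subgroup \<open>N\<close>. Going through the \<open>m + 1\<close> families,
  controlled extension on the orbit space turns an almost equivariant map into an \<open>N\<close>-invariant one that is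
  equivariant up to an arbitrarily small error, moving it by an amount that depends only on the
  original error. A sequence of such corrections converges to \<open>\<psi>\<close>.
\<close>


section \<open>Centres of the triadic cells and stretching maps\<close>

text \<open>An equivariant map into \<open>menger m\<close> is a section of a bundle over the orbit
  space whose fibre is an extensor for spaces of dimension at most \<open>m\<close>, so for a finite
  group it can be built piece by piece over trivialising sets. A free action of an infinite
  profinite group need not have local cross-sections at all; the orbit map splits locally only
  modulo an open normal subgroup \<open>N\<close>. But \<open>N\<close> may act non-trivially on
  \<open>menger m\<close>, and a map that is both \<open>N\<close>-invariant and equivariant takes
  its values in the fixed points of \<open>N\<close>. Hence every finite stage has a defect of
  equivariance, and convergence hinges on the order of quantifiers: the displacement is fixed by the
  present defect, before the next one is prescribed. The moduli of controlled extension allow this,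
  because they and the number \<open>m + 1\<close> of extensions do not depend on \<open>N\<close>.
  The hypothesis \<open>n < m\<close> serves the null-homotopy, the bound on the orbit space the
  number of families, and freeness on \<open>menger n\<close> the slices.\<close>

definition cell_centres :: "nat \<Rightarrow> real set" where
  "cell_centres k = (\<lambda>j. (real j + 1/2) / 3 ^ k) ` {..<3 ^ k}"

text \<open>The open middle thirds of level \<open>k\<close> are the points with
  \<open>centre_dist k t < 1 / (6 * 3 ^ k)\<close>, half the length of a third. Membership in them
  thus becomes an inequality for a continuous function.\<close>

definition centre_dist :: "nat \<Rightarrow> real \<Rightarrow> real" where
  "centre_dist k t = infdist t (cell_centres k)"

lemma cell_centres_nonempty: "cell_centres k \<noteq> {}" and finite_cell_centres: "finite (cell_centres k)"
  by (auto simp: cell_centres_def lessThan_empty_iff)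

lemma centre_dist_ge_iff: "centre_dist k t \<ge> r \<longleftrightarrow> (\<forall>j<3 ^ k. \<bar>t - (real j + 1/2) / 3 ^ k\<bar> \<ge> r)"
proof -
  have "centre_dist k t = Min ((\<lambda>c. dist t c) ` cell_centres k)"
    unfolding centre_dist_def infdist_def using cell_centres_nonempty finite_cell_centres
    by (simp add: cInf_eq_Min)
  then show ?thesis
    by (simp add: cell_centres_nonempty finite_cell_centres) (auto simp: cell_centres_def dist_real_def)
qed

lemma centre_dist_less_iff: "centre_dist k t < r \<longleftrightarrow> (\<exists>j<3 ^ k. \<bar>t - (real j + 1/2) / 3 ^ k\<bar> < r)"
  using centre_dist_ge_iff[of r k t] by (auto simp: not_le)

lemma centre_dist_pos_iff: "centre_dist k t > 0 \<longleftrightarrow> t \<notin> cell_centres k"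
  unfolding centre_dist_def using in_closed_iff_infdist_zero[OF _ cell_centres_nonempty] finite_cell_centres
  by (metis finite_imp_closed infdist_nonneg order_le_less less_irrefl)

lemma centre_dist_lipschitz: "centre_dist k t \<le> centre_dist k s + \<bar>t - s\<bar>"
  unfolding centre_dist_def using infdist_triangle[of t "cell_centres k" s] by (simp add: dist_real_def)

text \<open>Every closed triadic interval of level \<open>k\<close> that contains \<open>t\<close> also contains \<open>s\<close>.\<close>

definition same_cell :: "nat \<Rightarrow> real \<Rightarrow> real \<Rightarrow> bool" where
  "same_cell k t s \<longleftrightarrow>
     (\<forall>a::nat. (t \<le> a / 3 ^ k \<longrightarrow> s \<le> a / 3 ^ k) \<and> (a / 3 ^ k \<le> t \<longrightarrow> a / 3 ^ k \<le> s))"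

lemma same_cell_refl: "same_cell k t t"
  by (simp add: same_cell_def)

lemma same_cell_bounds: "same_cell k t s \<Longrightarrow> t \<in> {0..1} \<Longrightarrow> s \<in> {0..1}"
proof -
  assume s: "same_cell k t s" and t: "t \<in> {0..1}"
  have "real 0 / 3 ^ k \<le> s"
    using s t unfolding same_cell_def by (elim allE[of _ 0]) simp
  moreover have "s \<le> real (3 ^ k) / 3 ^ k"
    using s t unfolding same_cell_def by (elim allE[of _ "3 ^ k"]) simp
  ultimately show "s \<in> {0..1}" by simp
qed

lemma same_cell_dist:
  assumes "same_cell k t s" "t \<ge> 0"
  shows "\<bar>t - s\<bar> \<le> 1 / 3 ^ k"
proof -
  define a where "a = nat \<lfloor>t * 3 ^ k\<rfloor>"
  have "a \<le> t * 3 ^ k" "t * 3 ^ k \<le> Suc a"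
    using assms(2) of_int_floor_le[of "t * 3 ^ k"] real_of_int_floor_add_one_ge[of "t * 3 ^ k"]
    by (auto simp: a_def add.commute)
  then have t: "a / 3 ^ k \<le> t" "t \<le> Suc a / 3 ^ k"
    by (auto simp: field_simps)
  then have "a / 3 ^ k \<le> s" "s \<le> Suc a / 3 ^ k"
    using assms(1) unfolding same_cell_def by blast+
  then show ?thesis using t by (auto simp: field_simps abs_if)
qed

text \<open>For \<open>j < k\<close> the ends of a middle third of level \<open>j\<close> are
  multiples of \<open>1 / 3 ^ k\<close>, so a move inside the cells of level \<open>k\<close> cannot
  cross them. Work at level \<open>k\<close> therefore leaves the earlier levels intact.\<close>

lemma same_cell_centre_dist:
  assumes "same_cell k t s" "j < k" "centre_dist j t \<ge> 1 / (6 * 3 ^ j)"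
  shows "centre_dist j s \<ge> 1 / (6 * 3 ^ j)"
  unfolding centre_dist_ge_iff
proof (intro allI impI)
  fix i :: nat assume i: "i < 3 ^ j"
  obtain l where k: "k = Suc j + l"
    using assms(2) by (metis less_iff_Suc_add add_Suc)
  have e: "(real i + 1/2) / 3 ^ j - 1 / (6 * 3 ^ j) = real ((3 * i + 1) * 3 ^ l) / 3 ^ k"
    "(real i + 1/2) / 3 ^ j + 1 / (6 * 3 ^ j) = real ((3 * i + 2) * 3 ^ l) / 3 ^ k"
    by (auto simp: k field_simps power_add)
  have "\<bar>t - (real i + 1/2) / 3 ^ j\<bar> \<ge> 1 / (6 * 3 ^ j)"
    using assms(3) i unfolding centre_dist_ge_iff by blast
  then have "t \<le> (real i + 1/2) / 3 ^ j - 1 / (6 * 3 ^ j) \<or> (real i + 1/2) / 3 ^ j + 1 / (6 * 3 ^ j) \<le> t"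
    by linarith
  then have "s \<le> (real i + 1/2) / 3 ^ j - 1 / (6 * 3 ^ j) \<or> (real i + 1/2) / 3 ^ j + 1 / (6 * 3 ^ j) \<le> s"
    using assms(1) unfolding e same_cell_def by blast
  then show "\<bar>s - (real i + 1/2) / 3 ^ j\<bar> \<ge> 1 / (6 * 3 ^ j)"
    by linarith
qed

text \<open>The hypothesis places both points in the interior of one cell, where no multiple of
  \<open>1 / 3 ^ k\<close> separates them. At a common endpoint of two cells
  \<open>same_cell\<close> would force \<open>t = s\<close>.\<close>

lemma same_cell_near_centre:
  assumes "centre_dist k t + \<bar>t - s\<bar> < 1 / (2 * 3 ^ k)"
  shows "same_cell k t s"
proof -
  have "centre_dist k t < 1 / (2 * 3 ^ k) - \<bar>t - s\<bar>" using assms by simp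
  then obtain j where j: "\<bar>t - (real j + 1/2) / 3 ^ k\<bar> < 1 / (2 * 3 ^ k) - \<bar>t - s\<bar>"
    unfolding centre_dist_less_iff by blast
  have e: "(real j + 1/2) / 3 ^ k - 1 / (2 * 3 ^ k) = j / 3 ^ k"
    "(real j + 1/2) / 3 ^ k + 1 / (2 * 3 ^ k) = Suc j / 3 ^ k"
    by (auto simp: field_simps)
  have b: "j / 3 ^ k < t" "j / 3 ^ k < s" "t < Suc j / 3 ^ k" "s < Suc j / 3 ^ k"
    using j unfolding e[symmetric] by linarith+
  show ?thesis
    unfolding same_cell_def
  proof (intro allI conjI impI)
    fix a :: nat
    assume "t \<le> a / 3 ^ k"
    then have "j / 3 ^ k < a / (3::real) ^ k" using b by linarith
    then have "Suc j \<le> a" by (simp add: field_simps)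
    then have "Suc j / 3 ^ k \<le> a / (3::real) ^ k" by (simp add: divide_right_mono)
    then show "s \<le> a / 3 ^ k" using b by linarith
  next
    fix a :: nat
    assume "a / 3 ^ k \<le> t"
    then have "a / (3::real) ^ k < Suc j / 3 ^ k" using b by linarith
    then have "a \<le> j" by (simp add: field_simps)
    then have "a / (3::real) ^ k \<le> j / 3 ^ k" by (simp add: divide_right_mono)
    then show "a / 3 ^ k \<le> s" using b by linarith
  qed
qed

text \<open>
  On each cell of level \<open>k\<close>, dilation by \<open>q\<close> about the centre, truncated to the cell. As a sum of
  truncated linear functions it is visibly continuous in both \<open>q\<close> and \<open>t\<close>.
\<close>

definition stretch :: "nat \<Rightarrow> real \<Rightarrow> real \<Rightarrow> real" where
  "stretch k q t = (\<Sum>j<3 ^ k. max 0 (min 1 (1/2 + q * (3 ^ k * t - real j - 1/2)))) / 3 ^ k"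

lemma stretch_mono: "q \<ge> 0 \<Longrightarrow> t \<le> s \<Longrightarrow> stretch k q t \<le> stretch k q s"
  unfolding stretch_def
  by (intro divide_right_mono sum_mono max.mono min.mono add_left_mono mult_left_mono) auto

text \<open>For \<open>q \<ge> 1\<close> every summand is saturated outside its own cell: the
  \<open>j\<close> cells to the left contribute 1 each, those to the right 0.\<close>

lemma stretch_cell:
  assumes q: "q \<ge> 1" and j: "j < 3 ^ k" and t: "j / 3 ^ k \<le> t" "t \<le> Suc j / 3 ^ k"
  shows "stretch k q t = (j + max 0 (min 1 (1/2 + q * (3 ^ k * t - real j - 1/2)))) / 3 ^ k"
proof -
  let ?f = "\<lambda>i. max 0 (min 1 (1/2 + q * (3 ^ k * t - real i - 1/2)))"
  have t': "j \<le> 3 ^ k * t" "3 ^ k * t \<le> j + 1"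
    using t by (auto simp: field_simps)
  have 1: "?f i = 1" if "i < j" for i
  proof -
    have "3 ^ k * t - real i - 1/2 \<ge> 1/2" using t' that by linarith
    then have "q * (3 ^ k * t - real i - 1/2) \<ge> 1 * (1/2)"
      using q by (intro mult_mono) auto
    then show ?thesis by simp
  qed
  have 2: "?f i = 0" if "i > j" for i
  proof -
    have "- (3 ^ k * t - real i - 1/2) \<ge> 1/2" using t' that by linarith
    then have "q * - (3 ^ k * t - real i - 1/2) \<ge> 1 * (1/2)"
      using q by (intro mult_mono) auto
    then have "1/2 + q * (3 ^ k * t - real i - 1/2) \<le> 0"
      unfolding mult_minus_right by linarith
    then show ?thesis by linarith
  qed
  have "{..<3 ^ k} = ({..<j} \<union> {j}) \<union> {j<..<3 ^ k}" using j by auto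
  then have "(\<Sum>i<3 ^ k. ?f i) = sum ?f (({..<j} \<union> {j}) \<union> {j<..<3 ^ k})" by (rule arg_cong)
  also have "\<dots> = (\<Sum>i\<in>{..<j} \<union> {j}. ?f i) + (\<Sum>i\<in>{j<..<3 ^ k}. ?f i)"
    by (rule sum.union_disjoint) auto
  also have "(\<Sum>i\<in>{j<..<3 ^ k}. ?f i) = 0"
    by (rule sum.neutral) (use 2 in auto)
  also have "(\<Sum>i\<in>{..<j} \<union> {j}. ?f i) = (\<Sum>i\<in>{..<j}. ?f i) + ?f j"
    by (subst sum.union_disjoint) auto
  also have "(\<Sum>i\<in>{..<j}. ?f i) = j"
    using 1 by simp
  finally show ?thesis
    unfolding stretch_def by simp
qed

lemma cell_containing:
  assumes "t \<in> {0..1::real}"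
  obtains j :: nat where "j < 3 ^ k" "j / 3 ^ k \<le> t" "t \<le> Suc j / 3 ^ k"
proof (cases "t = 1")
  case True
  then show ?thesis
    using that[of "3 ^ k - 1"] by (simp add: of_nat_diff field_simps)
next
  case False
  define a where "a = nat \<lfloor>t * 3 ^ k\<rfloor>"
  have "a \<le> t * 3 ^ k" "t * 3 ^ k \<le> Suc a"
    using assms of_int_floor_le[of "t * 3 ^ k"] real_of_int_floor_add_one_ge[of "t * 3 ^ k"]
    by (auto simp: a_def add.commute)
  moreover have "t * 3 ^ k < 1 * 3 ^ k" using False assms by (intro mult_strict_right_mono) auto
  ultimately have "real a < 3 ^ k" by linarith
  then have "a < 3 ^ k"
    using of_nat_less_imp_less[where 'a=real] by simp
  with \<open>a \<le> t * 3 ^ k\<close> \<open>t * 3 ^ k \<le> Suc a\<close> show ?thesis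
    using that[of a] by (simp add: field_simps)
qed

lemma stretch_id:
  assumes "t \<in> {0..1}"
  shows "stretch k 1 t = t"
proof -
  obtain j :: nat where j: "j < 3 ^ k" "j / 3 ^ k \<le> t" "t \<le> Suc j / 3 ^ k"
    using cell_containing assms by blast
  then have "real j \<le> 3 ^ k * t" "3 ^ k * t \<le> real j + 1" by (auto simp: field_simps)
  then have "max 0 (min 1 (1/2 + 1 * (3 ^ k * t - real j - 1/2))) = 3 ^ k * t - j"
    by (simp add: min_def max_def)
  then show ?thesis unfolding stretch_cell[OF order_refl j] by simp
qed

lemma stretch_dist:
  assumes "q \<ge> 1" "t \<in> {0..1}"
  shows "\<bar>stretch k q t - t\<bar> \<le> (q - 1) / (2 * 3 ^ k)"
proof -
  obtain j :: nat where j: "j < 3 ^ k" "j / 3 ^ k \<le> t" "t \<le> Suc j / 3 ^ k"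
    using cell_containing assms(2) by blast
  define s where "s = 3 ^ k * t - real j - 1/2"
  have s: "\<bar>s\<bar> \<le> 1/2" using j by (simp add: s_def field_simps abs_if)
  have t: "t = (j + (1/2 + s)) / 3 ^ k" by (simp add: s_def field_simps)
  have "stretch k q t - t = (max 0 (min 1 (1/2 + q * s)) - (1/2 + s)) / 3 ^ k"
    unfolding stretch_cell[OF assms(1) j] s_def[symmetric] by (subst t) (simp add: field_simps)
  \<comment> \<open>\<open>1/2 + s\<close> lies in the unit interval already, so truncation to that
    interval cannot increase the distance to it.\<close>
  moreover have "\<bar>max 0 (min 1 (1/2 + q * s)) - (1/2 + s)\<bar> \<le> \<bar>(1/2 + q * s) - (1/2 + s)\<bar>"
    using s by linarith
  moreover have "\<bar>(1/2 + q * s) - (1/2 + s)\<bar> = (q - 1) * \<bar>s\<bar>"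
  proof -
    have "(1/2 + q * s) - (1/2 + s) = (q - 1) * s" by (simp add: algebra_simps)
    then show ?thesis using assms(1) by (simp add: abs_mult)
  qed
  moreover have "(q - 1) * \<bar>s\<bar> \<le> (q - 1) * (1/2)"
    using s assms(1) by (intro mult_left_mono) auto
  ultimately have "\<bar>stretch k q t - t\<bar> \<le> ((q - 1) * (1/2)) / 3 ^ k"
    by (simp only: abs_divide abs_of_pos zero_less_power) (intro divide_right_mono, linarith, simp)
  then show ?thesis by simp
qed

lemma stretch_grid:
  assumes "q \<ge> 1" "a \<le> 3 ^ k"
  shows "stretch k q (real a / 3 ^ k) = a / 3 ^ k"
\<comment> \<open>The point 1 is not the left end of any cell and is treated as the right end of the
  last one.\<close>
proof (cases "a = 3 ^ k")
  case True
  show ?thesis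
    using stretch_cell[OF assms(1), of "3 ^ k - 1" k 1] True assms(1)
    by (simp add: of_nat_diff divide_right_mono field_simps)
next
  case False
  then show ?thesis
    using stretch_cell[OF assms(1), of a k "a / 3 ^ k"] assms by (simp add: divide_right_mono)
qed

lemma same_cell_stretch:
  assumes "q \<ge> 1" "t \<in> {0..1}"
  shows "same_cell k t (stretch k q t)"
proof -
  have "stretch k q t \<le> a / 3 ^ k" if "t \<le> a / 3 ^ k" for a :: nat
  proof (cases "a \<le> 3 ^ k")
    case True
    then show ?thesis using stretch_mono[OF _ that, of q k] stretch_grid[OF assms(1), of a k] assms by simp
  next
    case False
    have "stretch k q t \<le> stretch k q (real (3 ^ k) / 3 ^ k)"
      using assms by (intro stretch_mono) auto
    also have "\<dots> = real (3 ^ k) / 3 ^ k" using assms by (intro stretch_grid) auto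
    also have "\<dots> \<le> a / 3 ^ k" using False by (intro divide_right_mono) auto
    finally show ?thesis .
  qed
  moreover have "a / 3 ^ k \<le> stretch k q t" if "a / 3 ^ k \<le> t" for a :: nat
  proof -
    have "real a / 3 ^ k \<le> 1" using that assms(2) by (meson atLeastAtMost_iff order_trans)
    then have "real a \<le> 3 ^ k" by (simp add: field_simps)
    then have "a \<le> 3 ^ k" by (metis of_nat_le_iff of_nat_numeral of_nat_power)
    then show ?thesis using stretch_mono[OF _ that, of q k] stretch_grid[OF assms(1), of a k] assms(1) by linarith
  qed
  ultimately show ?thesis by (simp add: same_cell_def)
qed

lemma stretch_cases:
  assumes q: "q \<ge> 1" and t: "t \<in> {0..1}" and g: "centre_dist k t \<ge> l / 3 ^ k"
  obtains j :: nat and s where "j < 3 ^ k" "\<bar>s\<bar> \<le> 1/2" "\<bar>s\<bar> \<ge> l" 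
    "stretch k q t = (j + max 0 (min 1 (1/2 + q * s))) / 3 ^ k"
proof -
  obtain j :: nat where j: "j < 3 ^ k" "j / 3 ^ k \<le> t" "t \<le> Suc j / 3 ^ k"
    using cell_containing t by blast
  define s where "s = 3 ^ k * t - real j - 1/2"
  have "\<bar>t - (real j + 1/2) / 3 ^ k\<bar> \<ge> l / 3 ^ k" using g j unfolding centre_dist_ge_iff by blast
  moreover have "t - (real j + 1/2) / 3 ^ k = s / 3 ^ k" by (simp add: s_def field_simps)
  ultimately have "l \<le> \<bar>s\<bar>" by (simp add: divide_simps)
  moreover have "\<bar>s\<bar> \<le> 1/2" using j by (simp add: s_def field_simps abs_if)
  ultimately show ?thesis
    using that j stretch_cell[OF q j] by (simp add: s_def)
qed

text \<open>Dilation by \<open>1 / (6 * l)\<close> takes the relative distance \<open>l\<close> from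
  the centre to \<open>1/6\<close>, the rim of the middle third; truncation at the cell boundary
  acts only at the larger distance \<open>1/2\<close>.\<close>

lemma stretch_centre_dist:
  assumes l: "0 < l" "l \<le> 1/6" and t: "t \<in> {0..1}" and g: "centre_dist k t \<ge> l / 3 ^ k"
  shows "centre_dist k (stretch k (1 / (6 * l)) t) \<ge> 1 / (6 * 3 ^ k)"
proof -
  have q: "1 / (6 * l) \<ge> 1" using l by (simp add: field_simps)
  obtain j :: nat and s where j: "j < 3 ^ k" "\<bar>s\<bar> \<le> 1/2" "\<bar>s\<bar> \<ge> l" 
    "stretch k (1 / (6 * l)) t = (j + max 0 (min 1 (1/2 + 1 / (6 * l) * s))) / 3 ^ k"
    using stretch_cases[OF q t g] by metis
  define v where "v = 1 / (6 * l) * s"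
  define u where "u = max 0 (min 1 (1/2 + v))"
  have "\<bar>v\<bar> \<ge> 1/6" using j(3) l by (simp add: v_def abs_mult field_simps)
  then have "\<bar>u - 1/2\<bar> \<ge> 1/6" unfolding u_def by linarith
  moreover have "u \<in> {0..1}" by (simp add: u_def)
  ultimately have u: "u \<in> {0..1}" "\<bar>u - 1/2\<bar> \<ge> 1/6" by auto
  show ?thesis
    unfolding centre_dist_ge_iff
  proof (intro allI impI)
    fix i :: nat
    have "\<bar>(j + u) - (i + 1/2)\<bar> \<ge> 1/6"
    proof (cases i j rule: linorder_cases)
      case less
      then have "real i + 1 \<le> real j" by linarith
      then show ?thesis using u by (auto)
    next
      case greater
      then have "real j + 1 \<le> real i" by linarith
      then show ?thesis using u by (auto)
    qed (use u in auto)
    moreover have "stretch k (1 / (6 * l)) t - (i + 1/2) / 3 ^ k = ((j + u) - (i + 1/2)) / 3 ^ k"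
      unfolding j(4) u_def v_def by (simp add: field_simps)
    ultimately show "\<bar>stretch k (1 / (6 * l)) t - (i + 1/2) / 3 ^ k\<bar> \<ge> 1 / (6 * 3 ^ k)"
      by (simp add: divide_simps)
  qed
qed

text \<open>The factor 3 blows the middle third up to the whole cell and collapses each outer third
  to an endpoint. This later reveals the dimension of the Menger compactum through integral
  coordinates.\<close>

lemma stretch_three:
  assumes t: "t \<in> {0..1}" and g: "centre_dist k t \<ge> 1 / (6 * 3 ^ k)"
  shows "3 ^ k * stretch k 3 t \<in> \<int>"
proof -
  obtain j :: nat and s where j: "j < 3 ^ k" "\<bar>s\<bar> \<le> 1/2" "\<bar>s\<bar> \<ge> 1/6" 
    "stretch k 3 t = (j + max 0 (min 1 (1/2 + 3 * s))) / 3 ^ k"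
    using stretch_cases[of 3 t "1/6" k] t g by auto
  have "max 0 (min 1 (1/2 + 3 * s)) \<in> {0, 1}" using j(3) by auto
  then show ?thesis unfolding j(4) by auto
qed


section \<open>The Menger compactum in coordinates\<close>

definition level :: "nat \<Rightarrow> nat \<Rightarrow> (nat \<Rightarrow> real) \<Rightarrow> bool" where
  "level m j y \<longleftrightarrow> card {i. i < 2 * m + 1 \<and> centre_dist j (y i) < 1 / (6 * 3 ^ j)} \<le> m"

text \<open>Stage \<open>k\<close> constrains only the levels below \<open>k\<close>: step
  \<open>k + 1\<close> of the construction looks at the thirds of cells of side
  \<open>1 / 3 ^ k\<close>, which is level \<open>k\<close>. Stage 0 is the whole cube.\<close>

definition menger_stage :: "nat \<Rightarrow> nat \<Rightarrow> (nat \<Rightarrow> real) set" where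
  "menger_stage m k = {y. (\<forall>i\<ge>2 * m + 1. y i = 0) \<and> (\<forall>i<2 * m + 1. y i \<in> {0..1}) \<and> (\<forall>j<k. level m j y)}"

lemma menger_stage_Suc: "y \<in> menger_stage m (Suc k) \<longleftrightarrow> y \<in> menger_stage m k \<and> level m k y"
  by (auto simp: menger_stage_def less_Suc_eq)

text \<open>A face fixes all but \<open>m\<close> coordinates at ends of their intervals, and the
  middle one of three subintervals reaches neither end. So every middle coordinate of the subcube
  has to be free in the face, and a face that frees them all is met.\<close>

lemma subcube_meets_faces:
  assumes s: "s > 0" and aE: "a \<in> topspace (Euclidean_space (2 * m + 1))"
    and bE: "b \<in> topspace (Euclidean_space (2 * m + 1))"
    and b: "\<And>i. i < 2 * m + 1 \<Longrightarrow> b i \<in> {a i, a i + s / 3, a i + 2 * s / 3}"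
  shows "cube (2 * m + 1) b (s / 3) \<inter> \<Union> (cube_faces m (2 * m + 1) a s) \<noteq> {} \<longleftrightarrow>
    card {i. i < 2 * m + 1 \<and> b i = a i + s / 3} \<le> m" (is "?l \<longleftrightarrow> card ?J \<le> m")
proof
  assume ?l
  then obtain x J v where x: "x \<in> cube (2 * m + 1) b (s / 3)"
    and J: "J \<subseteq> {..<2 * m + 1}" "card J = m"
    and v: "\<forall>i\<in>{..<2 * m + 1} - J. v i \<in> {a i, a i + s}" "\<forall>i\<in>{..<2 * m + 1} - J. x i = v i"
    by (auto simp: cube_faces_def)
  have "?J \<subseteq> J"
  proof
    fix i assume i: "i \<in> ?J"
    show "i \<in> J"
    proof (rule ccontr)
      assume "i \<notin> J"
      then have "x i \<in> {a i, a i + s}" using v i by auto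
      moreover have "b i \<le> x i" "x i \<le> b i + s / 3" using x i by (auto simp: cube_def)
      ultimately show False using i s by auto
    qed
  qed
  then show "card ?J \<le> m"
    using J by (metis card_mono finite_lessThan finite_subset)
next
  assume "card ?J \<le> m"
  then obtain J where J: "?J \<subseteq> J" "J \<subseteq> {..<2 * m + 1}" "card J = m"
    using exists_subset_between[of ?J m "{..<2 * m + 1}"] by auto
  \<comment> \<open>A coordinate in the last third is moved to the upper end; one in the first third
    sits at the lower end already, and the middle ones are free in \<open>J\<close>.\<close>
  define x where "x i = (if i \<ge> 2 * m + 1 then 0 else if b i = a i + 2 * s / 3 then a i + s else b i)" for i
  have "x \<in> cube (2 * m + 1) b (s / 3)"
    using s by (auto simp: cube_def x_def topspace_Euclidean_space)
  moreover have "x \<in> cube (2 * m + 1) a s"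
  proof -
    have "a i \<le> x i \<and> x i \<le> a i + s" if "i < 2 * m + 1" for i
      using b[OF that] that s by (auto simp: x_def)
    then show ?thesis by (simp add: cube_def x_def topspace_Euclidean_space)
  qed
  then have "x \<in> {y \<in> cube (2 * m + 1) a s. \<forall>i\<in>{..<2 * m + 1} - J. y i = x i}" by simp
  moreover have "{y \<in> cube (2 * m + 1) a s. \<forall>i\<in>{..<2 * m + 1} - J. y i = x i} \<in> cube_faces m (2 * m + 1) a s"
    unfolding cube_faces_def
  proof (rule CollectI, intro exI conjI ballI)
    fix i assume i: "i \<in> {..<2 * m + 1} - J"
    then have "b i \<in> {a i, a i + 2 * s / 3}" using J b[of i] by auto
    then show "x i \<in> {a i, a i + s}" using i by (auto simp: x_def)
  qed (use J in auto)
  ultimately show ?l by blast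
qed

lemma menger_corners_props:
  assumes "a \<in> menger_corners m k"
  shows "a \<in> topspace (Euclidean_space (2 * m + 1))"
    and "i < 2 * m + 1 \<Longrightarrow> \<exists>j<3 ^ k. a i = real j / 3 ^ k"
proof -
  have "a \<in> topspace (Euclidean_space (2 * m + 1)) \<and> (\<forall>i<2 * m + 1. \<exists>j<3 ^ k. a i = real j / 3 ^ k)"
    using assms
  proof (induction k arbitrary: a)
    case (Suc k)
    then obtain c where c: "c \<in> menger_corners m k" "a \<in> subcube_corners (2 * m + 1) c ((1/3) ^ k)"
      by auto
    have "\<exists>j<3 ^ Suc k. a i = real j / 3 ^ Suc k" if i: "i < 2 * m + 1" for i
    proof -
      obtain j where j: "j < 3 ^ k" "c i = real j / 3 ^ k" using Suc.IH[OF c(1)] i by blast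
      obtain e where e: "e \<in> {0, 1, 2::nat}" "a i = c i + real e * ((1/3) ^ k / 3)"
        using c(2) i unfolding subcube_corners_def by blast
      have "3 * j + e < 3 ^ Suc k" using j(1) e(1) by auto
      moreover have "a i = real (3 * j + e) / 3 ^ Suc k"
        unfolding e(2) j(2) by (simp add: field_simps power_one_over)
      ultimately show ?thesis by blast
    qed
    then show ?case using c(2) by (auto simp: subcube_corners_def)
  qed (auto simp: topspace_Euclidean_space)
  then show "a \<in> topspace (Euclidean_space (2 * m + 1))"
    "i < 2 * m + 1 \<Longrightarrow> \<exists>j<3 ^ k. a i = real j / 3 ^ k" by blast+
qed

text \<open>Only the centre of the given cell can be that close: all other centres are at distance
  at least \<open>1 / (2 * 3 ^ k)\<close>, even from the endpoints of the cell.\<close>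

lemma centre_dist_in_cell:
  fixes j :: nat
  assumes j: "j < 3 ^ k" and t: "j / 3 ^ k \<le> t" "t \<le> j / 3 ^ k + 1 / 3 ^ k"
  shows "centre_dist k t < 1 / (6 * 3 ^ k) \<longleftrightarrow> j / 3 ^ k + 1 / 3 ^ k / 3 < t \<and> t < j / 3 ^ k + 2 * (1 / 3 ^ k) / 3"
proof -
  define u where "u = 3 ^ k * t - j"
  have t': "t = (j + u) / 3 ^ k" by (simp add: u_def field_simps)
  have u: "0 \<le> u" "u \<le> 1" using t by (auto simp: t' field_simps)
  have e: "\<bar>t - (real i + 1/2) / 3 ^ k\<bar> < 1 / (6 * 3 ^ k) \<longleftrightarrow> \<bar>j + u - (i + 1/2)\<bar> < 1/6" for i :: nat
  proof -
    have "t - (real i + 1/2) / 3 ^ k = (j + u - (i + 1/2)) / 3 ^ k"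
      by (simp add: t' diff_divide_distrib)
    then show ?thesis by (simp add: divide_simps)
  qed
  have "centre_dist k t < 1 / (6 * 3 ^ k) \<longleftrightarrow> \<bar>u - 1/2\<bar> < 1/6"
    unfolding centre_dist_less_iff e
  proof
    assume "\<exists>i<3 ^ k. \<bar>real j + u - (real i + 1/2)\<bar> < 1/6"
    then obtain i :: nat where i: "\<bar>real j + u - (real i + 1/2)\<bar> < 1/6" by blast
    then have "real i < real j + 1" "real j < real i + 1" using u by linarith+
    then have "i = j" by linarith
    then show "\<bar>u - 1/2\<bar> < 1/6" using i by simp
  qed (use j in \<open>auto intro!: exI[of _ j]\<close>)
  also have "\<dots> \<longleftrightarrow> 1/3 < u \<and> u < 2/3" by arith
  also have "\<dots> \<longleftrightarrow> j / 3 ^ k + 1 / 3 ^ k / 3 < t \<and> t < j / 3 ^ k + 2 * (1 / 3 ^ k) / 3"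
    unfolding t' by (simp add: field_simps)
  finally show ?thesis .
qed

text \<open>Cubes of one stage share faces, so a point may lie in several of them; counting open
  middle thirds gives a criterion that does not depend on the cube.\<close>

lemma Union_cubes_eq: "(\<Union>a\<in>menger_corners m k. cube (2 * m + 1) a ((1/3) ^ k)) = menger_stage m k"
proof (induction k)
  case 0
  show ?case by (auto simp: cube_def menger_stage_def topspace_Euclidean_space)
next
  case (Suc k)
  let ?N = "2 * m + 1" and ?s = "(1/3) ^ k :: real"
  have s: "?s > 0" "?s = 1 / 3 ^ k" "(1/3) ^ Suc k = ?s / 3" by (auto simp: power_one_over)
  show ?case
  proof (intro subset_antisym subsetI)
    fix x assume "x \<in> (\<Union>a\<in>menger_corners m (Suc k). cube ?N a ((1/3) ^ Suc k))"
    then obtain a b where a: "a \<in> menger_corners m k" and b: "b \<in> subcube_corners ?N a ?s"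
      and meet: "cube ?N b (?s / 3) \<inter> \<Union> (cube_faces m ?N a ?s) \<noteq> {}" and x: "x \<in> cube ?N b (?s / 3)"
      unfolding menger_corners.simps s(3) by blast
    have b': "b i \<in> {a i, a i + ?s / 3, a i + 2 * ?s / 3}" if "i < ?N" for i
      using b that unfolding subcube_corners_def by fastforce
    have c: "card {i. i < ?N \<and> b i = a i + ?s / 3} \<le> m"
      using subcube_meets_faces[OF s(1) _ _ b'] meet b menger_corners_props(1)[OF a]
      by (simp add: subcube_corners_def)
    have xc: "b i \<le> x i" "x i \<le> b i + ?s / 3" if "i < ?N" for i
      using x that by (auto simp: cube_def)
    have xa: "a i \<le> x i" "x i \<le> a i + ?s" if "i < ?N" for i
      using xc[OF that] b'[OF that] s(1) by auto
    have "x \<in> cube ?N a ?s" using xa x by (auto simp: cube_def)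
    then have "x \<in> menger_stage m k" using Suc.IH a by blast
    moreover have "{i. i < ?N \<and> centre_dist k (x i) < 1 / (6 * 3 ^ k)} \<subseteq> {i. i < ?N \<and> b i = a i + ?s / 3}"
    proof clarify
      fix i assume i: "i < ?N" "centre_dist k (x i) < 1 / (6 * 3 ^ k)"
      obtain j where j: "j < 3 ^ k" "a i = real j / 3 ^ k" using menger_corners_props(2)[OF a i(1)] by blast
      have "a i + ?s / 3 < x i \<and> x i < a i + 2 * ?s / 3"
        using centre_dist_in_cell[OF j(1), of "x i"] xa[OF i(1)] i(2) j(2) s(2) by simp
      then show "b i = a i + ?s / 3" using b'[OF i(1)] xc[OF i(1)] by auto
    qed
    then have "card {i. i < ?N \<and> centre_dist k (x i) < 1 / (6 * 3 ^ k)} \<le> card {i. i < ?N \<and> b i = a i + ?s / 3}"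
      by (rule card_mono[rotated]) simp
    then have "level m k x"
      unfolding level_def using c by linarith
    ultimately show "x \<in> menger_stage m (Suc k)" by (simp add: menger_stage_Suc)
  next
    fix x assume x: "x \<in> menger_stage m (Suc k)"
    then obtain a where a: "a \<in> menger_corners m k" and xc: "x \<in> cube ?N a ?s"
      using Suc.IH by (auto simp: menger_stage_Suc)
    have aE: "a \<in> topspace (Euclidean_space ?N)" using menger_corners_props(1)[OF a] .
    \<comment> \<open>Ties go to the outer thirds: the middle corner is taken only if
      \<open>x i\<close> is in the open middle third, which keeps the number of middle coordinates
      minimal.\<close>
    define b where "b i = (if i \<ge> ?N \<or> x i \<le> a i + ?s / 3 then a i else if x i < a i + 2 * ?s / 3 then a i + ?s / 3
      else a i + 2 * ?s / 3)" for i
    have b': "b i \<in> {a i, a i + ?s / 3, a i + 2 * ?s / 3}" for i by (auto simp: b_def)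
    have bE: "b \<in> topspace (Euclidean_space ?N)" using aE by (auto simp: b_def topspace_Euclidean_space)
    have xa: "a i \<le> x i" "x i \<le> a i + ?s" if "i < ?N" for i using xc that by (auto simp: cube_def)
    have "\<exists>e\<in>{0, 1, 2::nat}. b i = a i + real e * (?s / 3)" for i using b'[of i] by auto
    then have bs: "b \<in> subcube_corners ?N a ?s" using bE by (simp add: subcube_corners_def)
    have "{i. i < ?N \<and> b i = a i + ?s / 3} \<subseteq> {i. i < ?N \<and> centre_dist k (x i) < 1 / (6 * 3 ^ k)}"
    proof clarify
      fix i assume i: "i < ?N" "b i = a i + ?s / 3"
      obtain j where j: "j < 3 ^ k" "a i = real j / 3 ^ k" using menger_corners_props(2)[OF a i(1)] by blast
      have "a i + ?s / 3 < x i \<and> x i < a i + 2 * ?s / 3"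
        using i s(1) by (auto simp: b_def split: if_splits)
      then show "centre_dist k (x i) < 1 / (6 * 3 ^ k)"
        using centre_dist_in_cell[OF j(1), of "x i"] xa[OF i(1)] j(2) s(2) by simp
    qed
    then have "card {i. i < ?N \<and> b i = a i + ?s / 3} \<le> card {i. i < ?N \<and> centre_dist k (x i) < 1 / (6 * 3 ^ k)}"
      by (rule card_mono[rotated]) simp
    also have "\<dots> \<le> m"
      using x unfolding menger_stage_Suc level_def by blast
    finally have "card {i. i < ?N \<and> b i = a i + ?s / 3} \<le> m" .
    then have "cube ?N b (?s / 3) \<inter> \<Union> (cube_faces m ?N a ?s) \<noteq> {}"
      using subcube_meets_faces[OF s(1) aE bE b'] by blast
    then have "b \<in> menger_corners m (Suc k)"
      unfolding menger_corners.simps s(3) using a bs by blast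
    moreover have "x \<in> cube ?N b (?s / 3)"
    proof -
      have "b i \<le> x i \<and> x i \<le> b i + ?s / 3" if "i < ?N" for i
        using xa[OF that] that by (auto simp: b_def)
      then show ?thesis using xc by (auto simp: cube_def)
    qed
    ultimately show "x \<in> (\<Union>a\<in>menger_corners m (Suc k). cube ?N a ((1/3) ^ Suc k))"
      unfolding s(3) by blast
  qed
qed

lemma menger_set_eq: "menger_set m = (\<Inter>k. menger_stage m k)"
  unfolding menger_set_def Union_cubes_eq ..

lemma topspace_menger: "topspace (menger m) = menger_set m"
  by (auto simp: menger_def menger_set_eq menger_stage_def topspace_Euclidean_space)

lemma menger_level: "y \<in> menger_set m \<Longrightarrow> level m k y"
  by (auto simp: menger_set_eq menger_stage_def intro: lessI)

lemma menger_set_in_stage: "y \<in> menger_set m \<Longrightarrow> y \<in> menger_stage m k"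
  by (auto simp: menger_set_eq)

text \<open>The indices from \<open>2 * m + 1\<close> on carry no information, since points of
  \<open>menger_set m\<close> vanish there.\<close>

lemma continuous_map_menger:
  "continuous_map P (menger m) f \<longleftrightarrow>
    (\<forall>i<2 * m + 1. continuous_map P euclideanreal (\<lambda>p. f p i)) \<and> f \<in> topspace P \<rightarrow> menger_set m"
  (is "?l \<longleftrightarrow> ?r")
proof
  assume l: ?l
  then have "continuous_map P (powertop_real UNIV) f"
    by (simp add: menger_def Euclidean_space_def continuous_map_in_subtopology)
  then show ?r
    using continuous_map_funspace[OF l] by (simp add: continuous_map_componentwise_UNIV topspace_menger)
next
  assume r: ?r
  then have "continuous_map P (Euclidean_space (2 * m + 1)) (\<lambda>x i. if i < 2 * m + 1 then f x i else 0)"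
    by (simp add: continuous_map_componentwise_Euclidean_space)
  moreover have "(\<lambda>i. if i < 2 * m + 1 then f p i else 0) = f p" if "p \<in> topspace P" for p
    using r that menger_set_in_stage[of "f p" m 0] by (force simp: menger_stage_def)
  ultimately have "continuous_map P (Euclidean_space (2 * m + 1)) f"
    by (rule continuous_map_eq)
  then show ?l using r by (auto simp: menger_def continuous_map_in_subtopology)
qed

lemma continuous_map_centre_dist: "continuous_map P euclideanreal f \<Longrightarrow> continuous_map P euclideanreal (\<lambda>p. centre_dist k (f p))"
  using continuous_map_compose[of P euclideanreal f euclideanreal "centre_dist k"]
  by (simp add: o_def centre_dist_def continuous_on_infdist)

lemma continuous_map_coordinate_menger: "i < 2 * m + 1 \<Longrightarrow> continuous_map (menger m) euclideanreal (\<lambda>y. y i)"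
  using continuous_map_menger[of "menger m" m "\<lambda>y. y"] continuous_map_id[of "menger m"] by (simp add: id_def)

lemma Hausdorff_menger: "Hausdorff_space (menger m)"
  unfolding menger_def by (intro Hausdorff_space_subtopology Hausdorff_Euclidean_space)

text \<open>The \<open>(m + 1)\<close>-st smallest distance of a coordinate to a centre.\<close>

definition spread :: "nat \<Rightarrow> nat \<Rightarrow> (nat \<Rightarrow> real) \<Rightarrow> real" where
  "spread m k y = Min ((\<lambda>I. Max ((\<lambda>i. centre_dist k (y i)) ` I)) ` {I. I \<subseteq> {..<2 * m + 1} \<and> card I = m + 1})"

lemma finite_index_sets: "finite {I. I \<subseteq> {..<2 * m + 1} \<and> card I = m + 1}"
  and index_sets_nonempty: "{I. I \<subseteq> {..<2 * m + 1} \<and> card I = m + 1} \<noteq> {}"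
proof -
  show "finite {I. I \<subseteq> {..<2 * m + 1} \<and> card I = m + 1}"
    by (rule finite_subset[of _ "Pow {..<2 * m + 1}"]) auto
  have "{..<m + 1} \<subseteq> {..<2 * m + 1} \<and> card {..<m + 1} = m + 1" by auto
  then show "{I. I \<subseteq> {..<2 * m + 1} \<and> card I = m + 1} \<noteq> {}" by blast
qed

lemma spread_ge_iff:
  "r \<le> spread m k y \<longleftrightarrow> (\<forall>I. I \<subseteq> {..<2 * m + 1} \<longrightarrow> card I = m + 1 \<longrightarrow> (\<exists>i\<in>I. r \<le> centre_dist k (y i)))"
proof -
  have "r \<le> Max ((\<lambda>i. centre_dist k (y i)) ` I) \<longleftrightarrow> (\<exists>i\<in>I. r \<le> centre_dist k (y i))"
    if "I \<subseteq> {..<2 * m + 1}" "card I = m + 1" for I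
    using that finite_subset[OF that(1)] by (subst Max_ge_iff) (auto simp: card_gt_0_iff)
  then show ?thesis
    unfolding spread_def using finite_index_sets[of m] index_sets_nonempty[of m]
    by (subst Min_ge_iff) auto
qed

text \<open>At most \<open>m\<close> small distances means that the \<open>(m + 1)\<close>-st
  smallest is not small. This trades a count for a closed condition on a continuous function, which
  can be followed through limits and perturbations.\<close>

lemma level_iff_spread: "level m k y \<longleftrightarrow> 1 / (6 * 3 ^ k) \<le> spread m k y"
proof
  assume l: "level m k y"
  show "1 / (6 * 3 ^ k) \<le> spread m k y"
    unfolding spread_ge_iff
  proof (intro allI impI)
    fix I assume I: "I \<subseteq> {..<2 * m + 1}" "card I = m + 1"
    show "\<exists>i\<in>I. 1 / (6 * 3 ^ k) \<le> centre_dist k (y i)"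
    proof (rule ccontr)
      assume "\<not> ?thesis"
      then have "I \<subseteq> {i. i < 2 * m + 1 \<and> centre_dist k (y i) < 1 / (6 * 3 ^ k)}" using I by auto
      from card_mono[OF _ this] show False using I l by (simp add: level_def)
    qed
  qed
next
  assume y: "1 / (6 * 3 ^ k) \<le> spread m k y"
  show "level m k y"
    unfolding level_def
  proof (rule ccontr)
    assume "\<not> card {i. i < 2 * m + 1 \<and> centre_dist k (y i) < 1 / (6 * 3 ^ k)} \<le> m"
    then have "m + 1 \<le> card {i. i < 2 * m + 1 \<and> centre_dist k (y i) < 1 / (6 * 3 ^ k)}" by simp
    then obtain I where I: "I \<subseteq> {i. i < 2 * m + 1 \<and> centre_dist k (y i) < 1 / (6 * 3 ^ k)}" "card I = m + 1"
      by (rule obtain_subset_with_card_n)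
    then have "I \<subseteq> {..<2 * m + 1}" by auto
    then obtain i where "i \<in> I" "1 / (6 * 3 ^ k) \<le> centre_dist k (y i)" using y I(2) unfolding spread_ge_iff by blast
    then show False using I(1) by auto
  qed
qed

lemma continuous_map_Max:
  fixes f :: "'i \<Rightarrow> 'a \<Rightarrow> real"
  assumes "finite I" "I \<noteq> {}" "\<And>i. i \<in> I \<Longrightarrow> continuous_map P euclideanreal (f i)"
  shows "continuous_map P euclideanreal (\<lambda>p. Max ((\<lambda>i. f i p) ` I))"
  using assms
proof (induction rule: finite_ne_induct)
  case (insert i I)
  then have "continuous_map P euclideanreal (\<lambda>p. max (f i p) (Max ((\<lambda>i. f i p) ` I)))"
    by (intro continuous_map_real_max) auto
  then show ?case using insert by (simp add: Max_insert)
qed simp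

lemma continuous_map_Min:
  fixes f :: "'i \<Rightarrow> 'a \<Rightarrow> real"
  assumes "finite I" "I \<noteq> {}" "\<And>i. i \<in> I \<Longrightarrow> continuous_map P euclideanreal (f i)"
  shows "continuous_map P euclideanreal (\<lambda>p. Min ((\<lambda>i. f i p) ` I))"
  using assms
proof (induction rule: finite_ne_induct)
  case (insert i I)
  then have "continuous_map P euclideanreal (\<lambda>p. min (f i p) (Min ((\<lambda>i. f i p) ` I)))"
    by (intro continuous_map_real_min) auto
  then show ?case using insert by (simp add: Min_insert)
qed simp

lemma continuous_map_spread:
  assumes "\<And>i. i < 2 * m + 1 \<Longrightarrow> continuous_map P euclideanreal (\<lambda>p. f p i)"
  shows "continuous_map P euclideanreal (\<lambda>p. spread m k (f p))"
  unfolding spread_def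
proof (rule continuous_map_Min[OF finite_index_sets index_sets_nonempty])
  fix I assume "I \<in> {I. I \<subseteq> {..<2 * m + 1} \<and> card I = m + 1}"
  then have "finite I" "I \<noteq> {}" "I \<subseteq> {..<2 * m + 1}" by (auto intro: finite_subset)
  then show "continuous_map P euclideanreal (\<lambda>p. Max ((\<lambda>i. centre_dist k (f p i)) ` I))"
    by (intro continuous_map_Max continuous_map_centre_dist assms) auto
qed

text \<open>A product of compact intervals is compact, and \<open>spread\<close> makes each level a
  closed condition in the full product.\<close>

lemma compact_menger: "compact_space (menger m)"
proof -
  define K where "K = (\<Pi>\<^sub>E i\<in>UNIV. if i < 2 * m + 1 then {0..1::real} else {0})"
  have K: "compactin (powertop_real UNIV) K"
    unfolding K_def by (subst compactin_PiE) auto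
  have "closedin (powertop_real UNIV)
      {y \<in> topspace (powertop_real UNIV). spread m k y \<in> {1 / (6 * 3 ^ k)..}}" for k
    by (rule closedin_continuous_map_preimage[where Y=euclideanreal])
      (auto intro!: continuous_map_spread continuous_map_product_projection)
  then have "closedin (powertop_real UNIV)
      (\<Inter>k. {y \<in> topspace (powertop_real UNIV). spread m k y \<in> {1 / (6 * 3 ^ k)..}})"
    by (intro closedin_Inter) auto
  then have "compactin (powertop_real UNIV)
      ((\<Inter>k. {y \<in> topspace (powertop_real UNIV). spread m k y \<in> {1 / (6 * 3 ^ k)..}}) \<inter> K)"
    using K by (rule closed_Int_compactin)
  also have "(\<Inter>k. {y \<in> topspace (powertop_real UNIV). spread m k y \<in> {1 / (6 * 3 ^ k)..}}) \<inter> K = menger_set m"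
  proof -
    have K': "y \<in> K \<longleftrightarrow> (\<forall>i\<ge>2 * m + 1. y i = 0) \<and> (\<forall>i<2 * m + 1. y i \<in> {0..1})" for y
    proof -
      have "y i \<in> (if i < 2 * m + 1 then {0..1::real} else {0}) \<longleftrightarrow>
          (2 * m + 1 \<le> i \<longrightarrow> y i = 0) \<and> (i < 2 * m + 1 \<longrightarrow> y i \<in> {0..1})" for i
        by auto
      then show ?thesis unfolding K_def by (simp add: PiE_iff) blast
    qed
    have M: "y \<in> menger_set m \<longleftrightarrow> y \<in> K \<and> (\<forall>k. level m k y)" for y
      unfolding K' menger_set_eq menger_stage_def by (auto intro: lessI)
    show ?thesis
      by (auto simp: M level_iff_spread)
  qed
  finally have "compactin (powertop_real UNIV) (menger_set m)" .
  moreover have "menger m = subtopology (powertop_real UNIV) (menger_set m)"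
  proof -
    have "{x. \<forall>i\<ge>2 * m + 1. x i = 0} \<inter> menger_set m = menger_set m"
      by (auto simp: menger_set_eq menger_stage_def)
    then show ?thesis unfolding menger_def Euclidean_space_def subtopology_subtopology by simp
  qed
  ultimately show ?thesis by (simp add: compact_space_subtopology)
qed


section \<open>Coloured covers\<close>

lemma compact_space_points:
  assumes "compact_space P" and "\<And>p. p \<in> topspace P \<Longrightarrow> openin P (U p) \<and> p \<in> U p"
  obtains F where "finite F" "F \<subseteq> topspace P" "topspace P \<subseteq> (\<Union>p\<in>F. U p)"
proof -
  have "(\<forall>V\<in>U ` topspace P. openin P V) \<and> topspace P \<subseteq> \<Union> (U ` topspace P)"
    using assms(2) by blast
  from assms(1)[unfolded compact_space_alt, THEN spec, THEN mp, OF this]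
  obtain \<F> where \<F>: "finite \<F>" "\<F> \<subseteq> U ` topspace P" "topspace P \<subseteq> \<Union>\<F>"
    by (elim exE conjE)
  from finite_subset_image[OF \<F>(1,2)] obtain F where "F \<subseteq> topspace P" "finite F" "\<F> = U ` F"
    by (elim exE conjE)
  then show ?thesis using that[of F] \<F>(3) by simp
qed

lemma compact_pos_bound:
  assumes "compact_space P" "continuous_map P euclideanreal f" "\<And>p. p \<in> topspace P \<Longrightarrow> f p > 0"
  obtains r where "r > 0" "\<And>p. p \<in> topspace P \<Longrightarrow> r \<le> f p"
proof (cases "topspace P = {}")
  case True
  then show ?thesis using that[of 1] by simp
next
  case False
  have "compact (f ` topspace P)"
    using image_compactin[OF _ assms(2), of "topspace P"] assms(1) by (simp add: compact_space_def)
  then obtain r where "r \<in> f ` topspace P" "\<forall>s\<in>f ` topspace P. r \<le> s"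
    using compact_attains_inf[of "f ` topspace P"] False by auto
  then show ?thesis using that[of r] assms(3) by auto
qed

lemma openin_less:
  assumes "continuous_map P euclideanreal f" "continuous_map P euclideanreal g"
  shows "openin P {p \<in> topspace P. f p < g p}"
proof -
  have "openin P {p \<in> topspace P. g p - f p \<in> {0<..}}"
    using assms by (intro openin_continuous_map_preimage[where Y=euclideanreal] continuous_intros) auto
  then show ?thesis by simp
qed

lemma openin_Ball:
  assumes "finite I" "\<And>i. i \<in> I \<Longrightarrow> openin P {p \<in> topspace P. Q i p}"
  shows "openin P {p \<in> topspace P. \<forall>i\<in>I. Q i p}"
  using assms
proof (induction I)
  case (insert i I)
  have "{p \<in> topspace P. \<forall>i\<in>insert i I. Q i p} = {p \<in> topspace P. Q i p} \<inter> {p \<in> topspace P. \<forall>i\<in>I. Q i p}"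
    by blast
  then show ?case using insert by auto
qed simp

text \<open>Each point has a closed neighbourhood inside some \<open>W i\<close>; finitely many of
  these cover, and they are collected according to the chosen index.\<close>

lemma closed_shrinking:
  assumes P: "compact_space P" "Hausdorff_space P"
    and W: "\<And>i. i \<in> I \<Longrightarrow> openin P (W i)" "topspace P \<subseteq> (\<Union>i\<in>I. W i)"
  obtains K where "\<And>i. i \<in> I \<Longrightarrow> closedin P (K i)" "\<And>i. i \<in> I \<Longrightarrow> K i \<subseteq> W i" "topspace P = (\<Union>i\<in>I. K i)"
proof -
  have reg: "neighbourhood_base_of (closedin P) P"
    using P compact_Hausdorff_imp_regular_space neighbourhood_base_of_closedin by blast
  have "\<exists>i U C. i \<in> I \<and> openin P U \<and> closedin P C \<and> p \<in> U \<and> U \<subseteq> C \<and> C \<subseteq> W i" if p: "p \<in> topspace P" for p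
  proof -
    obtain i where i: "i \<in> I" "p \<in> W i" using W(2) p by blast
    then show ?thesis using reg W(1)[OF i(1)] unfolding neighbourhood_base_of by metis
  qed
  then obtain i U C where iUC: "\<And>p. p \<in> topspace P \<Longrightarrow>
      i p \<in> I \<and> openin P (U p) \<and> closedin P (C p) \<and> p \<in> U p \<and> U p \<subseteq> C p \<and> C p \<subseteq> W (i p)"
    by metis
  obtain F where F: "finite F" "F \<subseteq> topspace P" "topspace P \<subseteq> (\<Union>p\<in>F. U p)"
    using compact_space_points[OF P(1), of U] iUC by metis
  define K where "K j = (\<Union>p\<in>{p \<in> F. i p = j}. C p)" for j
  show ?thesis
  proof (rule that[of K])
    show cl: "closedin P (K j)" for j
      unfolding K_def using F iUC by (intro closedin_Union) auto
    show "K j \<subseteq> W j" for j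
      unfolding K_def using F iUC by fastforce
    show "topspace P = (\<Union>j\<in>I. K j)"
    proof (intro subset_antisym subsetI)
      fix p assume "p \<in> topspace P"
      then obtain q where q: "q \<in> F" "p \<in> U q" using F by blast
      then have "p \<in> K (i q)" "i q \<in> I" using iUC[of q] F by (auto simp: K_def)
      then show "p \<in> (\<Union>j\<in>I. K j)" by blast
    qed (use cl closedin_subset in blast)
  qed
qed

text \<open>Ostrand's characterisation of covering dimension at most \<open>d\<close>, with closed sets.\<close>

definition colored :: "'a topology \<Rightarrow> nat \<Rightarrow> bool" where
  "colored P d \<longleftrightarrow> (\<forall>\<U>. finite \<U> \<and> open_cover P \<U> \<longrightarrow>
     (\<exists>\<F>::nat \<Rightarrow> 'a set set. (\<forall>j\<le>d. finite (\<F> j) \<and> pairwise disjnt (\<F> j) \<and>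
         (\<forall>C\<in>\<F> j. closedin P C \<and> (\<exists>U\<in>\<U>. C \<subseteq> U))) \<and>
       topspace P = (\<Union>j\<le>d. \<Union>(\<F> j))))"

text \<open>A coloured open refinement is enough: after its members are shrunk to closed sets,
  distinct sets of one colour are still disjoint.\<close>

lemma colored_families:
  assumes P: "compact_space P" "Hausdorff_space P" and I: "finite I"
    and W: "\<And>i. i \<in> I \<Longrightarrow> openin P (W i)" "topspace P \<subseteq> (\<Union>i\<in>I. W i)"
    and U: "\<And>i. i \<in> I \<Longrightarrow> \<exists>U\<in>\<U>. W i \<subseteq> U"
    and c: "\<And>i. i \<in> I \<Longrightarrow> c i \<le> (d::nat)"
    and disj: "\<And>i i'. \<lbrakk>i \<in> I; i' \<in> I; i \<noteq> i'; c i = c i'\<rbrakk> \<Longrightarrow> W i \<inter> W i' = {}"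
  shows "\<exists>\<F>::nat \<Rightarrow> 'a set set. (\<forall>j\<le>d. finite (\<F> j) \<and> pairwise disjnt (\<F> j) \<and>
         (\<forall>C\<in>\<F> j. closedin P C \<and> (\<exists>U\<in>\<U>. C \<subseteq> U))) \<and>
       topspace P = (\<Union>j\<le>d. \<Union>(\<F> j))"
proof -
  obtain K where K: "\<And>i. i \<in> I \<Longrightarrow> closedin P (K i)" "\<And>i. i \<in> I \<Longrightarrow> K i \<subseteq> W i" "topspace P = (\<Union>i\<in>I. K i)"
    using closed_shrinking[OF P W] by metis
  show ?thesis
  proof (intro exI[of _ "\<lambda>j. K ` {i \<in> I. c i = j}"] conjI allI impI ballI)
    fix j
    show "finite (K ` {i \<in> I. c i = j})" using I by simp
    show "pairwise disjnt (K ` {i \<in> I. c i = j})"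
    proof (rule pairwiseI)
      fix A B assume AB: "A \<in> K ` {i \<in> I. c i = j}" "B \<in> K ` {i \<in> I. c i = j}" "A \<noteq> B"
      from AB(1) obtain i where i: "i \<in> I" "c i = j" "A = K i" by auto
      from AB(2) obtain i' where i': "i' \<in> I" "c i' = j" "B = K i'" by auto
      have "W i \<inter> W i' = {}" using i i' AB(3) by (intro disj) auto
      then show "disjnt A B" using K(2)[OF i(1)] K(2)[OF i'(1)] i(3) i'(3) unfolding disjnt_def by auto
    qed
    fix C assume "C \<in> K ` {i \<in> I. c i = j}"
    then obtain i where i: "i \<in> I" "C = K i" by auto
    then show "closedin P C" "\<exists>U\<in>\<U>. C \<subseteq> U" using K(1,2)[OF i(1)] U[OF i(1)] by auto
  next
    have "(\<Union>j\<le>d. \<Union>(K ` {i \<in> I. c i = j})) = (\<Union>i\<in>I. K i)" using c by blast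
    then show "topspace P = (\<Union>j\<le>d. \<Union>(K ` {i \<in> I. c i = j}))" using K(3) by simp
  qed
qed

text \<open>The functions \<open>f V\<close> act as barycentric coordinates on the nerve of a
  refinement of order \<open>d + 1\<close>; only comparisons among them matter, so they are not
  normalised. A point is sorted by a set \<open>S\<close> of functions that dominate all the others
  there. Different sets of equal size are incomparable, so a common point would order some pair of
  functions both ways.\<close>

lemma colored_of_covering_dim:
  assumes P: "compact_space P" "Hausdorff_space P" and d: "covering_dim_le P d"
  shows "colored P d"
  unfolding colored_def
proof (intro allI impI)
  fix \<U> assume "finite \<U> \<and> open_cover P \<U>"
  then obtain \<V> where V: "finite \<V>" "open_cover P \<V>" "\<forall>V\<in>\<V>. \<exists>U\<in>\<U>. V \<subseteq> U"
    "\<forall>x\<in>topspace P. card {V\<in>\<V>. x \<in> V} \<le> d + 1"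
    using d unfolding covering_dim_le_def by metis
  have nP: "normal_space P" using P compact_Hausdorff_or_regular_imp_normal_space by blast
  obtain K where K: "\<And>V. V \<in> \<V> \<Longrightarrow> closedin P (K V)" "\<And>V. V \<in> \<V> \<Longrightarrow> K V \<subseteq> V" "topspace P = (\<Union>V\<in>\<V>. K V)"
    using closed_shrinking[OF P, of \<V> "\<lambda>V. V"] V(2) unfolding open_cover_def by (metis image_ident order_refl)
  have "\<exists>f. continuous_map P euclideanreal f \<and> f ` (topspace P - V) \<subseteq> {0} \<and> f ` K V \<subseteq> {1}" if "V \<in> \<V>" for V
  proof -
    have "closedin P (topspace P - V)" using V(2) that by (auto simp: open_cover_def)
    moreover have "disjnt (topspace P - V) (K V)" using K(2)[OF that] by (auto simp: disjnt_def)
    ultimately show ?thesis using nP K(1)[OF that] unfolding normal_space_iff_Urysohn_alt by blast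
  qed
  then have "\<forall>V\<in>\<V>. \<exists>f. continuous_map P euclideanreal f \<and> f ` (topspace P - V) \<subseteq> {0} \<and> f ` K V \<subseteq> {1}"
    by blast
  then obtain f where f': "\<forall>V\<in>\<V>. continuous_map P euclideanreal (f V) \<and> f V ` (topspace P - V) \<subseteq> {0} \<and> f V ` K V \<subseteq> {1}"
    by (rule bchoice[THEN exE])
  have f: "continuous_map P euclideanreal (f V)"
    "p \<in> topspace P \<Longrightarrow> p \<notin> V \<Longrightarrow> f V p = 0" "p \<in> K V \<Longrightarrow> f V p = 1" if "V \<in> \<V>" for V p
    using f' that by blast+
  define I where "I = {S. S \<subseteq> \<V> \<and> S \<noteq> {} \<and> card S \<le> d + 1}"
  \<comment> \<open>the barycentric subdivision of the nerve: \<open>card S - 1\<close> is the colour of \<open>W S\<close>\<close>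
  define W where "W S = {p \<in> topspace P. \<forall>V\<in>S. 0 < f V p \<and> (\<forall>V'\<in>\<V> - S. f V' p < f V p)}" for S
  show "\<exists>\<F>::nat \<Rightarrow> 'a set set. (\<forall>j\<le>d. finite (\<F> j) \<and> pairwise disjnt (\<F> j) \<and>
         (\<forall>C\<in>\<F> j. closedin P C \<and> (\<exists>U\<in>\<U>. C \<subseteq> U))) \<and> topspace P = (\<Union>j\<le>d. \<Union>(\<F> j))"
  proof (rule colored_families[OF P, of I W _ "\<lambda>S. card S - 1"])
    show "finite I" using V(1) by (auto simp: I_def intro: finite_subset[of _ "Pow \<V>"])
    show "openin P (W S)" if "S \<in> I" for S
    proof -
      have S: "S \<subseteq> \<V>" "finite S" using that V(1) by (auto simp: I_def intro: finite_subset)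
      have "openin P ({p \<in> topspace P. \<forall>V\<in>S. 0 < f V p} \<inter> {p \<in> topspace P. \<forall>V\<in>S. \<forall>V'\<in>\<V> - S. f V' p < f V p})"
        using S V(1) by (intro openin_Int openin_Ball openin_less f continuous_intros) auto
      also have "\<dots> = W S" by (auto simp: W_def)
      finally show ?thesis .
    qed
    show "topspace P \<subseteq> (\<Union>S\<in>I. W S)"
    proof
      fix p assume p: "p \<in> topspace P"
      define S where "S = {V \<in> \<V>. 0 < f V p}"
      have "S \<subseteq> {V\<in>\<V>. p \<in> V}" using f(2) p by (force simp: S_def)
      then have "card S \<le> card {V\<in>\<V>. p \<in> V}" using V(1) by (intro card_mono) auto
      then have "card S \<le> d + 1" using V(4) p by (meson le_trans)
      moreover have "S \<noteq> {}"
      proof -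
        obtain V where "V \<in> \<V>" "p \<in> K V" using K(3) p by blast
        then show ?thesis using f(3)[of V p] by (auto simp: S_def)
      qed
      moreover have "p \<in> W S"
        unfolding W_def
      proof (intro CollectI conjI ballI p)
        fix V V' assume V: "V \<in> S" "V' \<in> \<V> - S"
        then have "f V' p \<le> 0" "0 < f V p" by (auto simp: S_def not_less)
        then show "f V' p < f V p" by linarith
      qed (simp add: S_def)
      moreover have "S \<subseteq> \<V>" by (auto simp: S_def)
      ultimately show "p \<in> (\<Union>S\<in>I. W S)" unfolding I_def by blast
    qed
    show "\<exists>U\<in>\<U>. W S \<subseteq> U" if S: "S \<in> I" for S
    proof -
      obtain V where Vs: "V \<in> S" "V \<in> \<V>" using S unfolding I_def by blast
      have "W S \<subseteq> V"
      proof
        fix p assume "p \<in> W S"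
        then have "0 < f V p" "p \<in> topspace P" using Vs(1) by (auto simp: W_def)
        then show "p \<in> V" using f(2)[OF Vs(2), of p] by fastforce
      qed
      moreover obtain U where "U \<in> \<U>" "V \<subseteq> U" using V(3) Vs(2) by blast
      ultimately show ?thesis by blast
    qed
    show "card S - 1 \<le> d" if "S \<in> I" for S using that by (auto simp: I_def)
    show "W S \<inter> W S' = {}" if "S \<in> I" "S' \<in> I" "S \<noteq> S'" "card S - 1 = card S' - 1" for S S'
    proof -
      have fin: "finite S" "finite S'" using that V(1) by (auto simp: I_def intro: finite_subset)
      then have "card S > 0" "card S' > 0" using that by (auto simp: I_def card_gt_0_iff)
      then have "card S = card S'" using that(4) by linarith
      then have "\<not> S \<subseteq> S'" "\<not> S' \<subseteq> S" using that(3) fin card_subset_eq by metis+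
      then obtain V V' where "V \<in> S - S'" "V' \<in> S' - S" by blast
      then have V: "V \<in> S" "V' \<in> \<V> - S" "V' \<in> S'" "V \<in> \<V> - S'" using that by (auto simp: I_def)
      show ?thesis
      proof (rule ccontr)
        assume "W S \<inter> W S' \<noteq> {}"
        then obtain p where "p \<in> W S" "p \<in> W S'" by blast
        then have "f V' p < f V p" "f V p < f V' p" using V unfolding W_def by blast+
        then show False by simp
      qed
    qed
  qed
qed

lemma colored_closed_subspace:
  assumes P: "colored P d" and Z: "closedin P Z"
  shows "colored (subtopology P Z) d"
  unfolding colored_def
proof (intro allI impI)
  fix \<U> assume "finite \<U> \<and> open_cover (subtopology P Z) \<U>"
  then have U: "finite \<U>" "\<And>U. U \<in> \<U> \<Longrightarrow> openin (subtopology P Z) U" "\<Union>\<U> = Z"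
    using closedin_subset[OF Z] by (auto simp: open_cover_def Int_absorb1)
  then obtain E where E: "\<And>U. U \<in> \<U> \<Longrightarrow> openin P (E U)" "\<And>U. U \<in> \<U> \<Longrightarrow> U = E U \<inter> Z"
    unfolding openin_subtopology by metis
  have ZU: "Z \<subseteq> (\<Union>U\<in>\<U>. E U)" using E(2) U(3) by blast
  have ET: "E U \<subseteq> topspace P" if "U \<in> \<U>" for U using E(1)[OF that] openin_subset by blast
  have "\<Union> (insert (topspace P - Z) (E ` \<U>)) = topspace P"
  proof
    show "\<Union> (insert (topspace P - Z) (E ` \<U>)) \<subseteq> topspace P" using ET by auto
    show "topspace P \<subseteq> \<Union> (insert (topspace P - Z) (E ` \<U>))" using ZU by auto
  qed
  moreover have "openin P (topspace P - Z)" using Z by blast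
  ultimately have "open_cover P (insert (topspace P - Z) (E ` \<U>))"
    using E(1) unfolding open_cover_def by blast
  moreover have "finite (insert (topspace P - Z) (E ` \<U>))" using U(1) by simp
  ultimately obtain \<F> where F: "\<forall>j\<le>d. finite (\<F> j) \<and> pairwise disjnt (\<F> j) \<and>
         (\<forall>C\<in>\<F> j. closedin P C \<and> (\<exists>U\<in>insert (topspace P - Z) (E ` \<U>). C \<subseteq> U))"
    "topspace P = (\<Union>j\<le>d. \<Union>(\<F> j))"
    using P unfolding colored_def by metis
  show "\<exists>\<F>. (\<forall>j\<le>d. finite (\<F> j) \<and> pairwise disjnt (\<F> j) \<and>
         (\<forall>C\<in>\<F> j. closedin (subtopology P Z) C \<and> (\<exists>U\<in>\<U>. C \<subseteq> U))) \<and>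
       topspace (subtopology P Z) = (\<Union>j\<le>d. \<Union>(\<F> j))"
  \<comment> \<open>Sets that miss \<open>Z\<close> are dropped, since they may lie in the added
    complement only; every other one lies in some \<open>E U\<close>.\<close>
  proof (intro exI[of _ "\<lambda>j. (\<lambda>C. C \<inter> Z) ` {C \<in> \<F> j. C \<inter> Z \<noteq> {}}"] conjI allI impI ballI)
    fix j assume j: "j \<le> d"
    show "finite ((\<lambda>C. C \<inter> Z) ` {C \<in> \<F> j. C \<inter> Z \<noteq> {}})" using F j by simp
    show "pairwise disjnt ((\<lambda>C. C \<inter> Z) ` {C \<in> \<F> j. C \<inter> Z \<noteq> {}})"
      using F(1) j unfolding pairwise_def disjnt_def by blast
    fix C' assume "C' \<in> (\<lambda>C. C \<inter> Z) ` {C \<in> \<F> j. C \<inter> Z \<noteq> {}}"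
    then obtain C where C: "C \<in> \<F> j" "C \<inter> Z \<noteq> {}" "C' = C \<inter> Z" by blast
    then have "closedin P C" "\<exists>U\<in>insert (topspace P - Z) (E ` \<U>). C \<subseteq> U" using F(1) j by blast+
    then show "closedin (subtopology P Z) C'" "\<exists>U\<in>\<U>. C' \<subseteq> U"
    proof -
      assume "closedin P C" "\<exists>U\<in>insert (topspace P - Z) (E ` \<U>). C \<subseteq> U"
      then obtain U where "U \<in> \<U>" "C \<subseteq> E U" using C(2) by blast
      then show "closedin (subtopology P Z) C'" "\<exists>U\<in>\<U>. C' \<subseteq> U"
        using C(3) E(2) \<open>closedin P C\<close> by (auto simp: closedin_subtopology) 
    qed
  next
    have "topspace (subtopology P Z) = topspace P \<inter> Z" by simp
    also have "\<dots> = (\<Union>j\<le>d. \<Union> ((\<lambda>C. C \<inter> Z) ` {C \<in> \<F> j. C \<inter> Z \<noteq> {}}))" unfolding F(2) by blast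
    finally show "topspace (subtopology P Z) = (\<Union>j\<le>d. \<Union> ((\<lambda>C. C \<inter> Z) ` {C \<in> \<F> j. C \<inter> Z \<noteq> {}}))" .
  qed
qed

lemma continuous_piecewise_const:
  assumes "finite \<C>" "pairwise disjnt \<C>" "\<And>C. C \<in> \<C> \<Longrightarrow> closedin P C" "\<And>C. C \<in> \<C> \<Longrightarrow> c C \<in> topspace Y"
  obtains h where "continuous_map (subtopology P (\<Union>\<C>)) Y h" "\<And>C p. C \<in> \<C> \<Longrightarrow> p \<in> C \<Longrightarrow> h p = c C"
proof -
  let ?P = "subtopology P (\<Union>\<C>)"
  have sub: "C \<subseteq> topspace P" if "C \<in> \<C>" for C using assms(3) that closedin_subset by blast
  obtain h where h: "continuous_map ?P Y h" "\<And>p C. C \<in> \<C> \<Longrightarrow> p \<in> topspace ?P \<inter> C \<Longrightarrow> h p = c C"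
  proof (rule pasting_lemma_exists_closed[of \<C> ?P "\<lambda>C. C" Y "\<lambda>C p. c C"])
    show "closedin ?P C" if "C \<in> \<C>" for C
      using that assms(3)[OF that] by (simp add: closedin_closed_subtopology[OF closedin_Union[OF assms(1,3)]] Union_upper)
    show "c C = c D" if "C \<in> \<C>" "D \<in> \<C>" "x \<in> topspace ?P \<inter> C \<inter> D" for C D x
      using that assms(2) by (metis IntD1 IntD2 disjnt_iff pairwiseD)
  qed (use assms in auto)
  show ?thesis
  proof (rule that[OF h(1)])
    fix C p assume "C \<in> \<C>" "p \<in> C"
    then show "h p = c C" using h(2)[of C p] sub[of C] by auto
  qed
qed


section \<open>Pushing maps off the centres\<close>

lemma coloredE:
  assumes "colored P d" "finite \<U>" "open_cover P \<U>"
  obtains \<F> :: "nat \<Rightarrow> 'a set set" where "\<And>j. j \<le> d \<Longrightarrow> finite (\<F> j)" "\<And>j. j \<le> d \<Longrightarrow> pairwise disjnt (\<F> j)"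
    "\<And>j C. j \<le> d \<Longrightarrow> C \<in> \<F> j \<Longrightarrow> closedin P C" "\<And>j C. j \<le> d \<Longrightarrow> C \<in> \<F> j \<Longrightarrow> \<exists>U\<in>\<U>. C \<subseteq> U"
    "topspace P = (\<Union>j\<le>d. \<Union>(\<F> j))"
proof -
  have "finite \<U> \<and> open_cover P \<U>" using assms by blast
  from assms(1)[unfolded colored_def, THEN spec, THEN mp, OF this] obtain \<F> :: "nat \<Rightarrow> 'a set set"
    where "(\<forall>j\<le>d. finite (\<F> j) \<and> pairwise disjnt (\<F> j) \<and> (\<forall>C\<in>\<F> j. closedin P C \<and> (\<exists>U\<in>\<U>. C \<subseteq> U)))
      \<and> topspace P = (\<Union>j\<le>d. \<Union>(\<F> j))"
    by (rule exE)
  then show ?thesis by (intro that[of \<F>]) auto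
qed

lemma exists_near_notin_cell_centres:
  assumes "e > 0"
  obtains c where "\<bar>c - t\<bar> < e" "c \<notin> cell_centres k"
proof -
  have "infinite {t<..<t + e}" using assms by simp
  then have "{t<..<t + e} - cell_centres k \<noteq> {}" using finite_cell_centres[of k] by (metis Diff_infinite_finite finite.emptyI)
  then obtain c where "c \<in> {t<..<t + e}" "c \<notin> cell_centres k" by blast
  then show ?thesis using that[of c] by auto
qed

text \<open>
  The \<open>m + 1\<close> colours are matched with the \<open>m + 1\<close> coordinates in \<open>I\<close>: on the sets of a given colour
  the matching coordinate is made locally constant, with values off the centres.
\<close>

lemma avoid_centres_one:
  fixes g :: "nat \<Rightarrow> 'a \<Rightarrow> real"
  assumes P: "compact_space P" "Hausdorff_space P" "colored P m"
    and g: "\<And>i. continuous_map P euclideanreal (g i)"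
    and I: "finite I" "card I = m + 1" and e: "e > 0"
  obtains g' where "\<And>i. continuous_map P euclideanreal (g' i)"
    "\<And>i p. p \<in> topspace P \<Longrightarrow> \<bar>g' i p - g i p\<bar> \<le> e"
    "\<And>p. p \<in> topspace P \<Longrightarrow> \<exists>i\<in>I. g' i p \<notin> cell_centres k"
proof -
  have nP: "normal_space P" using P compact_Hausdorff_or_regular_imp_normal_space by blast
  define U where "U p = {q \<in> topspace P. \<forall>i\<in>I. \<bar>g i q - g i p\<bar> < e / 4}" for p
  have U: "openin P (U p) \<and> p \<in> U p" if "p \<in> topspace P" for p
    unfolding U_def using that e
    by (auto intro!: openin_Ball I openin_less continuous_intros g)
  obtain F where F: "finite F" "F \<subseteq> topspace P" "topspace P \<subseteq> (\<Union>p\<in>F. U p)"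
    using compact_space_points[OF P(1) U] by blast
  have "U p \<subseteq> topspace P" for p by (auto simp: U_def)
  then have "open_cover P (U ` F)"
    using F U by (auto simp: open_cover_def)
  then obtain \<F> :: "nat \<Rightarrow> 'a set set" where \<F>: "\<And>j. j \<le> m \<Longrightarrow> finite (\<F> j)" "\<And>j. j \<le> m \<Longrightarrow> pairwise disjnt (\<F> j)"
    "\<And>j C. j \<le> m \<Longrightarrow> C \<in> \<F> j \<Longrightarrow> closedin P C" "\<And>j C. j \<le> m \<Longrightarrow> C \<in> \<F> j \<Longrightarrow> \<exists>V\<in>U ` F. C \<subseteq> V"
    "topspace P = (\<Union>j\<le>m. \<Union>(\<F> j))"
    using coloredE[OF P(3) finite_imageI[OF F(1)]] by blast
  obtain h where h: "bij_betw h {..m} I"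
    using finite_same_card_bij[of "{..m}" I] I by auto
  have ex: "\<exists>u. continuous_map P euclideanreal u \<and> u ` topspace P \<subseteq> {-e..e} \<and>
      (\<forall>p\<in>\<Union>(\<F> j). g (h j) p + u p \<notin> cell_centres k)" if j: "j \<le> m" for j
  proof -
    have hj: "h j \<in> I" using h j by (auto simp: bij_betw_def)
    have "\<exists>c. c \<notin> cell_centres k \<and> (\<forall>p\<in>C. \<bar>c - g (h j) p\<bar> \<le> e)" if C: "C \<in> \<F> j" for C
    proof -
      obtain q where "C \<subseteq> U q" using \<F>(4)[OF j C] by blast
      moreover obtain c where "\<bar>c - g (h j) q\<bar> < e / 4" "c \<notin> cell_centres k"
        using exists_near_notin_cell_centres[of "e / 4" "g (h j) q" k] e by auto
      moreover have "\<bar>c - g (h j) p\<bar> \<le> e" if "p \<in> U q" for p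
      proof -
        have "\<bar>g (h j) p - g (h j) q\<bar> < e / 4" using that hj unfolding U_def by blast
        then show ?thesis using \<open>\<bar>c - g (h j) q\<bar> < e / 4\<close> e by linarith
      qed
      ultimately show ?thesis by blast
    qed
    then obtain c where c: "\<And>C. C \<in> \<F> j \<Longrightarrow> c C \<notin> cell_centres k \<and> (\<forall>p\<in>C. \<bar>c C - g (h j) p\<bar> \<le> e)"
      by metis
    have Fj: "finite (\<F> j)" "pairwise disjnt (\<F> j)" "\<And>C. C \<in> \<F> j \<Longrightarrow> closedin P C"
      using \<F>(1-3)[OF j] by auto
    obtain w where w: "continuous_map (subtopology P (\<Union>(\<F> j))) euclideanreal w"
      "\<And>C p. C \<in> \<F> j \<Longrightarrow> p \<in> C \<Longrightarrow> w p = c C"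
      using continuous_piecewise_const[OF Fj, of c euclideanreal] by auto
    \<comment> \<open>The difference is extended rather than the constant values, so that the bound
      \<open>e\<close> holds on the whole space.\<close>
    have cw: "continuous_map (subtopology P (\<Union>(\<F> j))) euclideanreal (\<lambda>p. w p - g (h j) p)"
      by (intro continuous_intros w(1) continuous_map_from_subtopology g)
    have cl: "closedin P (\<Union>(\<F> j))" using Fj by (intro closedin_Union)
    have im: "(\<lambda>p. w p - g (h j) p) ` (\<Union>(\<F> j)) \<subseteq> {-e..e}"
    proof clarify
      fix p C assume C: "C \<in> \<F> j" "p \<in> C"
      then have "\<bar>w p - g (h j) p\<bar> \<le> e" using c[OF C(1)] w(2) by auto
      then show "w p - g (h j) p \<in> {-e..e}" by auto
    qed
    have "-e \<le> e" using e by simp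
    then obtain u where u: "continuous_map P euclideanreal u"
      "\<And>p. p \<in> \<Union>(\<F> j) \<Longrightarrow> u p = w p - g (h j) p" "u ` topspace P \<subseteq> {-e..e}"
      using Tietze_extension_closed_real_interval[OF nP cl cw im] by blast
    have "g (h j) p + u p \<notin> cell_centres k" if pF: "p \<in> \<Union>(\<F> j)" for p
    proof -
      obtain C where C: "C \<in> \<F> j" "p \<in> C" using pF by blast
      then have "g (h j) p + u p = c C" using u(2)[OF pF] w(2)[OF C] by auto
      then show ?thesis using c[OF C(1)] by simp
    qed
    then show ?thesis using u by blast
  qed
  have "\<forall>j\<in>{..m}. \<exists>u. continuous_map P euclideanreal u \<and> u ` topspace P \<subseteq> {-e..e} \<and>
      (\<forall>p\<in>\<Union>(\<F> j). g (h j) p + u p \<notin> cell_centres k)"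
    using ex by simp
  then obtain u where u: "\<forall>j\<in>{..m}. continuous_map P euclideanreal (u j) \<and> u j ` topspace P \<subseteq> {-e..e} \<and>
      (\<forall>p\<in>\<Union>(\<F> j). g (h j) p + u j p \<notin> cell_centres k)"
    by (rule bchoice[THEN exE])
  \<comment> \<open>Colour \<open>j\<close> perturbs the coordinate \<open>h j\<close> alone, so the
    perturbations for different colours do not interfere.\<close>
  define g' where "g' i p = (if i \<in> I then g i p + u (the_inv_into {..m} h i) p else g i p)" for i p
  have inv: "the_inv_into {..m} h i \<in> {..m}" if "i \<in> I" for i
    using h that by (metis bij_betw_imp_inj_on bij_betw_imp_surj_on order_refl the_inv_into_into)
  have g'h: "g' (h j) p = g (h j) p + u j p" if "j \<le> m" for j p
    using h that by (auto simp: g'_def bij_betw_def the_inv_into_f_f)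
  show ?thesis
  proof (rule that[of g'])
    show "continuous_map P euclideanreal (g' i)" for i
    proof (cases "i \<in> I")
      case True
      then have "g' i = (\<lambda>p. g i p + u (the_inv_into {..m} h i) p)" by (simp add: g'_def fun_eq_iff)
      then show ?thesis using u inv[OF True] g[of i] by (simp add: continuous_map_add)
    next
      case False
      then have "g' i = g i" by (simp add: g'_def fun_eq_iff)
      then show ?thesis using g by simp
    qed
    show "\<bar>g' i p - g i p\<bar> \<le> e" if p: "p \<in> topspace P" for i p
    proof (cases "i \<in> I")
      case True
      then have "u (the_inv_into {..m} h i) p \<in> {-e..e}" using u inv[OF True] p by blast
      then show ?thesis by (auto simp: g'_def)
    qed (use e in \<open>auto simp: g'_def\<close>)
    show "\<exists>i\<in>I. g' i p \<notin> cell_centres k" if p: "p \<in> topspace P" for p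
    proof -
      obtain j where j: "j \<le> m" "p \<in> \<Union>(\<F> j)" using \<F>(5) p by blast
      then have "g' (h j) p \<notin> cell_centres k" using u g'h by auto
      moreover have "h j \<in> I" using h j by (auto simp: bij_betw_def)
      ultimately show ?thesis by blast
    qed
  qed
qed

text \<open>Induction over the index sets: compactness turns avoidance into a uniform distance
  \<open>r\<close>, and a later perturbation of size at most \<open>r / 2\<close> cannot undo
  it.\<close>

lemma avoid_centres:
  fixes g :: "nat \<Rightarrow> 'a \<Rightarrow> real"
  assumes P: "compact_space P" "Hausdorff_space P" "colored P m"
    and g: "\<And>i. continuous_map P euclideanreal (g i)"
    and \<I>: "finite \<I>" "\<And>I. I \<in> \<I> \<Longrightarrow> finite I \<and> card I = m + 1" and e: "e > 0"
  shows "\<exists>g' r. (\<forall>i. continuous_map P euclideanreal (g' i)) \<and>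
    (\<forall>i. \<forall>p\<in>topspace P. \<bar>g' i p - g i p\<bar> \<le> e) \<and> r > 0 \<and>
    (\<forall>I\<in>\<I>. \<forall>p\<in>topspace P. \<exists>i\<in>I. centre_dist k (g' i p) \<ge> r)"
  using \<I> e
proof (induction \<I> arbitrary: e rule: finite_induct)
  case empty
  then show ?case using g by (intro exI[of _ g] exI[of _ 1]) auto
next
  case (insert I \<I>)
  obtain g1 r where g1: "\<forall>i. continuous_map P euclideanreal (g1 i)"
    "\<forall>i. \<forall>p\<in>topspace P. \<bar>g1 i p - g i p\<bar> \<le> e / 2" "r > 0"
    "\<forall>I\<in>\<I>. \<forall>p\<in>topspace P. \<exists>i\<in>I. centre_dist k (g1 i p) \<ge> r"
    using insert.IH[of "e / 2"] insert.prems by auto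
  have I: "finite I" "card I = m + 1" using insert.prems by auto
  then have "I \<noteq> {}" by auto
  define e' where "e' = min (e / 2) (r / 2)"
  have e': "e' > 0" using insert.prems g1(3) by (simp add: e'_def)
  obtain g2 where g2: "\<And>i. continuous_map P euclideanreal (g2 i)"
    "\<And>i p. p \<in> topspace P \<Longrightarrow> \<bar>g2 i p - g1 i p\<bar> \<le> e'"
    "\<And>p. p \<in> topspace P \<Longrightarrow> \<exists>i\<in>I. g2 i p \<notin> cell_centres k"
    using avoid_centres_one[OF P, of g1 I e' k] g1(1) I e' by blast
  have "continuous_map P euclideanreal (\<lambda>p. Max ((\<lambda>i. centre_dist k (g2 i p)) ` I))"
    using I \<open>I \<noteq> {}\<close> by (intro continuous_map_Max continuous_map_centre_dist g2(1)) auto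
  moreover have "0 < Max ((\<lambda>i. centre_dist k (g2 i p)) ` I)" if p: "p \<in> topspace P" for p
    using g2(3)[OF p] I \<open>I \<noteq> {}\<close> by (subst Max_gr_iff) (auto simp: centre_dist_pos_iff)
  ultimately obtain s where s: "s > 0" "\<And>p. p \<in> topspace P \<Longrightarrow> s \<le> Max ((\<lambda>i. centre_dist k (g2 i p)) ` I)"
    using compact_pos_bound[OF P(1), of "\<lambda>p. Max ((\<lambda>i. centre_dist k (g2 i p)) ` I)"] by blast
  show ?case
  proof (intro exI[of _ g2] exI[of _ "min s (r / 2)"] conjI allI ballI)
    fix i p assume p: "p \<in> topspace P"
    have "\<bar>g2 i p - g1 i p\<bar> \<le> e / 2" using g2(2)[OF p, of i] by (simp add: e'_def)
    moreover have "\<bar>g1 i p - g i p\<bar> \<le> e / 2" using g1(2) p by blast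
    ultimately show "\<bar>g2 i p - g i p\<bar> \<le> e" by linarith
  next
    fix J p assume J: "J \<in> insert I \<I>" and p: "p \<in> topspace P"
    show "\<exists>i\<in>J. min s (r / 2) \<le> centre_dist k (g2 i p)"
    proof (cases "J = I")
      case True
      obtain i where "i \<in> I" "s \<le> centre_dist k (g2 i p)"
        using s(2)[OF p] I \<open>I \<noteq> {}\<close> by (auto simp: Max_ge_iff)
      then show ?thesis using True by (auto intro!: bexI[of _ i])
    next
      case False
      then obtain i where i: "i \<in> J" "r \<le> centre_dist k (g1 i p)" using J g1(4) p by blast
      have "centre_dist k (g1 i p) \<le> centre_dist k (g2 i p) + \<bar>g1 i p - g2 i p\<bar>" by (rule centre_dist_lipschitz)
      moreover have "\<bar>g2 i p - g1 i p\<bar> \<le> r / 2" using g2(2)[OF p, of i] by (simp add: e'_def)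
      ultimately have "min s (r / 2) \<le> centre_dist k (g2 i p)" using i(2) by linarith
      then show ?thesis using i(1) by blast
    qed
  qed (use g2 s g1 in auto)
qed

text \<open>The factor is just large enough to raise the \<open>(m + 1)\<close>-st smallest distance
  to the threshold \<open>1 / (6 * 3 ^ k)\<close>. It equals 1 where level \<open>k\<close> already
  holds and is continuous as long as \<open>spread\<close> stays positive.\<close>

definition push_out :: "nat \<Rightarrow> nat \<Rightarrow> (nat \<Rightarrow> real) \<Rightarrow> nat \<Rightarrow> real" where
  "push_out m k y i = (if i < 2 * m + 1
     then stretch k (1 / (6 * 3 ^ k) / min (1 / (6 * 3 ^ k)) (spread m k y)) (y i) else 0)"

lemma level_same_cell:
  assumes "level m j y" "j < k" "\<And>i. i < 2 * m + 1 \<Longrightarrow> same_cell k (y i) (z i)"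
  shows "level m j z"
proof -
  have "{i. i < 2 * m + 1 \<and> centre_dist j (z i) < 1 / (6 * 3 ^ j)} \<subseteq> {i. i < 2 * m + 1 \<and> centre_dist j (y i) < 1 / (6 * 3 ^ j)}"
    using same_cell_centre_dist[OF assms(3) assms(2)] by (auto simp: not_le[symmetric])
  from card_mono[OF _ this] show ?thesis using assms(1) by (simp add: level_def)
qed

lemma menger_stage_same_cell:
  assumes "y \<in> menger_stage m k" "\<And>i. i < 2 * m + 1 \<Longrightarrow> same_cell k (y i) (z i)" "\<And>i. i \<ge> 2 * m + 1 \<Longrightarrow> z i = 0"
  shows "z \<in> menger_stage m k"
  using assms(1,3) same_cell_bounds[OF assms(2)] level_same_cell[OF _ _ assms(2)] unfolding menger_stage_def by auto

text \<open>Staying in the cells of level \<open>k\<close> preserves the earlier levels and gives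
  the crude bound. The finer bound \<open>6 * d\<close> is for controlled extension: if
  \<open>spread\<close> misses the threshold by at most \<open>d\<close>, itself at most half of the
  threshold, then \<open>q - 1 \<le> 12 * 3 ^ k * d\<close>, and \<open>stretch_dist\<close> divides
  this by \<open>2 * 3 ^ k\<close>.\<close>

lemma push_out_properties:
  assumes y: "y \<in> menger_stage m k" and s: "spread m k y > 0"
  shows "push_out m k y \<in> menger_stage m (Suc k)"
    and "i < 2 * m + 1 \<Longrightarrow> \<bar>push_out m k y i - y i\<bar> \<le> 1 / 3 ^ k"
    and "i < 2 * m + 1 \<Longrightarrow> 0 \<le> d \<Longrightarrow> d \<le> 1 / (12 * 3 ^ k) \<Longrightarrow> 1 / (6 * 3 ^ k) - d \<le> spread m k y \<Longrightarrow>
      \<bar>push_out m k y i - y i\<bar> \<le> 6 * d"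
    and "level m k y \<Longrightarrow> push_out m k y = y"
proof -
  define l where "l = min (1 / (6 * 3 ^ k)) (spread m k y)"
  define q where "q = 1 / (6 * 3 ^ k) / l"
  have l: "0 < l" "l \<le> 1 / (6 * 3 ^ k)" "l \<le> spread m k y" using s by (auto simp: l_def)
  then have q: "q \<ge> 1" unfolding q_def by (subst le_divide_eq_1_pos) auto
  have q': "q = 1 / (6 * (l * 3 ^ k))" by (simp add: q_def)
  have r: "push_out m k y i = (if i < 2 * m + 1 then stretch k q (y i) else 0)" for i
    unfolding push_out_def q_def l_def ..
  have y01: "y i \<in> {0..1}" if "i < 2 * m + 1" for i using y that unfolding menger_stage_def by blast
  have sc: "same_cell k (y i) (push_out m k y i)" if "i < 2 * m + 1" for i
    using same_cell_stretch[OF q y01[OF that]] that by (simp add: r)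
  have "push_out m k y \<in> menger_stage m k"
    by (rule menger_stage_same_cell[OF y sc]) (auto simp: r)
  moreover have "level m k (push_out m k y)"
    unfolding level_iff_spread spread_ge_iff
  proof (intro allI impI)
    fix I assume I: "I \<subseteq> {..<2 * m + 1}" "card I = m + 1"
    then obtain i where i: "i \<in> I" "l \<le> centre_dist k (y i)" using l(3) unfolding spread_ge_iff by blast
    then have iN: "i < 2 * m + 1" using I by auto
    have "centre_dist k (stretch k (1 / (6 * (l * 3 ^ k))) (y i)) \<ge> 1 / (6 * 3 ^ k)"
      by (rule stretch_centre_dist) (use l i y01[OF iN] in \<open>auto simp: field_simps\<close>)
    then show "\<exists>i\<in>I. 1 / (6 * 3 ^ k) \<le> centre_dist k (push_out m k y i)" using i(1) iN by (auto simp: r q')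
  qed
  ultimately show "push_out m k y \<in> menger_stage m (Suc k)" by (simp add: menger_stage_Suc)
  show "i < 2 * m + 1 \<Longrightarrow> \<bar>push_out m k y i - y i\<bar> \<le> 1 / 3 ^ k"
    using same_cell_dist[OF sc] y01 by (auto simp: abs_minus_commute)
  show "\<bar>push_out m k y i - y i\<bar> \<le> 6 * d"
    if i: "i < 2 * m + 1" and d: "0 \<le> d" "d \<le> 1 / (12 * 3 ^ k)" "1 / (6 * 3 ^ k) - d \<le> spread m k y"
  proof -
    have ld: "1 / (6 * 3 ^ k) - d \<le> l" using d by (simp add: l_def)
    then have l12: "1 / (12 * 3 ^ k) \<le> l" using d(2) by (simp add: field_simps)
    have "q - 1 = (1 / (6 * 3 ^ k) - l) / l" using l by (simp add: q_def field_simps)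
    also have "\<dots> \<le> d / (1 / (12 * 3 ^ k))"
      using ld l12 d l by (intro frac_le) auto
    finally have "(q - 1) / (2 * 3 ^ k) \<le> d / (1 / (12 * 3 ^ k)) / (2 * 3 ^ k)"
      by (intro divide_right_mono) auto
    also have "\<dots> = 6 * d" by simp
    finally show ?thesis using stretch_dist[OF q y01[OF i], of k] i by (simp add: r)
  qed
  show "push_out m k y = y" if "level m k y"
  proof
    fix i
    have "q = 1" using that by (simp add: level_iff_spread q_def l_def)
    moreover have "y i = 0" if "i \<ge> 2 * m + 1" using y that by (auto simp: menger_stage_def)
    ultimately show "push_out m k y i = y i" using stretch_id[OF y01[of i]] by (auto simp: r)
  qed
qed

lemma continuous_map_push_out:
  assumes "\<And>i. i < 2 * m + 1 \<Longrightarrow> continuous_map P euclideanreal (\<lambda>p. f p i)"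
    and "\<And>p. p \<in> topspace P \<Longrightarrow> spread m k (f p) > 0"
  shows "continuous_map P euclideanreal (\<lambda>p. push_out m k (f p) i)"
proof (cases "i < 2 * m + 1")
  case True
  have "min (1 / (6 * 3 ^ k)) (spread m k (f p)) \<noteq> 0" if "p \<in> topspace P" for p
    using assms(2)[OF that] by (auto simp: min_def)
  then show ?thesis
    unfolding push_out_def stretch_def using True
    by (simp only: if_True) (intro continuous_intros continuous_map_spread assms(1), auto)
qed (simp add: push_out_def)

lemma spread_gr_iff:
  "r < spread m k y \<longleftrightarrow> (\<forall>I. I \<subseteq> {..<2 * m + 1} \<longrightarrow> card I = m + 1 \<longrightarrow> (\<exists>i\<in>I. r < centre_dist k (y i)))"
proof -
  have "r < Max ((\<lambda>i. centre_dist k (y i)) ` I) \<longleftrightarrow> (\<exists>i\<in>I. r < centre_dist k (y i))"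
    if "I \<subseteq> {..<2 * m + 1}" "card I = m + 1" for I
    using that finite_subset[OF that(1)] by (subst Max_gr_iff) (auto simp: card_gt_0_iff)
  then show ?thesis
    unfolding spread_def using finite_index_sets[of m] index_sets_nonempty[of m]
    by (subst Min_gr_iff) auto
qed

text \<open>An order statistic of 1-Lipschitz functions is 1-Lipschitz for the maximum norm.\<close>

lemma spread_lipschitz:
  assumes "\<And>i. i < 2 * m + 1 \<Longrightarrow> \<bar>y i - z i\<bar> \<le> d"
  shows "spread m k z - d \<le> spread m k y"
  unfolding spread_ge_iff
proof (intro allI impI)
  fix I assume I: "I \<subseteq> {..<2 * m + 1}" "card I = m + 1"
  then obtain i where i: "i \<in> I" "spread m k z \<le> centre_dist k (z i)"
    using spread_ge_iff[of "spread m k z" m k z] by auto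
  then have "\<bar>z i - y i\<bar> \<le> d" using assms[of i] I by (auto simp: abs_minus_commute)
  then have "spread m k z - d \<le> centre_dist k (y i)" using i(2) centre_dist_lipschitz[of k "z i" "y i"] by linarith
  then show "\<exists>i\<in>I. spread m k z - d \<le> centre_dist k (y i)" using i(1) by blast
qed


text \<open>An unrestricted perturbation would change \<open>g\<close> on \<open>A\<close> and could
  carry a coordinate into another cell, spoiling the earlier levels. Two cut-offs prevent this:
  \<open>\<zeta>\<close> switches the perturbation off where level \<open>k\<close> holds,
  \<open>\<theta>\<close> for a coordinate outside the middle thirds.\<close>

lemma improve_level:
  fixes g :: "'a \<Rightarrow> nat \<Rightarrow> real"
  assumes P: "compact_space P" "Hausdorff_space P" "colored P m"
    and g: "\<And>i. continuous_map P euclideanreal (\<lambda>p. g p i)" "\<And>p. p \<in> topspace P \<Longrightarrow> g p \<in> menger_stage m k"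
    and A: "A \<subseteq> topspace P" "\<And>p. p \<in> A \<Longrightarrow> level m k (g p)"
  obtains g' where "\<And>i. continuous_map P euclideanreal (\<lambda>p. g' p i)"
    "\<And>p. p \<in> topspace P \<Longrightarrow> g' p \<in> menger_stage m (Suc k)" "\<And>p. p \<in> A \<Longrightarrow> g' p = g p"
    "\<And>p i. p \<in> topspace P \<Longrightarrow> i < 2 * m + 1 \<Longrightarrow> \<bar>g' p i - g p i\<bar> \<le> 2 / 3 ^ k"
proof -
  define r :: real where "r = 1 / (6 * 3 ^ k)"
  have r: "r > 0" by (simp add: r_def)
  let ?\<I> = "{I. I \<subseteq> {..<2 * m + 1} \<and> card I = m + 1}"
  have fI: "finite I \<and> card I = m + 1" if "I \<in> ?\<I>" for I using that finite_subset by auto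
  have r4: "r / 4 > 0" using r by simp
  have "\<exists>g1 s. (\<forall>i. continuous_map P euclideanreal (g1 i)) \<and>
    (\<forall>i. \<forall>p\<in>topspace P. \<bar>g1 i p - g p i\<bar> \<le> r / 4) \<and> s > 0 \<and>
    (\<forall>I\<in>?\<I>. \<forall>p\<in>topspace P. \<exists>i\<in>I. centre_dist k (g1 i p) \<ge> s)"
    by (rule avoid_centres[OF P g(1) finite_index_sets fI r4])
  then obtain g1 s where g1: "\<forall>i. continuous_map P euclideanreal (g1 i)"
    "\<forall>i. \<forall>p\<in>topspace P. \<bar>g1 i p - g p i\<bar> \<le> r / 4" "s > 0"
    "\<forall>I\<in>?\<I>. \<forall>p\<in>topspace P. \<exists>i\<in>I. centre_dist k (g1 i p) \<ge> s"
    by (elim exE conjE)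
  \<comment> \<open>With \<open>r\<close> the threshold, both cut-offs are 1 up to
    \<open>r / 2\<close> and 0 from \<open>r\<close> on.\<close>
  define \<zeta> where "\<zeta> p = max 0 (min 1 (2 - 2 * spread m k (g p) / r))" for p
  define \<theta> where "\<theta> i p = max 0 (min 1 (2 - 2 * centre_dist k (g p i) / r))" for i p
  define g2 where "g2 p i = (if i < 2 * m + 1 then g p i + \<zeta> p * \<theta> i p * (g1 i p - g p i) else 0)" for p i
  have z01: "0 \<le> \<zeta> p" "\<zeta> p \<le> 1" "0 \<le> \<theta> i p" "\<theta> i p \<le> 1" for i p by (auto simp: \<zeta>_def \<theta>_def)
  then have zt: "0 \<le> \<zeta> p * \<theta> i p" "\<zeta> p * \<theta> i p \<le> 1" for i p by (auto simp: mult_le_one)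
  have c2: "continuous_map P euclideanreal (\<lambda>p. g2 p i)" for i
  proof (cases "i < 2 * m + 1")
    case True
    have cz: "continuous_map P euclideanreal \<zeta>"
      unfolding \<zeta>_def using r by (intro continuous_intros continuous_map_spread g(1)) auto
    have ct: "continuous_map P euclideanreal (\<theta> i)"
      unfolding \<theta>_def using r by (intro continuous_intros continuous_map_centre_dist g(1)) auto
    have c1: "continuous_map P euclideanreal (g1 i)" using g1(1) by blast
    show ?thesis unfolding g2_def using True
      by (simp only: if_True) (intro continuous_intros cz ct c1 g(1))
  qed (simp add: g2_def)
  have d2: "\<bar>g2 p i - g p i\<bar> \<le> r / 4" if p: "p \<in> topspace P" and i: "i < 2 * m + 1" for p i
  proof -
    have "\<bar>g2 p i - g p i\<bar> = (\<zeta> p * \<theta> i p) * \<bar>g1 i p - g p i\<bar>"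
      using i zt[of p i] by (simp add: g2_def abs_mult z01)
    also have "\<dots> \<le> 1 * (r / 4)" using zt[of p i] g1(2) p by (intro mult_mono) auto
    finally show ?thesis by simp
  qed
  have sc: "same_cell k (g p i) (g2 p i)" if p: "p \<in> topspace P" and i: "i < 2 * m + 1" for p i
  proof (cases "centre_dist k (g p i) < r")
    case True
    have "centre_dist k (g p i) + \<bar>g p i - g2 p i\<bar> < 3 * r"
      using d2[OF p i] True r by linarith
    also have "3 * r = 1 / (2 * 3 ^ k)" by (simp add: r_def)
    finally show ?thesis by (rule same_cell_near_centre)
  next
    case False
    then have "2 - 2 * centre_dist k (g p i) / r \<le> 0" using r by (simp add: field_simps)
    then have "\<theta> i p = 0" by (simp add: \<theta>_def)
    then show ?thesis using i by (simp add: g2_def same_cell_refl)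
  qed
  have M2: "g2 p \<in> menger_stage m k" if "p \<in> topspace P" for p
    by (rule menger_stage_same_cell[OF g(2)[OF that] sc[OF that]]) (auto simp: g2_def)
  have s2: "spread m k (g2 p) > 0" if p: "p \<in> topspace P" for p
    unfolding spread_gr_iff
  proof (intro allI impI)
    fix I assume I: "I \<subseteq> {..<2 * m + 1}" "card I = m + 1"
    \<comment> \<open>A perturbation of at most \<open>r / 4\<close> cannot carry a coordinate from
      distance \<open>r / 2\<close> to a centre. The remaining case is a coordinate that has been
      replaced by \<open>g1\<close> entirely.\<close>
    have far: "\<exists>i\<in>I. 0 < centre_dist k (g2 p i)" if i: "i \<in> I" "r / 2 \<le> centre_dist k (g p i)" for i
    proof -
      have "i < 2 * m + 1" using I i by auto
      then have "0 < centre_dist k (g2 p i)"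
        using d2[OF p, of i] centre_dist_lipschitz[of k "g p i" "g2 p i"] i(2) r by linarith
      then show ?thesis using i(1) by blast
    qed
    show "\<exists>i\<in>I. 0 < centre_dist k (g2 p i)"
    proof (cases "spread m k (g p) \<ge> r / 2")
      case True
      then obtain i where "i \<in> I" "r / 2 \<le> centre_dist k (g p i)" using I unfolding spread_ge_iff by blast
      then show ?thesis by (rule far)
    next
      case False
      then have "1 \<le> 2 - 2 * spread m k (g p) / r" using r by (simp add: field_simps)
      then have z: "\<zeta> p = 1" by (simp add: \<zeta>_def)
      have "I \<in> ?\<I>" using I by simp
      then obtain i where i: "i \<in> I" "s \<le> centre_dist k (g1 i p)" using g1(4) p by blast
      show ?thesis
      proof (cases "centre_dist k (g p i) \<ge> r / 2")
        case True
        then show ?thesis using far i(1) by blast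
      next
        case False
        then have "1 \<le> 2 - 2 * centre_dist k (g p i) / r" using r by (simp add: field_simps)
        then have "\<theta> i p = 1" by (simp add: \<theta>_def)
        moreover have "i < 2 * m + 1" using I i by auto
        ultimately have "g2 p i = g1 i p" using z by (simp add: g2_def)
        then show ?thesis using i g1(3) by force
      qed
    qed
  qed
  show ?thesis
  proof (rule that[of "\<lambda>p. push_out m k (g2 p)"])
    show "continuous_map P euclideanreal (\<lambda>p. push_out m k (g2 p) i)" for i
      by (intro continuous_map_push_out c2 s2)
    show "push_out m k (g2 p) \<in> menger_stage m (Suc k)" if "p \<in> topspace P" for p
      using push_out_properties(1)[OF M2 s2] that by blast
    show "push_out m k (g2 p) = g p" if p: "p \<in> A" for p
    proof -
      have pP: "p \<in> topspace P" using p A(1) by blast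
      have l: "level m k (g p)" using A(2)[OF p] .
      then have "2 - 2 * spread m k (g p) / r \<le> 0" using r by (simp add: level_iff_spread r_def[symmetric] field_simps)
      then have "\<zeta> p = 0" by (simp add: \<zeta>_def)
      moreover have "g p i = 0" if "i \<ge> 2 * m + 1" for i using g(2)[OF pP] that by (auto simp: menger_stage_def)
      ultimately have "g2 p = g p" by (auto simp: g2_def fun_eq_iff)
      then show ?thesis using push_out_properties(4)[OF M2[OF pP] s2[OF pP]] l by simp
    qed
    show "\<bar>push_out m k (g2 p) i - g p i\<bar> \<le> 2 / 3 ^ k" if p: "p \<in> topspace P" and i: "i < 2 * m + 1" for p i
    proof -
      \<comment> \<open>\<open>push_out\<close> costs at most one cell length, the perturbation
        before it \<open>r / 4\<close>.\<close>
      have "\<bar>push_out m k (g2 p) i - g2 p i\<bar> \<le> 1 / 3 ^ k" by (rule push_out_properties(2)[OF M2[OF p] s2[OF p] i])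
      moreover have "r / 4 \<le> 1 / 3 ^ k" by (simp add: r_def field_simps)
      moreover have "2 / 3 ^ k = 1 / 3 ^ k + 1 / (3::real) ^ k" by simp
      ultimately show ?thesis using d2[OF p i] by linarith
    qed
  qed
qed

text \<open>The steps from \<open>n\<close> on add up to at most \<open>3 * (c / 3 ^ n)\<close>, so
  the intervals of this radius about \<open>x n\<close> are nested and have a common point.\<close>

lemma geometric_limit:
  fixes x :: "nat \<Rightarrow> real"
  assumes x: "\<And>n. \<bar>x (Suc n) - x n\<bar> \<le> 2 * (c / 3 ^ n)"
  shows "\<exists>L. \<forall>n. \<bar>x n - L\<bar> \<le> 3 * (c / 3 ^ n)"
proof -
  define u where "u n = x n - 3 * (c / 3 ^ n)" for n
  define v where "v n = x n + 3 * (c / 3 ^ n)" for n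
  have s: "3 * (c / 3 ^ Suc n) = c / 3 ^ n" for n by simp
  have "u n \<le> u (Suc n)" "v (Suc n) \<le> v n" for n
    using x[of n] s[of n] unfolding u_def v_def by linarith+
  then have uv: "mono u" "antimono v" by (auto intro: incseq_SucI decseq_SucI)
  have c: "c \<ge> 0" using x[of 0] by simp
  have uv': "u n \<le> v k" for n k
  proof -
    have "u n \<le> u (max n k)" using uv(1) by (simp add: monoD)
    also have "\<dots> \<le> v (max n k)" using c by (simp add: u_def v_def)
    also have "\<dots> \<le> v k" using uv(2) by (simp add: antimonoD)
    finally show ?thesis .
  qed
  have bdd: "bdd_above (range u)" using uv'[of _ 0] by (intro bdd_aboveI[of _ "v 0"]) auto
  define L where "L = (SUP n. u n)"
  have "\<bar>x n - L\<bar> \<le> 3 * (c / 3 ^ n)" for n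
  proof -
    have "u n \<le> L" "L \<le> v n"
      using cSUP_upper[OF _ bdd, of n] cSUP_least[of UNIV u "v n"] uv' by (auto simp: L_def)
    then show ?thesis unfolding u_def v_def by linarith
  qed
  then show ?thesis by blast
qed

lemma continuous_map_uniform_limit_real:
  fixes f :: "'a \<Rightarrow> real"
  assumes "\<And>e. e > 0 \<Longrightarrow> \<exists>g. continuous_map P euclideanreal g \<and> (\<forall>p\<in>topspace P. \<bar>g p - f p\<bar> \<le> e)"
  shows "continuous_map P euclideanreal f"
proof -
  have "\<exists>U. openin P U \<and> p \<in> U \<and> (\<forall>q\<in>U. \<bar>f q - f p\<bar> < e)" if p: "p \<in> topspace P" and e: "e > 0" for p e
  proof -
    obtain g where g: "continuous_map P euclideanreal g" "\<forall>p\<in>topspace P. \<bar>g p - f p\<bar> \<le> e / 4"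
      using assms[of "e / 4"] e by auto
    have "openin P {q \<in> topspace P. \<bar>g q - g p\<bar> < e / 4}"
      by (intro openin_less continuous_intros g)
    moreover have "\<bar>f q - f p\<bar> < e" if "q \<in> {q \<in> topspace P. \<bar>g q - g p\<bar> < e / 4}" for q
    proof -
      have "\<bar>g q - f q\<bar> \<le> e / 4" "\<bar>g p - f p\<bar> \<le> e / 4" using g(2) that p by auto
      moreover have "\<bar>g q - g p\<bar> < e / 4" using that by simp
      ultimately show ?thesis using e by linarith
    qed
    ultimately show ?thesis using p e by (intro exI[of _ "{q \<in> topspace P. \<bar>g q - g p\<bar> < e / 4}"]) auto
  qed
  then have "((\<lambda>q. f q) \<longlongrightarrow> f p) (atin P p)" if "p \<in> topspace P" for p
    unfolding tendsto_iff eventually_atin dist_real_def using that by (metis Diff_iff)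
  then show ?thesis
    by (simp add: continuous_map_atin)
qed

text \<open>By \<open>spread_lipschitz\<close> each level is a closed condition; the approximating
  point may change with \<open>k\<close> as well as with \<open>e\<close>.\<close>

lemma menger_set_limit:
  assumes 0: "\<And>i. 2 * m + 1 \<le> i \<Longrightarrow> y i = 0"
    and lim: "\<And>e k. e > 0 \<Longrightarrow> \<exists>z\<in>menger_stage m k. \<forall>i<2 * m + 1. \<bar>z i - y i\<bar> \<le> e"
  shows "y \<in> menger_set m"
proof -
  have "level m j y" for j
    unfolding level_iff_spread
  proof (rule field_le_epsilon)
    fix e :: real assume "e > 0"
    then obtain z where z: "z \<in> menger_stage m (Suc j)" "\<forall>i<2 * m + 1. \<bar>z i - y i\<bar> \<le> e" using lim by blast
    then have "1 / (6 * 3 ^ j) \<le> spread m j z" by (simp add: menger_stage_Suc level_iff_spread)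
    moreover have "spread m j z - e \<le> spread m j y"
      using z(2) by (intro spread_lipschitz) (simp add: abs_minus_commute)
    ultimately show "1 / (6 * 3 ^ j) \<le> spread m j y + e" by linarith
  qed
  moreover have "y i \<in> {0..1}" if i: "i < 2 * m + 1" for i
  proof -
    have fe: "- y i \<le> 0 + e \<and> y i \<le> 1 + e" if e: "e > 0" for e
    proof -
      obtain z where z: "z \<in> menger_stage m 0" "\<forall>i<2 * m + 1. \<bar>z i - y i\<bar> \<le> e" using lim[OF e] by blast
      then have "\<bar>z i - y i\<bar> \<le> e" using i by blast
      moreover have "z i \<in> {0..1}" using z(1) i unfolding menger_stage_def by blast
      ultimately show ?thesis by auto
    qed
    have "- y i \<le> 0" by (rule field_le_epsilon) (use fe in blast)
    moreover have "y i \<le> 1" by (rule field_le_epsilon) (use fe in blast)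
    ultimately show ?thesis by simp
  qed
  ultimately show ?thesis using 0 unfolding menger_set_eq menger_stage_def by auto
qed

text \<open>On \<open>A\<close> all levels hold from the start, so no application of
  \<open>improve_level\<close> changes the values there. The steps \<open>2 / 3 ^ (k + n)\<close>
  sum to \<open>3 / 3 ^ k\<close>: a start at a deep stage yields a small displacement.\<close>

theorem extend_from_level:
  fixes g :: "'a \<Rightarrow> nat \<Rightarrow> real"
  assumes P: "compact_space P" "Hausdorff_space P" "colored P m"
    and g: "\<And>i. continuous_map P euclideanreal (\<lambda>p. g p i)" "\<And>p. p \<in> topspace P \<Longrightarrow> g p \<in> menger_stage m k"
    and A: "A \<subseteq> topspace P" "\<And>p. p \<in> A \<Longrightarrow> g p \<in> menger_set m"
  obtains f where "continuous_map P (menger m) f" "\<And>p. p \<in> A \<Longrightarrow> f p = g p"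
    "\<And>p i. p \<in> topspace P \<Longrightarrow> i < 2 * m + 1 \<Longrightarrow> \<bar>f p i - g p i\<bar> \<le> 3 / 3 ^ k"
proof -
  define correctable where "correctable n h \<longleftrightarrow> (\<forall>i. continuous_map P euclideanreal (\<lambda>p. h p i)) \<and>
    (\<forall>p\<in>topspace P. h p \<in> menger_stage m (k + n)) \<and> (\<forall>p\<in>A. h p = g p)" for n and h :: "'a \<Rightarrow> nat \<Rightarrow> real"
  have "\<exists>G. G 0 = g \<and> (\<forall>n. correctable n (G n) \<and>
      (\<forall>p\<in>topspace P. \<forall>i<2 * m + 1. \<bar>G (Suc n) p i - G n p i\<bar> \<le> 2 / 3 ^ (k + n)))"
  proof -
    have st: "\<exists>h'. correctable (Suc n) h' \<and> (\<forall>p\<in>topspace P. \<forall>i<2 * m + 1. \<bar>h' p i - h p i\<bar> \<le> 2 / 3 ^ (k + n))"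
      if h: "correctable n h" for n h
    proof -
      have "level m (k + n) (h p)" if "p \<in> A" for p
        using h that menger_level[OF A(2)[OF that], of "k + n"] by (simp add: correctable_def)
      then obtain h' where "\<And>i. continuous_map P euclideanreal (\<lambda>p. h' p i)"
        "\<And>p. p \<in> topspace P \<Longrightarrow> h' p \<in> menger_stage m (Suc (k + n))" "\<And>p. p \<in> A \<Longrightarrow> h' p = h p"
        "\<And>p i. p \<in> topspace P \<Longrightarrow> i < 2 * m + 1 \<Longrightarrow> \<bar>h' p i - h p i\<bar> \<le> 2 / 3 ^ (k + n)"
        using improve_level[OF P, of h "k + n" A] h A(1) unfolding correctable_def by blast
      then show ?thesis using h by (intro exI[of _ h']) (auto simp: correctable_def)
    qed
    have "correctable 0 g" using g by (simp add: correctable_def)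
    \<comment> \<open>Dependent choice only asserts that some start exists, so the prescribed start
      \<open>g\<close> is carried along as a condition at \<open>n = 0\<close>.\<close>
    then have "\<exists>h. correctable 0 h \<and> h = g" by blast
    then have "\<exists>G. \<forall>n. (correctable n (G n) \<and> (n = 0 \<longrightarrow> G n = g)) \<and>
        (\<forall>p\<in>topspace P. \<forall>i<2 * m + 1. \<bar>G (Suc n) p i - G n p i\<bar> \<le> 2 / 3 ^ (k + n))"
      by (intro dependent_nat_choice) (use st in auto)
    then show ?thesis by blast
  qed
  then obtain G where G: "G 0 = g" "\<And>n. correctable n (G n)"
    "\<And>n p i. p \<in> topspace P \<Longrightarrow> i < 2 * m + 1 \<Longrightarrow> \<bar>G (Suc n) p i - G n p i\<bar> \<le> 2 / 3 ^ (k + n)"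
    by blast
  have "\<exists>L. \<forall>n. \<bar>G n p i - L\<bar> \<le> 3 * (1 / 3 ^ k / 3 ^ n)" if "p \<in> topspace P" "i < 2 * m + 1" for p i
    using G(3)[OF that] by (intro geometric_limit) (simp add: power_add)
  then obtain L where L: "\<And>p i n. p \<in> topspace P \<Longrightarrow> i < 2 * m + 1 \<Longrightarrow> \<bar>G n p i - L p i\<bar> \<le> 3 * (1 / 3 ^ k / 3 ^ n)"
    by metis
  define f where "f p i = (if i < 2 * m + 1 then L p i else 0)" for p i
  have fL: "\<bar>G n p i - f p i\<bar> \<le> 3 / 3 ^ (k + n)" if "p \<in> topspace P" "i < 2 * m + 1" for p i n
    using L[OF that, of n] that by (simp add: f_def power_add)
  have small: "\<exists>n\<ge>n0. 3 / 3 ^ (k + n) \<le> e" if e: "e > 0" for e :: real and n0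
  proof -
    obtain n where n: "3 / e < 3 ^ n" using real_arch_pow[of 3 "3 / e"] by auto
    have "3 / e \<le> 3 ^ (k + max n n0)" using n power_increasing[of n "k + max n n0" "3::real"] by linarith
    then show ?thesis using e by (intro exI[of _ "max n n0"]) (simp add: field_simps)
  qed
  show ?thesis
  proof (rule that[of f])
    have "continuous_map P euclideanreal (\<lambda>p. f p i)" if i: "i < 2 * m + 1" for i
    proof (rule continuous_map_uniform_limit_real)
      fix e :: real assume "e > 0"
      then obtain n where "3 / 3 ^ (k + n) \<le> e" using small by blast
      then show "\<exists>g. continuous_map P euclideanreal g \<and> (\<forall>p\<in>topspace P. \<bar>g p - f p i\<bar> \<le> e)"
        using G(2)[of n] fL[OF _ i, of _ n] unfolding correctable_def
        by (intro exI[of _ "\<lambda>p. G n p i"]) (auto intro: order_trans)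
    qed
    moreover have "f p \<in> menger_set m" if p: "p \<in> topspace P" for p
    proof (rule menger_set_limit)
      fix e :: real and j assume "e > 0"
      then obtain n where n: "n \<ge> j" "3 / 3 ^ (k + n) \<le> e" using small by blast
      have "G n p \<in> menger_stage m (k + n)" using G(2)[of n] p by (simp add: correctable_def)
      then have "G n p \<in> menger_stage m j" using n(1) by (auto simp: menger_stage_def)
      moreover have "\<bar>G n p i - f p i\<bar> \<le> e" if "i < 2 * m + 1" for i using fL[OF p that, of n] n(2) by linarith
      ultimately show "\<exists>z\<in>menger_stage m j. \<forall>i<2 * m + 1. \<bar>z i - f p i\<bar> \<le> e" by blast
    qed (simp add: f_def)
    ultimately show "continuous_map P (menger m) f" unfolding continuous_map_menger by blast
    show "f p = g p" if p: "p \<in> A" for p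
    proof
      fix i
      have pP: "p \<in> topspace P" using A(1) p by blast
      have Gg: "G n p = g p" for n using G(2)[of n] p by (simp add: correctable_def)
      show "f p i = g p i"
      proof (cases "i < 2 * m + 1")
        case True
        have "\<bar>g p i - f p i\<bar> \<le> 0"
        proof (rule field_le_epsilon)
          fix e :: real assume "e > 0"
          then obtain n where "3 / 3 ^ (k + n) \<le> e" using small by blast
          then show "\<bar>g p i - f p i\<bar> \<le> 0 + e" using fL[OF pP True, of n] Gg[of n] by simp
        qed
        then show ?thesis by simp
      next
        case False
        then show ?thesis using g(2)[OF pP] by (auto simp: f_def menger_stage_def)
      qed
    qed
    show "\<bar>f p i - g p i\<bar> \<le> 3 / 3 ^ k" if "p \<in> topspace P" "i < 2 * m + 1" for p i
      using fL[OF that, of 0] G(1) by (simp add: abs_minus_commute)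
  qed
qed


section \<open>Extension of maps into Menger compacta\<close>

lemma Tietze_interval:
  fixes f :: "'a \<Rightarrow> real"
  assumes "normal_space P" "closedin P A" "continuous_map (subtopology P A) euclideanreal f"
    and f: "\<And>p. p \<in> A \<Longrightarrow> f p \<in> {a..b}" and "a \<le> b"
  shows "\<exists>u. continuous_map P euclideanreal u \<and> (\<forall>p\<in>A. u p = f p) \<and> (\<forall>p\<in>topspace P. u p \<in> {a..b})"
proof -
  have im: "f ` A \<subseteq> {a..b}" using f by auto
  show ?thesis
  proof (rule Tietze_extension_closed_real_interval[OF assms(1,2,3) im assms(5)])
    fix u assume u: "continuous_map P euclideanreal u" "\<And>x. x \<in> A \<Longrightarrow> u x = f x" "u ` topspace P \<subseteq> {a..b}"
    have "\<forall>p\<in>topspace P. u p \<in> {a..b}" using u(3) by (simp add: image_subset_iff)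
    then show ?thesis using u(1,2) by (intro exI[of _ u] conjI ballI) auto
  qed
qed

lemma continuous_map_menger_coordinate:
  assumes "continuous_map P (menger m) f"
  shows "continuous_map P euclideanreal (\<lambda>p. f p i)"
proof (cases "i < 2 * m + 1")
  case True
  then show ?thesis using assms unfolding continuous_map_menger by blast
next
  case False
  have "f p i = 0" if "p \<in> topspace P" for p
  proof -
    have "f p \<in> menger_stage m 0" using assms that menger_set_in_stage unfolding continuous_map_menger by blast
    then show ?thesis using False by (simp add: menger_stage_def)
  qed
  then have "0 = f p i" if "p \<in> topspace P" for p using that by simp
  then show ?thesis by (rule continuous_map_eq[OF continuous_map_canonical_const])
qed

lemma menger_bounds:
  assumes "y \<in> menger_set m"
  shows "y i \<in> {0..1}" and "2 * m + 1 \<le> i \<Longrightarrow> y i = 0"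
  using menger_set_in_stage[OF assms, of 0] by (cases "i < 2 * m + 1"; force simp: menger_stage_def)+

lemma continuous_map_menger_image:
  "continuous_map P (menger m) f \<Longrightarrow> p \<in> topspace P \<Longrightarrow> f p \<in> menger_set m"
  unfolding continuous_map_menger by blast

text \<open>Stage 0 is the cube, where Tietze in each coordinate gives a first extension;
  \<open>extend_from_level\<close> then corrects it without touching \<open>A\<close>.\<close>

theorem menger_extensor:
  assumes P: "compact_space P" "Hausdorff_space P" "colored P m"
    and A: "closedin P A" and f: "continuous_map (subtopology P A) (menger m) f"
  obtains g where "continuous_map P (menger m) g" "\<And>p. p \<in> A \<Longrightarrow> g p = f p"
proof -
  have nP: "normal_space P" using P compact_Hausdorff_or_regular_imp_normal_space by blast
  have AP: "A \<subseteq> topspace P" using A closedin_subset by blast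
  then have fA: "f p \<in> menger_set m" if "p \<in> A" for p
    using continuous_map_menger_image[OF f] that by auto
  have "\<exists>u. continuous_map P euclideanreal u \<and> (\<forall>p\<in>A. u p = f p i) \<and> (\<forall>p\<in>topspace P. u p \<in> {0..1})" for i
    by (rule Tietze_interval[OF nP A continuous_map_menger_coordinate[OF f] menger_bounds(1)[OF fA] zero_le_one])
  then have "\<forall>i. \<exists>u. continuous_map P euclideanreal u \<and> (\<forall>p\<in>A. u p = f p i) \<and> (\<forall>p\<in>topspace P. u p \<in> {0..1})" ..
  then obtain u where "\<forall>i. continuous_map P euclideanreal (u i) \<and> (\<forall>p\<in>A. u i p = f p i) \<and> (\<forall>p\<in>topspace P. u i p \<in> {0..1})"
    by (rule choice[THEN exE])
  then have u: "continuous_map P euclideanreal (u i)" "p \<in> A \<Longrightarrow> u i p = f p i"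
    "p \<in> topspace P \<Longrightarrow> u i p \<in> {0..1}" for i p
    by blast+
  define g where "g p i = (if i < 2 * m + 1 then u i p else 0)" for p i
  have "continuous_map P euclideanreal (\<lambda>p. g p i)" for i
    using u(1)[of i] by (cases "i < 2 * m + 1") (simp_all add: g_def)
  moreover have "g p \<in> menger_stage m 0" if "p \<in> topspace P" for p
    using u(3)[OF that] unfolding menger_stage_def g_def by simp
  moreover have gf: "g p = f p" if "p \<in> A" for p
    using u(2)[OF that] menger_bounds(2)[OF fA[OF that]] by (auto simp: g_def fun_eq_iff)
  moreover have "g p \<in> menger_set m" if "p \<in> A" for p using gf[OF that] fA[OF that] by simp
  ultimately show ?thesis
    using AP by - (rule extend_from_level[OF P, of g 0 A], auto intro: that simp: gf)
qed

text \<open>Closeness to \<open>h\<close> does the work of the perturbation: \<open>h\<close>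
  satisfies level \<open>k\<close>, so a nearby map has \<open>spread\<close> close to the threshold
  or above it and can be pushed out directly, by a distance proportional to the deviation. The
  admissible \<open>d\<close> depends on \<open>k\<close> and \<open>e\<close> but not on the
  space.\<close>

lemma menger_stage_controlled_extension:
  fixes e :: real
  assumes "e > 0"
  shows "\<exists>d>0. \<forall>(P::'a topology) A h f. compact_space P \<and> Hausdorff_space P \<and> closedin P A \<and>
    continuous_map P (menger m) h \<and> continuous_map (subtopology P A) (menger m) f \<and>
    (\<forall>p\<in>A. \<forall>i<2 * m + 1. \<bar>f p i - h p i\<bar> \<le> d) \<longrightarrow>
    (\<exists>g. (\<forall>i. continuous_map P euclideanreal (\<lambda>p. g p i)) \<and> (\<forall>p\<in>topspace P. g p \<in> menger_stage m k) \<and>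
      (\<forall>p\<in>A. g p = f p) \<and> (\<forall>p\<in>topspace P. \<forall>i<2 * m + 1. \<bar>g p i - h p i\<bar> \<le> e))"
  using assms
proof (induction k arbitrary: e)
  case 0
  show ?case
  proof (intro exI[of _ e] conjI allI impI; (elim conjE)?)
    fix P :: "'a topology" and A h f
    assume P: "compact_space P" "Hausdorff_space P" and A: "closedin P A"
      and h: "continuous_map P (menger m) h" and f: "continuous_map (subtopology P A) (menger m) f"
      and d: "\<forall>p\<in>A. \<forall>i<2 * m + 1. \<bar>f p i - h p i\<bar> \<le> e"
    have nP: "normal_space P" using P compact_Hausdorff_or_regular_imp_normal_space by blast
    have AP: "A \<subseteq> topspace P" using A closedin_subset by blast
    then have fA: "f p \<in> menger_set m" if "p \<in> A" for p
      using continuous_map_menger_image[OF f] that by auto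
    have ex: "\<exists>u. continuous_map P euclideanreal u \<and> (\<forall>p\<in>A. u p = f p i - h p i) \<and> (\<forall>p\<in>topspace P. u p \<in> {-e..e})"
      if i: "i < 2 * m + 1" for i
    proof -
      have im: "f p i - h p i \<in> {-e..e}" if "p \<in> A" for p
      proof -
        have "\<bar>f p i - h p i\<bar> \<le> e" using d i that by blast
        then show ?thesis by auto
      qed
      have c: "continuous_map (subtopology P A) euclideanreal (\<lambda>p. f p i - h p i)"
        by (rule continuous_map_diff[OF continuous_map_menger_coordinate[OF f]
              continuous_map_from_subtopology[OF continuous_map_menger_coordinate[OF h]]])
      have "-e \<le> e" using 0 by simp
      with nP A c im show ?thesis by (rule Tietze_interval)
    qed
    then have "\<forall>i\<in>{..<2 * m + 1}. \<exists>u. continuous_map P euclideanreal u \<and> (\<forall>p\<in>A. u p = f p i - h p i) \<and> (\<forall>p\<in>topspace P. u p \<in> {-e..e})"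
      by simp
    then obtain u where u': "\<forall>i\<in>{..<2 * m + 1}. continuous_map P euclideanreal (u i) \<and> (\<forall>p\<in>A. u i p = f p i - h p i) \<and> (\<forall>p\<in>topspace P. u i p \<in> {-e..e})"
      by (rule bchoice[THEN exE])
    \<comment> \<open>Clipping to the unit interval keeps the bound \<open>e\<close>, since
      \<open>h p i\<close> lies in that interval.\<close>
    define g where "g p i = (if i < 2 * m + 1 then max 0 (min 1 (h p i + u i p)) else 0)" for p i
    have "continuous_map P euclideanreal (\<lambda>p. g p i)" for i
    proof (cases "i < 2 * m + 1")
      case True
      then have "continuous_map P euclideanreal (u i)" using u' by simp
      then show ?thesis unfolding g_def using True
        by (simp only: if_True) (intro continuous_intros continuous_map_menger_coordinate[OF h])
    qed (simp add: g_def)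
    moreover have "g p \<in> menger_stage m 0" if "p \<in> topspace P" for p by (simp add: menger_stage_def g_def)
    moreover have "g p = f p" if p: "p \<in> A" for p
    proof
      fix i
      show "g p i = f p i"
      proof (cases "i < 2 * m + 1")
        case True
        then have "u i p = f p i - h p i" using u' p by simp
        then show ?thesis using menger_bounds(1)[OF fA[OF p], of i] True by (simp add: g_def)
      qed (use menger_bounds(2)[OF fA[OF p], of i] in \<open>simp add: g_def\<close>)
    qed
    moreover have "\<bar>g p i - h p i\<bar> \<le> e" if p: "p \<in> topspace P" and i: "i < 2 * m + 1" for p i
    proof -
      have "u i p \<in> {-e..e}" using u' i p by simp
      moreover have "h p i \<in> {0..1}" using menger_bounds(1)[OF continuous_map_menger_image[OF h p]] .
      ultimately show ?thesis using i by (auto simp: g_def)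
    qed
    ultimately show "\<exists>g. (\<forall>i. continuous_map P euclideanreal (\<lambda>p. g p i)) \<and> (\<forall>p\<in>topspace P. g p \<in> menger_stage m 0) \<and>
      (\<forall>p\<in>A. g p = f p) \<and> (\<forall>p\<in>topspace P. \<forall>i<2 * m + 1. \<bar>g p i - h p i\<bar> \<le> e)"
      by blast
  qed (rule 0)
next
  case (Suc k)
  \<comment> \<open>\<open>push_out\<close> moves by at most \<open>6 * e1\<close>, so
    \<open>7 * e1\<close> bounds the total deviation; \<open>1 / (12 * 3 ^ k)\<close> is half of the
    threshold, as \<open>push_out_properties\<close> requires.\<close>
  define e1 where "e1 = min (e / 7) (1 / (12 * 3 ^ k))"
  have e1: "e1 > 0" "e1 \<le> e / 7" "e1 \<le> 1 / (12 * 3 ^ k)" using Suc.prems by (auto simp: e1_def)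
  obtain d where d: "d > 0" "\<forall>(P::'a topology) A h f. compact_space P \<and> Hausdorff_space P \<and> closedin P A \<and>
    continuous_map P (menger m) h \<and> continuous_map (subtopology P A) (menger m) f \<and>
    (\<forall>p\<in>A. \<forall>i<2 * m + 1. \<bar>f p i - h p i\<bar> \<le> d) \<longrightarrow>
    (\<exists>g. (\<forall>i. continuous_map P euclideanreal (\<lambda>p. g p i)) \<and> (\<forall>p\<in>topspace P. g p \<in> menger_stage m k) \<and>
      (\<forall>p\<in>A. g p = f p) \<and> (\<forall>p\<in>topspace P. \<forall>i<2 * m + 1. \<bar>g p i - h p i\<bar> \<le> e1))"
    using Suc.IH[OF e1(1)] by (elim exE conjE)
  show ?case
  proof (intro exI[of _ d] conjI allI impI d(1))
    fix P :: "'a topology" and A h f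
    assume asm: "compact_space P \<and> Hausdorff_space P \<and> closedin P A \<and>
      continuous_map P (menger m) h \<and> continuous_map (subtopology P A) (menger m) f \<and>
      (\<forall>p\<in>A. \<forall>i<2 * m + 1. \<bar>f p i - h p i\<bar> \<le> d)"
    from d(2)[THEN spec, THEN spec, THEN spec, THEN spec, THEN mp, OF asm]
    obtain g where g: "\<forall>i. continuous_map P euclideanreal (\<lambda>p. g p i)" "\<forall>p\<in>topspace P. g p \<in> menger_stage m k"
      "\<forall>p\<in>A. g p = f p" "\<forall>p\<in>topspace P. \<forall>i<2 * m + 1. \<bar>g p i - h p i\<bar> \<le> e1"
      by (elim exE conjE)
    have h: "continuous_map P (menger m) h" and f: "continuous_map (subtopology P A) (menger m) f"
      and A: "A \<subseteq> topspace P"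
      using asm closedin_subset by auto
    have s: "1 / (6 * 3 ^ k) - e1 \<le> spread m k (g p)" if p: "p \<in> topspace P" for p
    proof -
      have "level m k (h p)" using menger_level[OF continuous_map_menger_image[OF h p]] .
      then have "1 / (6 * 3 ^ k) \<le> spread m k (h p)" by (simp add: level_iff_spread)
      moreover have "spread m k (h p) - e1 \<le> spread m k (g p)"
        using g(4) p by (intro spread_lipschitz) blast
      ultimately show ?thesis by linarith
    qed
    have s0: "0 < spread m k (g p)" if p: "p \<in> topspace P" for p
    proof -
      have "1 / (12 * 3 ^ k) < 1 / (6 * (3::real) ^ k)" by (simp add: field_simps)
      then show ?thesis using s[OF p] e1(3) by linarith
    qed
    have gM: "g p \<in> menger_stage m k" if p: "p \<in> topspace P" for p using g(2) p by blast
    have "continuous_map P euclideanreal (\<lambda>p. push_out m k (g p) i)" for i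
      using g(1) s0 by (intro continuous_map_push_out) auto
    moreover have "push_out m k (g p) \<in> menger_stage m (Suc k)" if p: "p \<in> topspace P" for p
      using push_out_properties(1)[OF gM[OF p] s0[OF p]] .
    moreover have "push_out m k (g p) = f p" if p: "p \<in> A" for p
    proof -
      have pP: "p \<in> topspace P" using A p by blast
      have "f p \<in> menger_set m" using continuous_map_menger_image[OF f, of p] p pP by simp
      then have "level m k (g p)" using g(3) p menger_level by auto
      then show ?thesis using push_out_properties(4)[OF gM[OF pP] s0[OF pP]] g(3) p by simp
    qed
    moreover have "\<bar>push_out m k (g p) i - h p i\<bar> \<le> e" if p: "p \<in> topspace P" and i: "i < 2 * m + 1" for p i
    proof -
      have "\<bar>push_out m k (g p) i - g p i\<bar> \<le> 6 * e1"
        using push_out_properties(3)[OF gM[OF p] s0[OF p] i] e1 s[OF p] by auto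
      moreover have "\<bar>g p i - h p i\<bar> \<le> e1" using g(4) p i by blast
      ultimately show ?thesis using e1(2) by linarith
    qed
    ultimately show "\<exists>g. (\<forall>i. continuous_map P euclideanreal (\<lambda>p. g p i)) \<and> (\<forall>p\<in>topspace P. g p \<in> menger_stage m (Suc k)) \<and>
      (\<forall>p\<in>A. g p = f p) \<and> (\<forall>p\<in>topspace P. \<forall>i<2 * m + 1. \<bar>g p i - h p i\<bar> \<le> e)"
      by (intro exI[of _ "\<lambda>p. push_out m k (g p)"]) blast
  qed
qed

text \<open>Up to a level \<open>k\<close> with \<open>3 / 3 ^ k \<le> e / 2\<close> the extension
  is controlled by the deviation on \<open>A\<close>; beyond it by the smallness of the cells, where
  the dimension of \<open>P\<close> enters.\<close>

theorem menger_controlled_extensor: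
  fixes e :: real
  assumes "e > 0"
  shows "\<exists>d>0. \<forall>(P::'a topology) A h f. compact_space P \<and> Hausdorff_space P \<and> colored P m \<and> closedin P A \<and>
    continuous_map P (menger m) h \<and> continuous_map (subtopology P A) (menger m) f \<and>
    (\<forall>p\<in>A. \<forall>i<2 * m + 1. \<bar>f p i - h p i\<bar> \<le> d) \<longrightarrow>
    (\<exists>g. continuous_map P (menger m) g \<and>
      (\<forall>p\<in>A. g p = f p) \<and> (\<forall>p\<in>topspace P. \<forall>i<2 * m + 1. \<bar>g p i - h p i\<bar> \<le> e))"
proof -
  obtain k where k: "3 / (e / 2) < 3 ^ k" using real_arch_pow[of 3 "3 / (e / 2)"] by auto
  then have k': "3 / 3 ^ k \<le> e / 2" using assms by (simp add: field_simps)
  have "e / 2 > 0" using assms by simp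
  from menger_stage_controlled_extension[OF this, where m = m and k = k and 'a = 'a]
  obtain d where d: "d > 0" "\<forall>(P::'a topology) A h f. compact_space P \<and> Hausdorff_space P \<and> closedin P A \<and>
    continuous_map P (menger m) h \<and> continuous_map (subtopology P A) (menger m) f \<and>
    (\<forall>p\<in>A. \<forall>i<2 * m + 1. \<bar>f p i - h p i\<bar> \<le> d) \<longrightarrow>
    (\<exists>g. (\<forall>i. continuous_map P euclideanreal (\<lambda>p. g p i)) \<and> (\<forall>p\<in>topspace P. g p \<in> menger_stage m k) \<and>
      (\<forall>p\<in>A. g p = f p) \<and> (\<forall>p\<in>topspace P. \<forall>i<2 * m + 1. \<bar>g p i - h p i\<bar> \<le> e / 2))"
    by (elim exE conjE)
  show ?thesis
  proof (intro exI[of _ d] conjI allI impI d(1))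
    fix P :: "'a topology" and A h f
    assume asm: "compact_space P \<and> Hausdorff_space P \<and> colored P m \<and> closedin P A \<and>
      continuous_map P (menger m) h \<and> continuous_map (subtopology P A) (menger m) f \<and>
      (\<forall>p\<in>A. \<forall>i<2 * m + 1. \<bar>f p i - h p i\<bar> \<le> d)"
    then have asm': "compact_space P \<and> Hausdorff_space P \<and> closedin P A \<and>
      continuous_map P (menger m) h \<and> continuous_map (subtopology P A) (menger m) f \<and>
      (\<forall>p\<in>A. \<forall>i<2 * m + 1. \<bar>f p i - h p i\<bar> \<le> d)"
      by (elim conjE) (intro conjI)
    from d(2)[THEN spec, THEN spec, THEN spec, THEN spec, THEN mp, OF asm']
    obtain g where g: "\<forall>i. continuous_map P euclideanreal (\<lambda>p. g p i)" "\<forall>p\<in>topspace P. g p \<in> menger_stage m k"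
      "\<forall>p\<in>A. g p = f p" "\<forall>p\<in>topspace P. \<forall>i<2 * m + 1. \<bar>g p i - h p i\<bar> \<le> e / 2"
      by (elim exE conjE)
    have P: "compact_space P" "Hausdorff_space P" "colored P m"
      and f: "continuous_map (subtopology P A) (menger m) f" and A: "A \<subseteq> topspace P"
      using asm closedin_subset by auto
    have "g p \<in> menger_set m" if "p \<in> A" for p
      using continuous_map_menger_image[OF f, of p] g(3) A that by auto
    then obtain g' where g': "continuous_map P (menger m) g'" "\<And>p. p \<in> A \<Longrightarrow> g' p = g p"
      "\<And>p i. p \<in> topspace P \<Longrightarrow> i < 2 * m + 1 \<Longrightarrow> \<bar>g' p i - g p i\<bar> \<le> 3 / 3 ^ k"
      using extend_from_level[OF P, of g k A] g(1,2) A by blast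
    have "\<bar>g' p i - h p i\<bar> \<le> e" if p: "p \<in> topspace P" and i: "i < 2 * m + 1" for p i
    proof -
      have "\<bar>g p i - h p i\<bar> \<le> e / 2" using g(4) p i by blast
      then show ?thesis using g'(3)[OF p i] k' by linarith
    qed
    then show "\<exists>g. continuous_map P (menger m) g \<and>
      (\<forall>p\<in>A. g p = f p) \<and> (\<forall>p\<in>topspace P. \<forall>i<2 * m + 1. \<bar>g p i - h p i\<bar> \<le> e)"
      using g' g(3) by (intro exI[of _ g']) auto
  qed
qed


section \<open>Coloured covers of cylinders over Menger compacta\<close>

text \<open>The largest coordinate difference serves as a metric: by compactness it has a positive
  minimum off any neighbourhood of a point, and the usual covering argument applies.\<close>

lemma Lebesgue_number_coordinates:
  fixes y :: "'i \<Rightarrow> 'a \<Rightarrow> real"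
  assumes P: "compact_space P" and I: "finite I" "I \<noteq> {}"
    and y: "\<And>i. i \<in> I \<Longrightarrow> continuous_map P euclideanreal (y i)"
    and inj: "\<And>p q. \<lbrakk>p \<in> topspace P; q \<in> topspace P; \<And>i. i \<in> I \<Longrightarrow> y i p = y i q\<rbrakk> \<Longrightarrow> p = q"
    and U: "open_cover P \<U>"
  obtains d where "d > 0"
    "\<And>p. p \<in> topspace P \<Longrightarrow> \<exists>U\<in>\<U>. \<forall>q\<in>topspace P. (\<forall>i\<in>I. \<bar>y i q - y i p\<bar> < d) \<longrightarrow> q \<in> U"
proof -
  define D where "D p q = Max ((\<lambda>i. \<bar>y i q - y i p\<bar>) ` I)" for p q
  have Dc: "continuous_map P euclideanreal (D p)" for p
    unfolding D_def[abs_def] using I by (intro continuous_map_Max continuous_intros y) auto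
  have Dl: "D p q < r \<longleftrightarrow> (\<forall>i\<in>I. \<bar>y i q - y i p\<bar> < r)" for p q r
    unfolding D_def using I by (subst Max_less_iff) auto
  have Dpos: "0 < D p q" if "p \<in> topspace P" "q \<in> topspace P" "p \<noteq> q" for p q
  proof (rule ccontr)
    assume "\<not> 0 < D p q"
    then have "D p q \<le> 0" by simp
    then have "\<forall>i\<in>I. \<bar>y i q - y i p\<bar> \<le> 0"
      unfolding D_def using I by (subst (asm) Max_le_iff) auto
    then show False using inj[of p q] that by auto
  qed
  have "\<exists>e U. e > 0 \<and> U \<in> \<U> \<and> (\<forall>q\<in>topspace P. D p q < e \<longrightarrow> q \<in> U)" if p: "p \<in> topspace P" for p
  proof -
    obtain U where V: "U \<in> \<U>" "p \<in> U" using p U by (auto simp: open_cover_def)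
    then have "openin P U" using U by (simp add: open_cover_def)
    then have "closedin P (topspace P - U)" by blast
    then have "compactin P (topspace P - U)" using P closedin_compact_space by blast
    then have "compact_space (subtopology P (topspace P - U))" by (simp add: compact_space_subtopology)
    moreover have "continuous_map (subtopology P (topspace P - U)) euclideanreal (D p)"
      using Dc continuous_map_from_subtopology by blast
    moreover have "0 < D p q" if "q \<in> topspace (subtopology P (topspace P - U))" for q
      using that V p by (intro Dpos) auto
    ultimately obtain e where e: "e > 0" "\<And>q. q \<in> topspace (subtopology P (topspace P - U)) \<Longrightarrow> e \<le> D p q"
      by (rule compact_pos_bound) (assumption | rule that)+
    have "q \<in> U" if "q \<in> topspace P" "D p q < e" for q
      using e(2)[of q] that by fastforce
    then show ?thesis using e(1) V(1) by blast
  qed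
  then have "\<forall>p\<in>topspace P. \<exists>e U. e > 0 \<and> U \<in> \<U> \<and> (\<forall>q\<in>topspace P. D p q < e \<longrightarrow> q \<in> U)" by blast
  then obtain e where "\<forall>p\<in>topspace P. \<exists>U. e p > 0 \<and> U \<in> \<U> \<and> (\<forall>q\<in>topspace P. D p q < e p \<longrightarrow> q \<in> U)"
    by (rule bchoice[THEN exE])
  then have e: "e p > 0" "\<exists>U\<in>\<U>. \<forall>q\<in>topspace P. D p q < e p \<longrightarrow> q \<in> U" if "p \<in> topspace P" for p
    using that by blast+
  have op: "openin P {q \<in> topspace P. D p q < e p / 2} \<and> p \<in> {q \<in> topspace P. D p q < e p / 2}"
    if p: "p \<in> topspace P" for p
  proof
    show "openin P {q \<in> topspace P. D p q < e p / 2}" by (intro openin_less Dc continuous_intros)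
    show "p \<in> {q \<in> topspace P. D p q < e p / 2}" unfolding Dl using p e(1)[OF p] by simp
  qed
  obtain F where F: "finite F" "F \<subseteq> topspace P" "topspace P \<subseteq> (\<Union>p\<in>F. {q \<in> topspace P. D p q < e p / 2})"
    by (rule compact_space_points[OF P op]) (assumption | rule that)+
  define d where "d = Min (insert 1 ((\<lambda>p. e p / 2) ` F))"
  show ?thesis
  proof (rule that[of d])
    show "d > 0" unfolding d_def using F e(1) by (subst Min_gr_iff) auto
    fix p assume p: "p \<in> topspace P"
    then obtain c where c: "c \<in> F" "D c p < e c / 2" using F(3) by blast
    have cP: "c \<in> topspace P" using c F by blast
    have dc: "d \<le> e c / 2" unfolding d_def using F(1) c(1) by (intro Min_le) auto
    obtain U where V: "U \<in> \<U>" "\<forall>q\<in>topspace P. D c q < e c \<longrightarrow> q \<in> U" using e(2)[OF cP] by blast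
    have "q \<in> U" if q: "q \<in> topspace P" "\<forall>i\<in>I. \<bar>y i q - y i p\<bar> < d" for q
    proof -
      have "D c q < e c" unfolding Dl
      proof
        fix i assume i: "i \<in> I"
        then have "\<bar>y i p - y i c\<bar> < e c / 2" using c(2) unfolding Dl by blast
        moreover have "\<bar>y i q - y i p\<bar> < d" using q i by blast
        ultimately show "\<bar>y i q - y i c\<bar> < e c" using dc by linarith
      qed
      then show ?thesis using V q by blast
    qed
    then show "\<exists>U\<in>\<U>. \<forall>q\<in>topspace P. (\<forall>i\<in>I. \<bar>y i q - y i p\<bar> < d) \<longrightarrow> q \<in> U"
      using V(1) by blast
  qed
qed

text \<open>\<open>Y\<close> maps into the \<open>d\<close>-skeleton of the unit cubical lattice.
  \<open>W (S, v)\<close> thickens the preimage of the open face with free coordinates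
  \<open>S\<close> and corner \<open>v\<close>; its colour is the dimension of the face. Thickened
  faces of equal dimension are disjoint: for different \<open>S\<close> two distances to the
  integers would compare both ways, and for equal \<open>S\<close> the point determines the
  corner.\<close>

lemma colored_integral_coordinates:
  fixes Y :: "nat \<Rightarrow> 'a \<Rightarrow> real" and d b :: nat
  assumes P: "compact_space P" "Hausdorff_space P"
    and Y: "\<And>i. i \<le> N \<Longrightarrow> continuous_map P euclideanreal (Y i)"
    and b: "\<And>i p. i \<le> N \<Longrightarrow> p \<in> topspace P \<Longrightarrow> Y i p \<in> {0..real b}"
    and few: "\<And>p. p \<in> topspace P \<Longrightarrow> card {i. i \<le> N \<and> Y i p \<notin> \<int>} \<le> d"
    and small: "\<And>p. p \<in> topspace P \<Longrightarrow> \<exists>U\<in>\<U>. \<forall>q\<in>topspace P. (\<forall>i\<le>N. \<bar>Y i q - Y i p\<bar> < 1) \<longrightarrow> q \<in> U"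
  shows "\<exists>\<F>::nat \<Rightarrow> 'a set set. (\<forall>j\<le>d. finite (\<F> j) \<and> pairwise disjnt (\<F> j) \<and>
         (\<forall>C\<in>\<F> j. closedin P C \<and> (\<exists>U\<in>\<U>. C \<subseteq> U))) \<and> topspace P = (\<Union>j\<le>d. \<Union>(\<F> j))"
proof -
  define z where "z i p = infdist (Y i p) \<int>" for i p
  have zc: "continuous_map P euclideanreal (z i)" if "i \<le> N" for i
    using continuous_map_compose[OF Y[OF that], of euclideanreal "\<lambda>t. infdist t \<int>"]
    by (simp add: o_def z_def[abs_def] continuous_on_infdist)
  have z0: "0 < z i p \<longleftrightarrow> Y i p \<notin> \<int>" for i p
    using in_closed_iff_infdist_zero[of "\<int>::real set" "Y i p"] infdist_nonneg[of "Y i p" "\<int>"] Ints_0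
    by (auto simp: z_def order_le_less)
  define W where "W = (\<lambda>(S, v). {p \<in> topspace P. \<forall>i\<in>{..N}.
    (if i \<in> S then real (v i) < Y i p \<and> Y i p < real (v i) + 1 \<and> (\<forall>i'\<in>{..N} - S. z i' p < z i p)
     else \<bar>Y i p - real (v i)\<bar> < 1/2)})"
  \<comment> \<open>Non-emptiness supplies the point at which \<open>small\<close> is applied; any
    two points of \<open>W (S, v)\<close> differ by less than 1 in each coordinate.\<close>
  define J where "J = {(S, v). S \<subseteq> {..N} \<and> card S \<le> d \<and> v \<in> (\<Pi>\<^sub>E i\<in>{..N}. {..b}) \<and> W (S, v) \<noteq> {}}"
  have Wi: "if i \<in> S then real (v i) < Y i p \<and> Y i p < real (v i) + 1 \<and> (\<forall>i'\<in>{..N} - S. z i' p < z i p)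
     else \<bar>Y i p - real (v i)\<bar> < 1/2" if "p \<in> W (S, v)" "i \<le> N" for p S v i
    using that unfolding W_def by blast
  show ?thesis
  proof (rule colored_families[OF P, of J W _ "\<lambda>(S, v). card S"])
    have "J \<subseteq> Pow {..N} \<times> (\<Pi>\<^sub>E i\<in>{..N}. {..b})" by (auto simp: J_def)
    then show "finite J" by (rule finite_subset) (intro finite_cartesian_product finite_PiE, auto)
    show "openin P (W i)" if "i \<in> J" for i
    proof -
      obtain S v where i: "i = (S, v)" by (cases i)
      show ?thesis
        unfolding i W_def prod.case
      proof (rule openin_Ball)
        fix i assume iN: "i \<in> {..N}"
        show "openin P {p \<in> topspace P. if i \<in> S then real (v i) < Y i p \<and> Y i p < real (v i) + 1 \<and> (\<forall>i'\<in>{..N} - S. z i' p < z i p)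
          else \<bar>Y i p - real (v i)\<bar> < 1/2}"
        proof (cases "i \<in> S")
          case True
          have "openin P ({p \<in> topspace P. real (v i) < Y i p} \<inter> ({p \<in> topspace P. Y i p < real (v i) + 1} \<inter>
              {p \<in> topspace P. \<forall>i'\<in>{..N} - S. z i' p < z i p}))"
            using iN by (intro openin_Int openin_Ball openin_less continuous_intros Y zc) auto
          also have "\<dots> = {p \<in> topspace P. real (v i) < Y i p \<and> Y i p < real (v i) + 1 \<and> (\<forall>i'\<in>{..N} - S. z i' p < z i p)}"
            by blast
          finally show ?thesis using True by simp
        next
          case False
          have "openin P {p \<in> topspace P. \<bar>Y i p - real (v i)\<bar> < 1/2}"
            using iN by (intro openin_less continuous_intros Y) auto
          then show ?thesis using False by simp
        qed
      qed simp
    qed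
    show "topspace P \<subseteq> (\<Union>i\<in>J. W i)"
    proof
      fix p assume p: "p \<in> topspace P"
      define S where "S = {i. i \<le> N \<and> Y i p \<notin> \<int>}"
      define v where "v = restrict (\<lambda>i. nat \<lfloor>Y i p\<rfloor>) {..N}"
      have v: "real (v i) = of_int \<lfloor>Y i p\<rfloor>" "v i \<le> b" if "i \<le> N" for i
      proof -
        have "0 \<le> Y i p" "Y i p \<le> real b" using b[OF that p] by auto
        then show "real (v i) = of_int \<lfloor>Y i p\<rfloor>" "v i \<le> b" using that by (auto simp: v_def nat_le_iff floor_le_iff)
      qed
      have pW: "p \<in> W (S, v)"
        unfolding W_def prod.case
      proof (intro CollectI conjI p ballI)
        fix i assume iN: "i \<in> {..N}"
        show "if i \<in> S then real (v i) < Y i p \<and> Y i p < real (v i) + 1 \<and> (\<forall>i'\<in>{..N} - S. z i' p < z i p)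
          else \<bar>Y i p - real (v i)\<bar> < 1/2"
        proof (cases "i \<in> S")
          case True
          then have nZ: "Y i p \<notin> \<int>" by (simp add: S_def)
          have "of_int \<lfloor>Y i p\<rfloor> \<noteq> Y i p" using nZ by (metis Ints_of_int)
          then have "of_int \<lfloor>Y i p\<rfloor> < Y i p" "Y i p < of_int \<lfloor>Y i p\<rfloor> + 1"
            using of_int_floor_le[of "Y i p"] by linarith+
          moreover have "z i' p < z i p" if "i' \<in> {..N} - S" for i'
          proof -
            have "\<not> 0 < z i' p" using that by (simp add: z0 S_def)
            moreover have "0 < z i p" using nZ by (simp add: z0)
            ultimately show ?thesis by linarith
          qed
          ultimately show ?thesis using True v(1)[of i] iN by simp
        next
          case False
          then have "Y i p \<in> \<int>" using iN by (simp add: S_def)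
          then show ?thesis using False v(1)[of i] iN by (auto elim: Ints_cases)
        qed
      qed
      moreover have "(S, v) \<in> J"
        using pW few[OF p] v(2) by (auto simp: J_def S_def v_def)
      ultimately show "p \<in> (\<Union>i\<in>J. W i)" by blast
    qed
    show "\<exists>U\<in>\<U>. W i \<subseteq> U" if iJ: "i \<in> J" for i
    proof -
      obtain S v where i: "i = (S, v)" by (cases i)
      then obtain p where p: "p \<in> W (S, v)" using iJ unfolding J_def by blast
      have WP: "W (S, v) \<subseteq> topspace P" by (auto simp: W_def)
      obtain U where U: "U \<in> \<U>" "\<forall>q\<in>topspace P. (\<forall>i\<le>N. \<bar>Y i q - Y i p\<bar> < 1) \<longrightarrow> q \<in> U"
        using small p WP by blast
      have "q \<in> U" if q: "q \<in> W (S, v)" for q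
      proof -
        have "\<bar>Y j q - Y j p\<bar> < 1" if "j \<le> N" for j
        proof (cases "j \<in> S")
          case True
          with Wi[OF p that] Wi[OF q that]
          have "real (v j) < Y j p \<and> Y j p < real (v j) + 1" "real (v j) < Y j q \<and> Y j q < real (v j) + 1"
            by simp_all
          then show ?thesis by linarith
        next
          case False
          with Wi[OF p that] Wi[OF q that]
          have "\<bar>Y j p - real (v j)\<bar> < 1/2" "\<bar>Y j q - real (v j)\<bar> < 1/2" by simp_all
          then show ?thesis by linarith
        qed
        then show ?thesis using U(2) q WP by blast
      qed
      then show ?thesis using U(1) i by blast
    qed
    show "(case i of (S, v) \<Rightarrow> card S) \<le> d" if "i \<in> J" for i
      using that by (auto simp: J_def)
    show "W i \<inter> W i' = {}"
      if ij: "i \<in> J" "i' \<in> J" "i \<noteq> i'" "(case i of (S, v) \<Rightarrow> card S) = (case i' of (S, v) \<Rightarrow> card S)" for i i'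
    proof (rule ccontr)
      assume ne: "W i \<inter> W i' \<noteq> {}"
      obtain S v S' v' where i: "i = (S, v)" "i' = (S', v')" by (metis surj_pair)
      obtain p where p: "p \<in> W (S, v)" "p \<in> W (S', v')" using ne unfolding i by blast
      have S: "S \<subseteq> {..N}" "S' \<subseteq> {..N}" "card S = card S'" using ij unfolding i J_def by auto
      have fin: "finite S" "finite S'" using S finite_subset by auto
      show False
      proof (cases "S = S'")
        case True
        have "v j = v' j" if "j \<le> N" for j
        proof (cases "j \<in> S")
          case jS: True
          then have "real (v j) < Y j p \<and> Y j p < real (v j) + 1" "real (v' j) < Y j p \<and> Y j p < real (v' j) + 1"
            using Wi[OF p(1) that] Wi[OF p(2) that] True by simp_all
          then have "real (v j) < real (v' j) + 1" "real (v' j) < real (v j) + 1" by linarith+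
          then show ?thesis by linarith
        next
          case False
          then have "\<bar>Y j p - real (v j)\<bar> < 1/2" "\<bar>Y j p - real (v' j)\<bar> < 1/2"
            using Wi[OF p(1) that] Wi[OF p(2) that] True by simp_all
          then have "real (v j) < real (v' j) + 1" "real (v' j) < real (v j) + 1" by linarith+
          then show ?thesis by linarith
        qed
        moreover have "v \<in> (\<Pi>\<^sub>E i\<in>{..N}. {..b})" "v' \<in> (\<Pi>\<^sub>E i\<in>{..N}. {..b})" using ij(1,2) unfolding i J_def by auto
        ultimately have "v = v'" by (intro PiE_ext) auto
        then show False using True ij(3) i by simp
      next
        case False
        then have "\<not> S \<subseteq> S'" "\<not> S' \<subseteq> S"
          using S(3) fin card_subset_eq[of S' S] card_subset_eq[of S S'] by auto
        then obtain j j' where j: "j \<in> S" "j \<notin> S'" "j' \<in> S'" "j' \<notin> S" by blast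
        then have N: "j \<le> N" "j' \<le> N" using S by auto
        have "z j' p < z j p" using Wi[OF p(1) N(1)] j N by auto
        moreover have "z j p < z j' p" using Wi[OF p(2) N(2)] j N by auto
        ultimately show False by simp
      qed
    qed
  qed
qed

text \<open>Stretching by 3 at a fine level and rescaling leaves at most \<open>n\<close>
  non-integral coordinates of a point of \<open>menger n\<close>, and the interval adds one more. So
  the cylinder maps with small fibres into a cubical skeleton of dimension
  \<open>n + 1 \<le> m\<close>.\<close>

lemma colored_menger_interval:
  assumes "n < m"
  shows "colored (prod_topology (menger n) (top_of_set {0..1::real})) m" (is "colored ?P m")
  unfolding colored_def
proof (intro allI impI)
  fix \<U> assume U: "finite \<U> \<and> open_cover ?P \<U>"
  \<comment> \<open>\<open>N\<close> counts the coordinates of \<open>menger n\<close> and is at the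
    same time the index of the interval coordinate.\<close>
  define N where "N = 2 * n + 1"
  define y where "y i p = (if i < N then fst p i else snd p)" for i and p :: "(nat \<Rightarrow> real) \<times> real"
  have P: "compact_space ?P" "Hausdorff_space ?P"
    by (auto simp: compact_space_prod_topology Hausdorff_space_prod_topology compact_menger Hausdorff_menger
        compact_space_subtopology Hausdorff_space_subtopology)
  have yc: "continuous_map ?P euclideanreal (y i)" for i
  proof (cases "i < N")
    case True
    have "continuous_map ?P euclideanreal (\<lambda>p. fst p i)"
      by (rule continuous_map_menger_coordinate[OF continuous_map_fst])
    then show ?thesis using True by (simp add: y_def[abs_def])
  next
    case False
    have "continuous_map ?P euclideanreal snd"
      using continuous_map_snd[of "menger n" "top_of_set {0..1::real}"] continuous_map_in_subtopology by blast
    then show ?thesis using False by (simp add: y_def[abs_def])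
  qed
  have y01: "y i p \<in> {0..1}" if "p \<in> topspace ?P" for i p
    using that menger_bounds(1)[of "fst p" n i] by (auto simp: y_def topspace_menger)
  have inj: "p = q" if "p \<in> topspace ?P" "q \<in> topspace ?P" "\<And>i. i \<in> {..N} \<Longrightarrow> y i p = y i q" for p q
  proof (rule prod_eqI)
    have "fst p i = fst q i" for i
    proof (cases "i < N")
      case True
      then show ?thesis using that(3)[of i] by (simp add: y_def)
    next
      case False
      then show ?thesis using that(1,2) menger_bounds(2)[of "fst p" n i] menger_bounds(2)[of "fst q" n i]
        by (auto simp: topspace_menger N_def)
    qed
    then show "fst p = fst q" by blast
    show "snd p = snd q" using that(3)[of N] by (simp add: y_def)
  qed
  have U': "open_cover ?P \<U>" using U by blast
  obtain e where e: "e > 0"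
    "\<And>p. p \<in> topspace ?P \<Longrightarrow> \<exists>U\<in>\<U>. \<forall>q\<in>topspace ?P. (\<forall>i\<in>{..N}. \<bar>y i q - y i p\<bar> < e) \<longrightarrow> q \<in> U"
  proof (rule Lebesgue_number_coordinates[OF P(1) _ _ yc inj U', of "{..N}"])
    show "finite {..N}" "{..N} \<noteq> {}" by auto
  qed (assumption | rule that | simp)+
  \<comment> \<open>Points whose \<open>Y\<close>-coordinates differ by less than 1 are within
    \<open>3 / 3 ^ k\<close>: one cell length for the difference and one for each of the two
    applications of \<open>stretch\<close>.\<close>
  obtain k where k: "3 / e < 3 ^ k" using real_arch_pow[of 3 "3 / e"] by auto
  then have k': "3 / 3 ^ k < e" using e(1) by (simp add: field_simps)
  define Y where "Y i p = 3 ^ k * stretch k 3 (y i p)" for i p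
  show "\<exists>\<F>::nat \<Rightarrow> ((nat \<Rightarrow> real) \<times> real) set set. (\<forall>j\<le>m. finite (\<F> j) \<and> pairwise disjnt (\<F> j) \<and>
         (\<forall>C\<in>\<F> j. closedin ?P C \<and> (\<exists>U\<in>\<U>. C \<subseteq> U))) \<and> topspace ?P = (\<Union>j\<le>m. \<Union>(\<F> j))"
  proof (rule colored_integral_coordinates[OF P, of N Y "3 ^ k"])
    show "continuous_map ?P euclideanreal (Y i)" for i
      unfolding Y_def[abs_def] stretch_def by (intro continuous_intros yc) auto
    show "Y i p \<in> {0..real (3 ^ k)}" if "p \<in> topspace ?P" for i p
    proof -
      have "stretch k 3 (y i p) \<in> {0..1}"
        using same_cell_bounds[OF same_cell_stretch y01[OF that]] y01[OF that] by simp
      then show ?thesis by (simp add: Y_def)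
    qed
    show "card {i. i \<le> N \<and> Y i p \<notin> \<int>} \<le> m" if p: "p \<in> topspace ?P" for p
    proof -
      have "fst p \<in> menger_set n" using p by (auto simp: topspace_menger)
      then have l: "card {i. i < 2 * n + 1 \<and> centre_dist k (fst p i) < 1 / (6 * 3 ^ k)} \<le> n"
        using menger_level[of "fst p" n k] by (simp add: level_def)
      have "{i. i \<le> N \<and> Y i p \<notin> \<int>} \<subseteq> insert N {i. i < 2 * n + 1 \<and> centre_dist k (fst p i) < 1 / (6 * 3 ^ k)}"
      proof
        fix i assume i: "i \<in> {i. i \<le> N \<and> Y i p \<notin> \<int>}"
        have "centre_dist k (fst p i) < 1 / (6 * 3 ^ k)" if "i \<noteq> N"
        proof (rule ccontr)
          assume "\<not> centre_dist k (fst p i) < 1 / (6 * 3 ^ k)"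
          moreover have "y i p = fst p i" using that i by (simp add: y_def)
          ultimately have "Y i p \<in> \<int>" unfolding Y_def using y01[OF p, of i] by (intro stretch_three) auto
          then show False using i by simp
        qed
        then show "i \<in> insert N {i. i < 2 * n + 1 \<and> centre_dist k (fst p i) < 1 / (6 * 3 ^ k)}"
          using i by (auto simp: N_def)
      qed
      from card_mono[OF _ this]
      have "card {i. i \<le> N \<and> Y i p \<notin> \<int>} \<le> card (insert N {i. i < 2 * n + 1 \<and> centre_dist k (fst p i) < 1 / (6 * 3 ^ k)})"
        by simp
      also have "\<dots> \<le> Suc n" using l card_insert_le_m1[of "Suc n" "{i. i < 2 * n + 1 \<and> centre_dist k (fst p i) < 1 / (6 * 3 ^ k)}" N] by simp
      finally show ?thesis using assms by linarith
    qed
    show "\<exists>U\<in>\<U>. \<forall>q\<in>topspace ?P. (\<forall>i\<le>N. \<bar>Y i q - Y i p\<bar> < 1) \<longrightarrow> q \<in> U" if p: "p \<in> topspace ?P" for p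
    proof -
      obtain U where V: "U \<in> \<U>" "\<forall>q\<in>topspace ?P. (\<forall>i\<in>{..N}. \<bar>y i q - y i p\<bar> < e) \<longrightarrow> q \<in> U"
        using e(2)[OF p] by blast
      have "q \<in> U" if q: "q \<in> topspace ?P" "\<forall>i\<le>N. \<bar>Y i q - Y i p\<bar> < 1" for q
      proof -
        have "\<bar>y i q - y i p\<bar> < e" if "i \<le> N" for i
        proof -
          have "3 ^ k * \<bar>stretch k 3 (y i q) - stretch k 3 (y i p)\<bar> < 1"
            using q(2) that by (simp add: Y_def abs_mult flip: right_diff_distrib)
          then have "\<bar>stretch k 3 (y i q) - stretch k 3 (y i p)\<bar> < 1 / 3 ^ k" by (simp add: field_simps)
          moreover have "\<bar>stretch k 3 (y i q) - y i q\<bar> \<le> 1 / 3 ^ k" "\<bar>stretch k 3 (y i p) - y i p\<bar> \<le> 1 / 3 ^ k"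
            using stretch_dist[of 3 "y i q" k] stretch_dist[of 3 "y i p" k] y01 q(1) p by auto
          moreover have "3 / 3 ^ k = 1 / 3 ^ k + 1 / 3 ^ k + 1 / (3::real) ^ k" by simp
          ultimately show ?thesis using k' by linarith
        qed
        then show ?thesis using V(2) q(1) by blast
      qed
      then show ?thesis using V(1) by blast
    qed
  qed
qed


section \<open>Open subgroups and orbit spaces\<close>

text \<open>A refinement of order 1 of \<open>U\<close> and the complement of \<open>x\<close> is a
  partition into open, hence clopen sets, and the member through \<open>x\<close> can only lie in
  \<open>U\<close>.\<close>

lemma clopen_neighbourhood:
  assumes "Hausdorff_space T" "covering_dim_le T 0" "openin T U" "x \<in> U"
  obtains V where "openin T V" "closedin T V" "x \<in> V" "V \<subseteq> U"
proof -
  have xT: "x \<in> topspace T" using assms(3,4) openin_subset by blast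
  then have "closedin T {x}" by (rule closedin_Hausdorff_singleton[OF assms(1)])
  then have op: "openin T (topspace T - {x})" by (rule openin_diff[OF openin_topspace])
  have "finite {U, topspace T - {x}} \<and> open_cover T {U, topspace T - {x}}"
    using op assms(3,4) openin_subset[OF assms(3)] by (auto simp: open_cover_def)
  from assms(2)[unfolded covering_dim_le_def, THEN spec, THEN mp, OF this]
  obtain \<V> where V: "finite \<V>" "open_cover T \<V>" "\<forall>V\<in>\<V>. \<exists>W\<in>{U, topspace T - {x}}. V \<subseteq> W"
    "\<forall>y\<in>topspace T. card {V\<in>\<V>. y \<in> V} \<le> 0 + 1"
    by (elim exE conjE)
  obtain V where Vx: "V \<in> \<V>" "x \<in> V" using V(2) xT by (auto simp: open_cover_def)
  have disj: "V' = V" if "V' \<in> \<V>" "y \<in> V'" "y \<in> V" for V' y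
  proof -
    have "V \<subseteq> topspace T" using V(2) Vx by (auto simp: open_cover_def)
    then have "card {V\<in>\<V>. y \<in> V} \<le> Suc 0" using V(4) that by auto
    then show ?thesis using card_le_Suc0_iff_eq[of "{V\<in>\<V>. y \<in> V}"] V(1) that Vx by simp
  qed
  have "topspace T - V = \<Union>(\<V> - {V})" 
  proof -
    have "\<Union>\<V> = topspace T" using V(2) by (simp add: open_cover_def)
    then show ?thesis using disj Vx by auto
  qed
  moreover have "openin T (\<Union>(\<V> - {V}))" using V(2) by (auto simp: open_cover_def)
  ultimately have "openin T (topspace T - V)" by simp
  moreover have oV: "openin T V" using V(2) Vx by (simp add: open_cover_def)
  ultimately have "closedin T V" using openin_subset by (simp add: closedin_def)
  moreover have "V \<subseteq> U" using V(3) Vx by auto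
  ultimately show ?thesis using that oV Vx by blast
qed

section \<open>Small open normal subgroups\<close>

context topological_group
begin

lemma continuous_translations:
  assumes "g \<in> carrier G"
  shows "continuous_map T T (\<lambda>h. h \<otimes> g)" "continuous_map T T (\<lambda>h. g \<otimes> h)"
proof -
  have "continuous_map T (prod_topology T T) (\<lambda>h. (h, g))" "continuous_map T (prod_topology T T) (\<lambda>h. (g, h))"
    using assms by (auto intro!: continuous_intros simp: topspace_eq_carrier)
  from this[THEN continuous_map_compose, OF continuous_mult]
  show "continuous_map T T (\<lambda>h. h \<otimes> g)" "continuous_map T T (\<lambda>h. g \<otimes> h)"
    by (simp_all add: o_def)
qed

lemma continuous_map_mult:
  assumes "continuous_map P T f" "continuous_map P T g"
  shows "continuous_map P T (\<lambda>p. f p \<otimes> g p)"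
  using continuous_map_compose[OF continuous_map_pairedI[OF assms] continuous_mult] by (simp add: o_def)

lemma open_subgroupI:
  assumes N: "subgroup N G" and U: "openin T U" "\<one> \<in> U" "U \<subseteq> N"
  shows "openin T N"
proof (subst openin_subopen, intro ballI)
  fix n assume n: "n \<in> N"
  then have nG: "n \<in> carrier G" using N subgroup.mem_carrier by fast
  let ?V = "{h \<in> topspace T. inv n \<otimes> h \<in> U}"
  have "openin T ?V"
    using continuous_translations(2)[of "inv n"] nG U(1) by (intro openin_continuous_map_preimage) auto
  moreover have "n \<in> ?V" using nG U by (simp add: topspace_eq_carrier)
  moreover have "?V \<subseteq> N"
  proof
    fix h assume h: "h \<in> ?V"
    then have hG: "h \<in> carrier G" by (simp add: topspace_eq_carrier)
    have "inv n \<otimes> h \<in> N" using h U by blast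
    then have "n \<otimes> (inv n \<otimes> h) \<in> N" using n N subgroup.m_closed by fast
    then show "h \<in> N" using nG hG by (simp add: m_assoc[symmetric])
  qed
  ultimately show "\<exists>V. openin T V \<and> n \<in> V \<and> V \<subseteq> N" by blast
qed

text \<open>
  For a clopen \<open>V\<close> the elements that can be inserted anywhere into a product without affecting
  membership in \<open>V\<close> form a normal subgroup (as for the syntactic monoid of a language), which is
  open by compactness.
\<close>

lemma small_open_normal_subgroup:
  assumes cT: "compact_space T" and dT: "covering_dim_le T 0" and U: "openin T U" "\<one> \<in> U"
  obtains N where "N \<subseteq> U" "openin T N" "subgroup N G"
    "\<And>n g. n \<in> N \<Longrightarrow> g \<in> carrier G \<Longrightarrow> g \<otimes> n \<otimes> inv g \<in> N"
proof -
  obtain V where V: "openin T V" "closedin T V" "\<one> \<in> V" "V \<subseteq> U"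
    using clopen_neighbourhood[OF Hausdorff dT U] by blast
  define N where "N = {n \<in> carrier G. \<forall>h\<in>carrier G. \<forall>k\<in>carrier G. h \<otimes> n \<otimes> k \<in> V \<longleftrightarrow> h \<otimes> k \<in> V}"
  have ND: "h \<otimes> n \<otimes> k \<in> V \<longleftrightarrow> h \<otimes> k \<in> V" if "n \<in> N" "h \<in> carrier G" "k \<in> carrier G" for n h k
    using that unfolding N_def by blast
  have NG: "n \<in> carrier G" if "n \<in> N" for n using that unfolding N_def by blast
  have sub: "subgroup N G"
  proof (rule subgroupI)
    show "N \<subseteq> carrier G" using NG by blast
    show "N \<noteq> {}" using one_closed unfolding N_def by force
    show "inv n \<in> N" if n: "n \<in> N" for n
    proof -
      have "h \<otimes> inv n \<otimes> k \<in> V \<longleftrightarrow> h \<otimes> k \<in> V" if hk: "h \<in> carrier G" "k \<in> carrier G" for h k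
      proof -
        have "h \<otimes> k = h \<otimes> inv n \<otimes> n \<otimes> k" using hk NG[OF n] by (simp add: m_assoc)
        then show ?thesis using ND[OF n, of "h \<otimes> inv n" k] hk NG[OF n] by simp
      qed
      moreover have "inv n \<in> carrier G" using NG[OF n] by simp
      ultimately show ?thesis unfolding N_def by blast
    qed
    show "n \<otimes> n' \<in> N" if n: "n \<in> N" "n' \<in> N" for n n'
    proof -
      have "h \<otimes> (n \<otimes> n') \<otimes> k \<in> V \<longleftrightarrow> h \<otimes> k \<in> V" if hk: "h \<in> carrier G" "k \<in> carrier G" for h k
      proof -
        have "h \<otimes> (n \<otimes> n') \<otimes> k = h \<otimes> n \<otimes> (n' \<otimes> k)" "h \<otimes> (n' \<otimes> k) = h \<otimes> n' \<otimes> k"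
          using hk NG[OF n(1)] NG[OF n(2)] by (simp_all add: m_assoc)
        then show ?thesis using ND[OF n(1), of h "n' \<otimes> k"] ND[OF n(2), of h k] hk NG[OF n(1)] NG[OF n(2)] by simp
      qed
      moreover have "n \<otimes> n' \<in> carrier G" using NG[OF n(1)] NG[OF n(2)] by simp
      ultimately show ?thesis unfolding N_def by blast
    qed
  qed
  have conj: "g \<otimes> n \<otimes> inv g \<in> N" if n: "n \<in> N" and g: "g \<in> carrier G" for n g
  proof -
    have "h \<otimes> (g \<otimes> n \<otimes> inv g) \<otimes> k \<in> V \<longleftrightarrow> h \<otimes> k \<in> V" if hk: "h \<in> carrier G" "k \<in> carrier G" for h k
    proof -
      have "h \<otimes> (g \<otimes> n \<otimes> inv g) \<otimes> k = (h \<otimes> g) \<otimes> n \<otimes> (inv g \<otimes> k)"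
        using hk g NG[OF n] by (simp add: m_assoc)
      moreover have "(h \<otimes> g) \<otimes> (inv g \<otimes> k) = h \<otimes> k"
      proof -
        have "g \<otimes> (inv g \<otimes> k) = k" using hk g by (simp add: m_assoc[symmetric])
        then show ?thesis using hk g by (simp add: m_assoc)
      qed
      ultimately show ?thesis using ND[OF n, of "h \<otimes> g" "inv g \<otimes> k"] hk g by simp
    qed
    moreover have "g \<otimes> n \<otimes> inv g \<in> carrier G" using NG[OF n] g by simp
    ultimately show ?thesis unfolding N_def by blast
  qed
  have NV: "N \<subseteq> V"
  proof
    fix n assume n: "n \<in> N"
    then show "n \<in> V" using ND[OF n, of \<one> \<one>] NG[OF n] V(3) by simp
  qed
  let ?Q = "prod_topology T (prod_topology T T)"
  define a where "a q = fst (snd q) \<otimes> fst q \<otimes> snd (snd q)" for q :: "'a \<times> 'a \<times> 'a"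
  define b where "b q = fst (snd q) \<otimes> snd (snd q)" for q :: "'a \<times> 'a \<times> 'a"
  have c: "continuous_map ?Q T fst" "continuous_map ?Q T (\<lambda>q. fst (snd q))" "continuous_map ?Q T (\<lambda>q. snd (snd q))"
    using continuous_map_fst continuous_map_compose[OF continuous_map_snd continuous_map_fst]
      continuous_map_compose[OF continuous_map_snd continuous_map_snd]
    by (auto simp: o_def)
  have ab: "continuous_map ?Q T a" "continuous_map ?Q T b"
    unfolding a_def[abs_def] b_def[abs_def] by (intro continuous_map_mult c)+
  have "openin T (topspace T - V)" using V(2) by (rule openin_diff[OF openin_topspace])
  \<comment> \<open>\<open>?W\<close> collects the triples \<open>(n, h, k)\<close> for which the
    products with and without \<open>n\<close> agree about \<open>V\<close>. It is open as
    \<open>V\<close> is clopen, and it contains the fibre over \<open>\<one>\<close>; compactness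
    gives a tube, whose base lies in \<open>N\<close>.\<close>
  then have W: "openin ?Q ({q \<in> topspace ?Q. a q \<in> V} \<inter> {q \<in> topspace ?Q. b q \<in> V} \<union>
      {q \<in> topspace ?Q. a q \<in> topspace T - V} \<inter> {q \<in> topspace ?Q. b q \<in> topspace T - V})" (is "openin ?Q ?W")
    using ab V(1) by (intro openin_Un openin_Int openin_continuous_map_preimage)
  have C: "compactin (prod_topology T T) (topspace (prod_topology T T))"
    using cT unfolding compact_space_def[symmetric] compact_space_prod_topology by blast
  have "{\<one>} \<times> topspace (prod_topology T T) \<subseteq> ?W"
    by (auto simp: a_def b_def topspace_eq_carrier)
  from tube_lemma_right[OF W C _ this]
  obtain O1 O2 where O1: "openin T O1" "\<one> \<in> O1" "topspace (prod_topology T T) \<subseteq> O2" "O1 \<times> O2 \<subseteq> ?W"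
    by (auto simp: topspace_eq_carrier)
  have "O1 \<subseteq> N"
  proof
    fix n assume n: "n \<in> O1"
    then have nG: "n \<in> carrier G" using O1(1) openin_subset topspace_eq_carrier by blast
    have "h \<otimes> n \<otimes> k \<in> V \<longleftrightarrow> h \<otimes> k \<in> V" if hk: "h \<in> carrier G" "k \<in> carrier G" for h k
    proof -
      have "(h, k) \<in> O2" using O1(3) hk by (auto simp: topspace_eq_carrier)
      then have "(n, h, k) \<in> ?W" using O1(4) n by blast
      then show ?thesis by (auto simp: a_def b_def)
    qed
    then show "n \<in> N" using nG by (simp add: N_def)
  qed
  then have "openin T N" using open_subgroupI[OF sub O1(1,2)] by blast
  then show ?thesis using that[of N] NV V(4) sub conj by blast
qed

end

section \<open>Topology of the orbit map\<close>

context continuous_right_action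
begin

lemma act_inv [simp]:
  assumes "x \<in> topspace X" "g \<in> carrier G"
  shows "act (act x g) (inv g) = x" "act (act x (inv g)) g = x"
  using assms by (simp_all flip: act_mult add: act_one)

lemma continuous_map_act:
  assumes "continuous_map P X f" "continuous_map P T g"
  shows "continuous_map P X (\<lambda>p. act (f p) (g p))"
  using continuous_map_compose[OF continuous_map_pairedI[OF assms] continuous_act] by (simp add: o_def)

lemma continuous_map_act_const:
  assumes "continuous_map P X f" "g \<in> carrier G"
  shows "continuous_map P X (\<lambda>p. act (f p) g)"
  using assms by (intro continuous_map_act) (simp_all add: topspace_eq_carrier)

definition orbit :: "'x \<Rightarrow> 'x set" where
  "orbit x = orbit_rel G X act `` {x}"

abbreviation orbits :: "'x set topology" where
  "orbits \<equiv> orbit_space G X act"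

lemma quotient_map_orbit: "quotient_map X orbits orbit"
  using quotient_map_quotient_space[OF equiv_orbit_rel] by (simp add: orbit_def[abs_def] orbit_space_def)

lemma continuous_map_orbit: "continuous_map X orbits orbit"
  using quotient_map_orbit quotient_imp_continuous_map by blast

lemma orbit_in_orbits: "x \<in> topspace X \<Longrightarrow> orbit x \<in> topspace orbits"
  using continuous_map_orbit continuous_map_image_subset_topspace by blast

lemma orbit_surj: "z \<in> topspace orbits \<Longrightarrow> \<exists>x\<in>topspace X. z = orbit x"
  using quotient_imp_surjective_map[OF quotient_map_orbit] by blast

lemma orbit_eq_iff:
  assumes "x \<in> topspace X" "y \<in> topspace X"
  shows "orbit x = orbit y \<longleftrightarrow> (\<exists>g\<in>carrier G. y = act x g)"
proof -
  have "orbit x = orbit y \<longleftrightarrow> (x, y) \<in> orbit_rel G X act"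
    unfolding orbit_def using eq_equiv_class_iff[OF equiv_orbit_rel assms] by simp
  then show ?thesis using assms(1) by (simp add: orbit_rel_def)
qed

lemma orbit_act: "x \<in> topspace X \<Longrightarrow> g \<in> carrier G \<Longrightarrow> orbit (act x g) = orbit x"
  using orbit_eq_iff[of x "act x g"] act_closed by auto

lemma saturation:
  assumes "C \<subseteq> topspace X"
  shows "{x \<in> topspace X. orbit x \<in> orbit ` C} = {x \<in> topspace X. \<exists>g\<in>carrier G. act x g \<in> C}"
proof (intro Collect_cong conj_cong refl iffI)
  fix x assume x: "x \<in> topspace X"
  {
    assume "orbit x \<in> orbit ` C"
    then obtain c where "c \<in> C" "orbit x = orbit c" by blast
    then show "\<exists>g\<in>carrier G. act x g \<in> C" using orbit_eq_iff[of x c] x assms by auto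
  next
    assume "\<exists>g\<in>carrier G. act x g \<in> C"
    then obtain g where "g \<in> carrier G" "act x g \<in> C" by blast
    then show "orbit x \<in> orbit ` C" using orbit_act[OF x] by (metis imageI)
  }
qed

lemma open_map_orbit: "open_map X orbits orbit"
  unfolding open_map_def
proof (intro allI impI)
  fix U assume U: "openin X U"
  then have UX: "U \<subseteq> topspace X" by (rule openin_subset)
  have "openin X {x \<in> topspace X. act x g \<in> U}" if "g \<in> carrier G" for g
    using continuous_map_act_const[OF _ that, of X "\<lambda>x. x"] U by (intro openin_continuous_map_preimage) auto
  then have "openin X (\<Union>g\<in>carrier G. {x \<in> topspace X. act x g \<in> U})" by blast
  also have "(\<Union>g\<in>carrier G. {x \<in> topspace X. act x g \<in> U}) = {x \<in> topspace X. orbit x \<in> orbit ` U}"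
    unfolding saturation[OF UX] by blast
  finally have "openin X {x \<in> topspace X. orbit x \<in> orbit ` U}" .
  moreover have "orbit ` U \<subseteq> topspace orbits" using UX orbit_in_orbits by blast
  ultimately show "openin orbits (orbit ` U)"
    using quotient_map_orbit unfolding quotient_map_def by blast
qed

text \<open>The saturation of a closed set is the image under the action of its product with the
  group, and this product is compact.\<close>

lemma closed_map_orbit:
  assumes "compact_space T" "compact_space X" "Hausdorff_space X"
  shows "closed_map X orbits orbit"
  unfolding closed_map_def
proof (intro allI impI)
  fix C assume C: "closedin X C"
  then have CX: "C \<subseteq> topspace X" by (rule closedin_subset)
  have "compactin (prod_topology X T) (C \<times> topspace T)"
    using assms C by (simp add: compactin_Times closedin_compact_space flip: compact_space_def)
  then have "compactin X ((\<lambda>(x, g). act x g) ` (C \<times> topspace T))"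
    using continuous_act by (rule image_compactin)
  also have "(\<lambda>(x, g). act x g) ` (C \<times> topspace T) = {x \<in> topspace X. orbit x \<in> orbit ` C}"
    unfolding saturation[OF CX]
  proof (intro subset_antisym subsetI)
    fix x assume "x \<in> (\<lambda>(x, g). act x g) ` (C \<times> topspace T)"
    then obtain c g where cg: "c \<in> C" "g \<in> carrier G" "x = act c g" by (auto simp: topspace_eq_carrier)
    then have "act x (inv g) \<in> C" using CX by auto
    then show "x \<in> {x \<in> topspace X. \<exists>g\<in>carrier G. act x g \<in> C}" using cg CX act_closed by blast
  next
    fix x assume "x \<in> {x \<in> topspace X. \<exists>g\<in>carrier G. act x g \<in> C}"
    then obtain g where x: "x \<in> topspace X" "g \<in> carrier G" "act x g \<in> C" by blast
    then have "x = (\<lambda>(x, g). act x g) (act x g, inv g)" "(act x g, inv g) \<in> C \<times> topspace T"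
      by (auto simp: topspace_eq_carrier)
    then show "x \<in> (\<lambda>(x, g). act x g) ` (C \<times> topspace T)" by blast
  qed
  finally have "closedin X {x \<in> topspace X. orbit x \<in> orbit ` C}"
    using assms(3) compactin_imp_closedin by blast
  moreover have "orbit ` C \<subseteq> topspace orbits" using CX orbit_in_orbits by blast
  ultimately show "closedin orbits (orbit ` C)"
    using quotient_map_orbit unfolding quotient_map_closedin by blast
qed

lemma orbits_compact_Hausdorff:
  assumes "compact_space T" "compact_space X" "Hausdorff_space X"
  shows "compact_space orbits" "Hausdorff_space orbits"
proof -
  have surj: "orbit ` topspace X = topspace orbits"
    using quotient_map_orbit quotient_imp_surjective_map by blast
  show "compact_space orbits"
    using image_compactin[OF _ continuous_map_orbit, of "topspace X"] assms(2) surj by (simp add: compact_space_def)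
  have "normal_space X" using assms compact_Hausdorff_or_regular_imp_normal_space by blast
  then show "Hausdorff_space orbits"
    using normal_Hausdorff_space_closed_continuous_map_image[OF _ assms(3) closed_map_orbit[OF assms] continuous_map_orbit surj]
    by blast
qed

end


section \<open>Equivariant maps into Menger compacta\<close>

text \<open>In the application \<open>X\<close> is \<open>menger n\<close>; it enters as a compact
  space with a free action whose orbit space has dimension at most \<open>m\<close>.\<close>

locale equivariant_lifting =
  X: free_right_action G T X actX + Y: continuous_right_action G T "menger m" actY
  for G :: "('g, 'b) monoid_scheme" (structure) and T and X :: "'x topology" and actX and m and actY +
  assumes compact_group: "compact_space T" and zero_dim: "covering_dim_le T 0"
    and compact_X: "compact_space X" and Hausdorff_X: "Hausdorff_space X"
    and colored_orbits: "colored (orbit_space G X actX) m"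
begin

lemma menger_act [simp]: "y \<in> menger_set m \<Longrightarrow> g \<in> carrier G \<Longrightarrow> actY y g \<in> menger_set m"
  using Y.act_closed by (simp add: topspace_menger)

lemma menger_act_mult:
  "\<lbrakk>y \<in> menger_set m; g \<in> carrier G; h \<in> carrier G\<rbrakk> \<Longrightarrow> actY y (g \<otimes> h) = actY (actY y g) h"
  using Y.act_mult by (simp add: topspace_menger)

lemma menger_act_one: "y \<in> menger_set m \<Longrightarrow> actY y \<one> = y"
  using Y.act_one by (simp add: topspace_menger)

text \<open>A \<open>G\<close>-invariant version of closeness in the maximum norm.\<close>

definition near :: "real \<Rightarrow> (nat \<Rightarrow> real) \<Rightarrow> (nat \<Rightarrow> real) \<Rightarrow> bool" where
  "near e y z \<longleftrightarrow> (\<forall>g\<in>carrier G. \<forall>i<2 * m + 1. \<bar>actY y g i - actY z g i\<bar> \<le> e)"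

lemma near_sym: "near e y z \<Longrightarrow> near e z y"
  by (simp add: near_def abs_minus_commute)

lemma near_trans:
  assumes "near a x y" "near b y z" "a + b \<le> c"
  shows "near c x z"
  unfolding near_def
proof (intro ballI allI impI)
  fix g i assume "g \<in> carrier G" "i < 2 * m + 1"
  then have "\<bar>actY x g i - actY y g i\<bar> \<le> a" "\<bar>actY y g i - actY z g i\<bar> \<le> b"
    using assms(1,2) unfolding near_def by blast+
  then show "\<bar>actY x g i - actY z g i\<bar> \<le> c" using assms(3) by linarith
qed

lemma near_mono: "near a x y \<Longrightarrow> a \<le> b \<Longrightarrow> near b x y"
  unfolding near_def by (meson order_trans)

lemma near_act:
  assumes "near e y z" "y \<in> menger_set m" "z \<in> menger_set m" "g \<in> carrier G"
  shows "near e (actY y g) (actY z g)"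
  unfolding near_def
proof (intro ballI allI impI)
  fix h i assume h: "h \<in> carrier G" "i < 2 * m + 1"
  then have "g \<otimes> h \<in> carrier G" using assms(4) by simp
  then have "\<bar>actY y (g \<otimes> h) i - actY z (g \<otimes> h) i\<bar> \<le> e" using assms(1) h unfolding near_def by blast
  then show "\<bar>actY (actY y g) h i - actY (actY z g) h i\<bar> \<le> e"
    using assms(2-4) h by (simp add: menger_act_mult)
qed

lemma near_one:
  assumes "y \<in> menger_set m" "z \<in> menger_set m" "1 \<le> e"
  shows "near e y z"
  unfolding near_def
proof (intro ballI allI impI)
  fix g i assume "g \<in> carrier G"
  then have "actY y g i \<in> {0..1}" "actY z g i \<in> {0..1}"
    using menger_bounds(1)[OF menger_act[OF assms(1)]] menger_bounds(1)[OF menger_act[OF assms(2)]] by blast+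
  then show "\<bar>actY y g i - actY z g i\<bar> \<le> e" using assms(3) by auto
qed

lemma near_coordinate:
  assumes "near e y z" "y \<in> menger_set m" "z \<in> menger_set m" "i < 2 * m + 1"
  shows "\<bar>y i - z i\<bar> \<le> e"
  using assms(1)[unfolded near_def, rule_format, OF X.one_closed assms(4)] assms(2,3) by (simp add: menger_act_one)

text \<open>\<open>near\<close> quantifies over a possibly infinite group, but the strict
  inequalities hold on an open set containing the whole fibre over \<open>y\<close>, and the tube
  lemma applies.\<close>

lemma near_open:
  assumes y: "y \<in> menger_set m" and e: "e > 0"
  obtains V where "openin (menger m) V" "y \<in> V" "\<And>z. z \<in> V \<Longrightarrow> near e z y"
proof -
  let ?Q = "prod_topology (menger m) T"
  define W where "W = {q \<in> topspace ?Q. \<forall>i\<in>{..<2 * m + 1}. \<bar>actY (fst q) (snd q) i - actY y (snd q) i\<bar> < e}"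
  have "continuous_map ?Q (menger m) (\<lambda>q. actY (fst q) (snd q))"
    by (intro Y.continuous_map_act continuous_map_fst continuous_map_snd)
  moreover have "continuous_map ?Q (menger m) (\<lambda>q. actY y (snd q))"
    using y by (intro Y.continuous_map_act continuous_map_snd) (simp add: topspace_menger)
  ultimately have W: "openin ?Q W"
    unfolding W_def by (intro openin_Ball openin_less continuous_intros continuous_map_menger_coordinate) auto
  have sub: "{y} \<times> topspace T \<subseteq> W" using y e by (auto simp: W_def topspace_menger)
  have C: "compactin T (topspace T)" using compact_group by (simp add: compact_space_def)
  have "y \<in> topspace (menger m)" using y by (simp add: topspace_menger)
  from tube_lemma_right[OF W C this sub]
  obtain V V' where V: "openin (menger m) V" "openin T V'" "y \<in> V" "topspace T \<subseteq> V'" "V \<times> V' \<subseteq> W"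
    by (elim exE conjE)
  have "near e z y" if z: "z \<in> V" for z
    unfolding near_def
  proof (intro ballI allI impI)
    fix g i assume g: "g \<in> carrier G" and i: "i < 2 * m + 1"
    have "(z, g) \<in> W" using V(4,5) z g by (auto simp: X.topspace_eq_carrier)
    then have "\<bar>actY z g i - actY y g i\<bar> < e" using i unfolding W_def by auto
    then show "\<bar>actY z g i - actY y g i\<bar> \<le> e" by simp
  qed
  then show ?thesis using that V by blast
qed

text \<open>Uniform equicontinuity of the action: \<open>d\<close> comes from a Lebesgue number of a
  cover by sets whose points are all \<open>e / 2\<close>-near to one point.\<close>

lemma near_of_coordinates:
  assumes e: "e > 0"
  obtains d where "d > 0" "\<And>y z. \<lbrakk>y \<in> menger_set m; z \<in> menger_set m;
    \<And>i. i < 2 * m + 1 \<Longrightarrow> \<bar>y i - z i\<bar> \<le> d\<rbrakk> \<Longrightarrow> near e y z"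
proof -
  have "\<exists>V. openin (menger m) V \<and> y \<in> V \<and> (\<forall>z\<in>V. near (e / 2) z y)" if "y \<in> menger_set m" for y
    by (rule near_open[OF that, of "e / 2"]) (use e in auto)
  then have "\<forall>y\<in>menger_set m. \<exists>V. openin (menger m) V \<and> y \<in> V \<and> (\<forall>z\<in>V. near (e / 2) z y)" by blast
  then obtain V where "\<forall>y\<in>menger_set m. openin (menger m) (V y) \<and> y \<in> V y \<and> (\<forall>z\<in>V y. near (e / 2) z y)"
    by (rule bchoice[THEN exE])
  then have V: "openin (menger m) (V y)" "y \<in> V y" "z \<in> V y \<Longrightarrow> near (e / 2) z y" if "y \<in> menger_set m" for y z
    using that by blast+
  have "V y \<subseteq> menger_set m" if "y \<in> menger_set m" for y
    using openin_subset[OF V(1)[OF that]] by (simp add: topspace_menger)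
  then have "\<Union> (V ` menger_set m) = menger_set m" using V(2) by auto
  then have cov: "open_cover (menger m) (V ` menger_set m)"
    using V(1) by (auto simp: open_cover_def topspace_menger)
  have inj: "y = z" if "y \<in> topspace (menger m)" "z \<in> topspace (menger m)" "\<And>i. i \<in> {..<2 * m + 1} \<Longrightarrow> y i = z i" for y z
  proof
    fix i
    have "y \<in> menger_set m" "z \<in> menger_set m" using that by (auto simp: topspace_menger)
    then show "y i = z i" using that(3)[of i] menger_bounds(2)[of y m i] menger_bounds(2)[of z m i]
      by (cases "i < 2 * m + 1") auto
  qed
  have fin: "finite {..<2 * m + 1}" "{..<2 * m + 1} \<noteq> {}" by auto
  obtain d where d: "d > 0"
    "\<And>y. y \<in> topspace (menger m) \<Longrightarrow> \<exists>U\<in>V ` menger_set m. \<forall>z\<in>topspace (menger m). (\<forall>i\<in>{..<2 * m + 1}. \<bar>z i - y i\<bar> < d) \<longrightarrow> z \<in> U"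
  proof (rule Lebesgue_number_coordinates[OF compact_menger fin _ inj cov, of "\<lambda>i y. y i"])
    show "continuous_map (menger m) euclideanreal (\<lambda>y. y i)" if "i \<in> {..<2 * m + 1}" for i
      using that by (intro continuous_map_coordinate_menger) simp
  qed (assumption | rule that)+
  show ?thesis
  proof (rule that[of "d / 2"])
    show "d / 2 > 0" using d(1) by simp
    fix y z assume y: "y \<in> menger_set m" and z: "z \<in> menger_set m"
      and yz: "\<And>i. i < 2 * m + 1 \<Longrightarrow> \<bar>y i - z i\<bar> \<le> d / 2"
    obtain c where c: "c \<in> menger_set m"
      "\<forall>z\<in>topspace (menger m). (\<forall>i\<in>{..<2 * m + 1}. \<bar>z i - y i\<bar> < d) \<longrightarrow> z \<in> V c"
      using d(2)[of y] y by (auto simp: topspace_menger)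
    have "y \<in> V c" using c(2) y d(1) by (auto simp: topspace_menger)
    moreover have "z \<in> V c"
    proof -
      have "\<bar>z i - y i\<bar> < d" if "i < 2 * m + 1" for i using yz[OF that] d(1) by (simp add: abs_minus_commute)
      then show ?thesis using c(2) z by (simp add: topspace_menger)
    qed
    ultimately show "near e y z"
      using near_trans[OF V(3)[OF c(1)] near_sym[OF V(3)[OF c(1)]], of y z e] by simp
  qed
qed

text \<open>The identity moves nothing, so by the tube lemma over the compact space of pairs
  \<open>(y, g)\<close> a neighbourhood of \<open>\<one>\<close> moves all points by at most
  \<open>e\<close>; it contains an open normal subgroup.\<close>

lemma near_small_subgroup:
  assumes e: "e > 0"
  obtains N where "openin T N" "subgroup N G"
    "\<And>n g. n \<in> N \<Longrightarrow> g \<in> carrier G \<Longrightarrow> g \<otimes> n \<otimes> inv g \<in> N"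
    "\<And>n y. n \<in> N \<Longrightarrow> y \<in> menger_set m \<Longrightarrow> near e (actY y n) y"
proof -
  let ?R = "prod_topology (menger m) T"
  let ?Q = "prod_topology T ?R"
  define W where "W = {q \<in> topspace ?Q. \<forall>i\<in>{..<2 * m + 1}.
    \<bar>actY (actY (fst (snd q)) (fst q)) (snd (snd q)) i - actY (fst (snd q)) (snd (snd q)) i\<bar> < e}"
  have c: "continuous_map ?Q T fst" "continuous_map ?Q (menger m) (\<lambda>q. fst (snd q))" "continuous_map ?Q T (\<lambda>q. snd (snd q))"
    using continuous_map_fst continuous_map_compose[OF continuous_map_snd continuous_map_fst]
      continuous_map_compose[OF continuous_map_snd continuous_map_snd]
    by (auto simp: o_def)
  have a: "continuous_map ?Q (menger m) (\<lambda>q. actY (actY (fst (snd q)) (fst q)) (snd (snd q)))"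
    "continuous_map ?Q (menger m) (\<lambda>q. actY (fst (snd q)) (snd (snd q)))"
    by (intro Y.continuous_map_act c)+
  have W: "openin ?Q W"
    unfolding W_def
    by (intro openin_Ball openin_less continuous_map_real_abs continuous_map_diff
        continuous_map_menger_coordinate[OF a(1)] continuous_map_menger_coordinate[OF a(2)]) auto
  have sub: "{\<one>} \<times> topspace ?R \<subseteq> W"
    using e by (auto simp: W_def X.topspace_eq_carrier topspace_menger menger_act_one)
  have C: "compactin ?R (topspace ?R)"
    using compact_group compact_menger unfolding compact_space_def[symmetric] compact_space_prod_topology by blast
  have "\<one> \<in> topspace T" by (simp add: X.topspace_eq_carrier)
  from tube_lemma_right[OF W C this sub]
  obtain U V where U: "openin T U" "openin ?R V" "\<one> \<in> U" "topspace ?R \<subseteq> V" "U \<times> V \<subseteq> W"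
    by (elim exE conjE)
  obtain N where N: "N \<subseteq> U" "openin T N" "subgroup N G"
    "\<And>n g. n \<in> N \<Longrightarrow> g \<in> carrier G \<Longrightarrow> g \<otimes> n \<otimes> inv g \<in> N"
    using X.small_open_normal_subgroup[OF compact_group zero_dim U(1,3)] by blast
  have "near e (actY y n) y" if n: "n \<in> N" and y: "y \<in> menger_set m" for n y
    unfolding near_def
  proof (intro ballI allI impI)
    fix g i assume g: "g \<in> carrier G" and i: "i < 2 * m + 1"
    have "(y, g) \<in> V" using U(4) y g by (auto simp: X.topspace_eq_carrier topspace_menger)
    then have "(n, y, g) \<in> W" using U(5) N(1) n by blast
    then have "\<bar>actY (actY y n) g i - actY y g i\<bar> < e" using i unfolding W_def by auto
    then show "\<bar>actY (actY y n) g i - actY y g i\<bar> \<le> e" by simp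
  qed
  then show ?thesis using that N by blast
qed

section \<open>Controlled extension over the orbit space\<close>

abbreviation "B \<equiv> orbit_space G X actX"
abbreviation "p \<equiv> X.orbit"

lemma compact_B: "compact_space B" and Hausdorff_B: "Hausdorff_space B"
  using X.orbits_compact_Hausdorff[OF compact_group compact_X Hausdorff_X] by auto

definition controlled_ext :: "real \<Rightarrow> real \<Rightarrow> bool" where
  "controlled_ext a b \<longleftrightarrow> (\<forall>Z A h f. closedin B Z \<longrightarrow> closedin B A \<longrightarrow> A \<subseteq> Z \<longrightarrow>
     continuous_map (subtopology B Z) (menger m) h \<longrightarrow> continuous_map (subtopology B A) (menger m) f \<longrightarrow>
     (\<forall>z\<in>A. near a (f z) (h z)) \<longrightarrow>
     (\<exists>g. continuous_map (subtopology B Z) (menger m) g \<and> (\<forall>z\<in>A. g z = f z) \<and> (\<forall>z\<in>Z. near b (g z) (h z))))"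

lemma closed_subspace_B:
  assumes "closedin B Z"
  shows "compact_space (subtopology B Z)" "Hausdorff_space (subtopology B Z)" "colored (subtopology B Z) m"
    "Z \<subseteq> topspace B"
  using assms compact_B Hausdorff_B colored_orbits closedin_subset
  by (auto simp: compact_space_subtopology closedin_compact_space Hausdorff_space_subtopology colored_closed_subspace)

text \<open>Any two points of the unit cube are 1-near. This trivial modulus lets the corrections
  start from a constant map.\<close>

lemma controlled_ext_one: "controlled_ext a 1"
  unfolding controlled_ext_def
proof (intro allI impI)
  fix Z A h f
  assume Z: "closedin B Z" and A: "closedin B A" "A \<subseteq> Z"
    and h: "continuous_map (subtopology B Z) (menger m) h" and f: "continuous_map (subtopology B A) (menger m) f"
  have cA: "closedin (subtopology B Z) A" using A by (simp add: closedin_closed_subtopology[OF Z])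
  have f': "continuous_map (subtopology (subtopology B Z) A) (menger m) f"
    using f A(2) by (simp add: subtopology_subtopology Int_absorb1)
  obtain g where g: "continuous_map (subtopology B Z) (menger m) g" "\<And>z. z \<in> A \<Longrightarrow> g z = f z"
    using menger_extensor[OF closed_subspace_B(1-3)[OF Z] cA f'] by blast
  have "near 1 (g z) (h z)" if "z \<in> Z" for z
    using continuous_map_menger_image[OF g(1), of z] continuous_map_menger_image[OF h, of z] closed_subspace_B(4)[OF Z] that
    by (intro near_one) auto
  then show "\<exists>g. continuous_map (subtopology B Z) (menger m) g \<and> (\<forall>z\<in>A. g z = f z) \<and> (\<forall>z\<in>Z. near 1 (g z) (h z))"
    using g by blast
qed

text \<open>The extension theorem speaks of coordinates; \<open>near_coordinate\<close> translates
  its input and \<open>near_of_coordinates\<close> its output into the invariant closeness.\<close>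

lemma controlled_ext_small:
  assumes b: "b > 0"
  shows "\<exists>a>0. controlled_ext a b"
proof -
  obtain d where d: "d > 0" "\<And>y z. \<lbrakk>y \<in> menger_set m; z \<in> menger_set m;
    \<And>i. i < 2 * m + 1 \<Longrightarrow> \<bar>y i - z i\<bar> \<le> d\<rbrakk> \<Longrightarrow> near b y z"
    using near_of_coordinates[OF b] by blast
  from menger_controlled_extensor[OF d(1), where m = m and 'a = "'x set"]
  obtain a where a: "a > 0" "\<forall>(P::'x set topology) A h f. compact_space P \<and> Hausdorff_space P \<and> colored P m \<and> closedin P A \<and>
    continuous_map P (menger m) h \<and> continuous_map (subtopology P A) (menger m) f \<and>
    (\<forall>p\<in>A. \<forall>i<2 * m + 1. \<bar>f p i - h p i\<bar> \<le> a) \<longrightarrow>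
    (\<exists>g. continuous_map P (menger m) g \<and>
      (\<forall>p\<in>A. g p = f p) \<and> (\<forall>p\<in>topspace P. \<forall>i<2 * m + 1. \<bar>g p i - h p i\<bar> \<le> d))"
    by (elim exE conjE)
  have "controlled_ext a b"
    unfolding controlled_ext_def
  proof (intro allI impI)
    fix Z A h f
    assume Z: "closedin B Z" and A: "closedin B A" "A \<subseteq> Z"
      and h: "continuous_map (subtopology B Z) (menger m) h" and f: "continuous_map (subtopology B A) (menger m) f"
      and near: "\<forall>z\<in>A. near a (f z) (h z)"
    have cA: "closedin (subtopology B Z) A" using A by (simp add: closedin_closed_subtopology[OF Z])
    have f': "continuous_map (subtopology (subtopology B Z) A) (menger m) f"
      using f A(2) by (simp add: subtopology_subtopology Int_absorb1)
    note ZB = closed_subspace_B(4)[OF Z]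
    have hM: "h z \<in> menger_set m" if "z \<in> Z" for z
      using continuous_map_menger_image[OF h, of z] ZB that by auto
    have fM: "f z \<in> menger_set m" if "z \<in> A" for z
      using continuous_map_menger_image[OF f, of z] ZB A that by auto
    have "\<forall>z\<in>A. \<forall>i<2 * m + 1. \<bar>f z i - h z i\<bar> \<le> a"
      using near near_coordinate fM hM A(2) by blast
    with closed_subspace_B(1-3)[OF Z] cA h f'
    have asm: "compact_space (subtopology B Z) \<and> Hausdorff_space (subtopology B Z) \<and> colored (subtopology B Z) m \<and>
      closedin (subtopology B Z) A \<and> continuous_map (subtopology B Z) (menger m) h \<and>
      continuous_map (subtopology (subtopology B Z) A) (menger m) f \<and> (\<forall>p\<in>A. \<forall>i<2 * m + 1. \<bar>f p i - h p i\<bar> \<le> a)"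
      by (intro conjI)
    from a(2)[THEN spec, THEN spec, THEN spec, THEN spec, THEN mp, OF asm]
    obtain g where g: "continuous_map (subtopology B Z) (menger m) g" "\<forall>p\<in>A. g p = f p"
      "\<forall>p\<in>topspace (subtopology B Z). \<forall>i<2 * m + 1. \<bar>g p i - h p i\<bar> \<le> d"
      by (elim exE conjE)
    have "near b (g z) (h z)" if z: "z \<in> Z" for z
    proof (rule d(2)[OF _ hM[OF z]])
      have zB: "z \<in> topspace (subtopology B Z)" using z ZB by auto
      then show "g z \<in> menger_set m" by (rule continuous_map_menger_image[OF g(1)])
      show "\<bar>g z i - h z i\<bar> \<le> d" if "i < 2 * m + 1" for i using g(3) zB that by blast
    qed
    then show "\<exists>g. continuous_map (subtopology B Z) (menger m) g \<and> (\<forall>z\<in>A. g z = f z) \<and> (\<forall>z\<in>Z. near b (g z) (h z))"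
      using g(1,2) by blast
  qed
  then show ?thesis using a(1) by blast
qed

end


lemma continuous_map_closed_cover:
  assumes "finite \<P>" "\<And>C. C \<in> \<P> \<Longrightarrow> closedin P C" "\<And>C. C \<in> \<P> \<Longrightarrow> continuous_map (subtopology P C) Y F"
  shows "continuous_map (subtopology P (\<Union>\<P>)) Y F"
proof (rule pasting_lemma_closed[of \<P> _ "\<lambda>C. C" Y "\<lambda>C. F"])
  have c: "closedin P (\<Union>\<P>)" using assms(1,2) by (intro closedin_Union)
  show "closedin (subtopology P (\<Union>\<P>)) C" if "C \<in> \<P>" for C
    using that assms(2) by (simp add: closedin_closed_subtopology[OF c] Union_upper)
  show "continuous_map (subtopology (subtopology P (\<Union>\<P>)) C) Y F" if "C \<in> \<P>" for C
    using assms(3)[OF that] Union_upper[OF that] by (simp add: subtopology_subtopology Int_absorb1)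
  show "\<exists>C. C \<in> \<P> \<and> x \<in> C \<and> F x = F x" if "x \<in> topspace (subtopology P (\<Union>\<P>))" for x
    using that by auto
qed (use assms in auto)

section \<open>Invariant maps over the bases of slices\<close>

context equivariant_lifting
begin

definition small_subgroup :: "real \<Rightarrow> 'g set \<Rightarrow> bool" where
  "small_subgroup e N \<longleftrightarrow> openin T N \<and> subgroup N G \<and>
    (\<forall>n\<in>N. \<forall>g\<in>carrier G. g \<otimes> n \<otimes> inv g \<in> N) \<and>
    (\<forall>n\<in>N. \<forall>y\<in>menger_set m. near e (actY y n) y)"

text \<open>Translates of \<open>S\<close> by elements outside \<open>N\<close> miss
  \<open>S\<close>; for a subgroup \<open>N\<close> the part of \<open>X\<close> over the base is
  thus a disjoint union of translates, one for each coset.\<close>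

definition slice :: "'g set \<Rightarrow> 'x set \<Rightarrow> bool" where
  "slice N S \<longleftrightarrow> closedin X S \<and> (\<forall>u\<in>S. \<forall>n\<in>N. actX u n \<in> S) \<and>
    (\<forall>u\<in>S. \<forall>g\<in>carrier G. actX u g \<in> S \<longrightarrow> g \<in> N)"

text \<open>Exact \<open>N\<close>-invariance lets \<open>F\<close> descend to the base of a slice;
  \<open>a\<close> measures the remaining defect of equivariance, \<open>b\<close> the displacement
  from the map \<open>f\<close> being corrected.\<close>

definition corrected :: "'g set \<Rightarrow> 'x set set \<Rightarrow> real \<Rightarrow> real \<Rightarrow> ('x \<Rightarrow> nat \<Rightarrow> real) \<Rightarrow> ('x \<Rightarrow> nat \<Rightarrow> real) \<Rightarrow> bool" where
  "corrected N K a b f F \<longleftrightarrow> continuous_map (subtopology X {x \<in> topspace X. p x \<in> K}) (menger m) F \<and>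
    (\<forall>x\<in>topspace X. p x \<in> K \<longrightarrow> (\<forall>n\<in>N. F (actX x n) = F x) \<and>
      (\<forall>g\<in>carrier G. near a (F (actX x g)) (actY (F x) g)) \<and> near b (F x) (f x))"

definition coset :: "'g set \<Rightarrow> 'g \<Rightarrow> 'g set" where
  "coset N g = (\<lambda>n. n \<otimes> g) ` N"

lemma coset_eq:
  assumes N: "subgroup N G" and g: "g \<in> carrier G" and h: "h \<in> coset N g"
  shows "coset N h = coset N g"
proof -
  obtain k where k: "k \<in> N" "h = k \<otimes> g" using h by (auto simp: coset_def)
  have NG: "n \<in> carrier G" if "n \<in> N" for n using N subgroup.mem_carrier that by fast
  show ?thesis
  proof (intro subset_antisym subsetI)
    fix x assume "x \<in> coset N h"
    then obtain n where n: "n \<in> N" "x = n \<otimes> h" by (auto simp: coset_def)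
    then have "x = (n \<otimes> k) \<otimes> g" using k g NG by (simp add: X.m_assoc)
    moreover have "n \<otimes> k \<in> N" using n k N subgroup.m_closed by fast
    ultimately show "x \<in> coset N g" unfolding coset_def by blast
  next
    fix x assume "x \<in> coset N g"
    then obtain n where n: "n \<in> N" "x = n \<otimes> g" by (auto simp: coset_def)
    have "inv k \<otimes> (k \<otimes> g) = g" using k g NG by (simp add: X.m_assoc[symmetric])
    then have "x = (n \<otimes> inv k) \<otimes> h" using n k g NG by (simp add: X.m_assoc)
    moreover have "n \<otimes> inv k \<in> N" using n k N subgroup.m_closed subgroup.m_inv_closed by fast
    ultimately show "x \<in> coset N h" unfolding coset_def by blast
  qed
qed

lemma self_in_coset: "subgroup N G \<Longrightarrow> g \<in> carrier G \<Longrightarrow> g \<in> coset N g"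
  unfolding coset_def using subgroup.one_closed X.l_one by (metis image_eqI)

lemma coset_subset: "subgroup N G \<Longrightarrow> g \<in> carrier G \<Longrightarrow> coset N g \<subseteq> carrier G"
  unfolding coset_def using subgroup.mem_carrier by fastforce

lemma openin_coset:
  assumes "openin T N" "subgroup N G" "g \<in> carrier G"
  shows "openin T (coset N g)"
proof -
  have NG: "n \<in> carrier G" if "n \<in> N" for n using assms(2) subgroup.mem_carrier that by fast
  have "openin T {h \<in> topspace T. h \<otimes> inv g \<in> N}"
    using X.continuous_translations(1)[of "inv g"] assms by (intro openin_continuous_map_preimage) auto
  also have "{h \<in> topspace T. h \<otimes> inv g \<in> N} = coset N g"
  proof (intro subset_antisym subsetI)
    fix h assume "h \<in> {h \<in> topspace T. h \<otimes> inv g \<in> N}"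
    then have h: "h \<in> carrier G" "h \<otimes> inv g \<in> N" by (auto simp: X.topspace_eq_carrier)
    then have "h = (h \<otimes> inv g) \<otimes> g" using assms(3) by (simp add: X.m_assoc)
    then show "h \<in> coset N g" using h(2) unfolding coset_def by blast
  next
    fix h assume "h \<in> coset N g"
    then obtain n where n: "n \<in> N" "h = n \<otimes> g" by (auto simp: coset_def)
    then have "h \<otimes> inv g = n" using assms(3) NG by (simp add: X.m_assoc)
    then show "h \<in> {h \<in> topspace T. h \<otimes> inv g \<in> N}" using n NG assms(3) by (simp add: X.topspace_eq_carrier)
  qed
  finally show ?thesis .
qed

lemma finite_cosets:
  assumes "openin T N" "subgroup N G"
  shows "finite (coset N ` carrier G)"
proof -
  have "openin T (coset N g) \<and> g \<in> coset N g" if "g \<in> topspace T" for g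
    using that openin_coset[OF assms] self_in_coset[OF assms(2)] by (simp add: X.topspace_eq_carrier)
  then obtain F where F: "finite F" "F \<subseteq> topspace T" "topspace T \<subseteq> (\<Union>g\<in>F. coset N g)"
    by (rule compact_space_points[OF compact_group]) (assumption | rule that)+
  have "coset N ` carrier G \<subseteq> coset N ` F"
  proof
    fix c assume "c \<in> coset N ` carrier G"
    then obtain g where g: "g \<in> carrier G" "c = coset N g" by blast
    then obtain f where f: "f \<in> F" "g \<in> coset N f" using F(3) by (auto simp: X.topspace_eq_carrier)
    then have "c = coset N f" using coset_eq[OF assms(2) _ f(2)] g F(2) by (auto simp: X.topspace_eq_carrier)
    then show "c \<in> coset N ` F" using f(1) by blast
  qed
  then show ?thesis using F(1) finite_surj by blast
qed

text \<open>Two points of \<open>S\<close> in one orbit differ by an element \<open>g\<close> of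
  \<open>N\<close>; translation by \<open>r\<close> turns it into
  \<open>inv r \<otimes> g \<otimes> r\<close>, again in \<open>N\<close>. So
  \<open>F (actX u r)\<close>, as a function of \<open>u\<close>, is constant on the fibres of
  \<open>p\<close>, and by compactness \<open>p\<close> restricts to a quotient map.\<close>

lemma descend_to_orbits:
  assumes N: "small_subgroup e N" and S: "slice N S" and r: "r \<in> carrier G" and K: "closedin B K"
    and F: "corrected N K a b f F"
  obtains q where "continuous_map (subtopology B (p ` S \<inter> K)) (menger m) q"
    "\<And>u. u \<in> S \<Longrightarrow> p u \<in> K \<Longrightarrow> q (p u) = F (actX u r)"
proof -
  define S' where "S' = {u \<in> S. p u \<in> K}"
  have SX: "S \<subseteq> topspace X" using S closedin_subset unfolding slice_def by blast
  have "closedin X {x \<in> topspace X. p x \<in> K}"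
    using closedin_continuous_map_preimage[OF X.continuous_map_orbit K] .
  then have "closedin X (S \<inter> {x \<in> topspace X. p x \<in> K})" using S unfolding slice_def by (intro closedin_Int) auto
  also have "S \<inter> {x \<in> topspace X. p x \<in> K} = S'" using SX by (auto simp: S'_def)
  finally have cS': "closedin X S'" .
  have S'X: "S' \<subseteq> topspace X" using SX by (auto simp: S'_def)
  have im: "p ` S' = p ` S \<inter> K" by (auto simp: S'_def)
  have sub: "p ` S' \<subseteq> topspace B" using S'X X.orbit_in_orbits by blast
  have "quotient_map (subtopology X S') (subtopology B (p ` S')) p"
  proof (rule continuous_imp_quotient_map)
    show "continuous_map (subtopology X S') (subtopology B (p ` S')) p"
      using X.continuous_map_orbit by (simp add: continuous_map_in_subtopology continuous_map_from_subtopology)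
    show "compact_space (subtopology X S')"
      by (rule compact_space_subtopology[OF closedin_compact_space[OF compact_X cS']])
    show "Hausdorff_space (subtopology B (p ` S'))" using Hausdorff_B by (simp add: Hausdorff_space_subtopology)
    show "p ` topspace (subtopology X S') = topspace (subtopology B (p ` S'))"
      using S'X sub by (simp add: Int_absorb1)
  qed
  \<comment> \<open>An arbitrary section, not a continuous one; continuity of \<open>q\<close> comes
    from the quotient map.\<close>
  define s where "s z = (SOME u. u \<in> S' \<and> p u = z)" for z
  have s: "s (p u) \<in> S'" "p (s (p u)) = p u" if "u \<in> S'" for u
  proof -
    have "\<exists>w. w \<in> S' \<and> p w = p u" using that by blast
    then have "s (p u) \<in> S' \<and> p (s (p u)) = p u" unfolding s_def by (rule someI_ex)
    then show "s (p u) \<in> S'" "p (s (p u)) = p u" by auto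
  qed
  define q where "q z = F (actX (s z) r)" for z
  have qF: "q (p u) = F (actX u r)" if u: "u \<in> S'" for u
  proof -
    have uX: "u \<in> topspace X" "s (p u) \<in> topspace X" using u s(1)[OF u] S'X by auto
    then obtain g where g: "g \<in> carrier G" "s (p u) = actX u g"
      using X.orbit_eq_iff[of u "s (p u)"] s(2)[OF u] by auto
    then have gN: "g \<in> N" using S s(1)[OF u] u unfolding slice_def S'_def by auto
    have "inv r \<otimes> g \<otimes> inv (inv r) \<in> N" using N gN r unfolding small_subgroup_def by blast
    then have n: "inv r \<otimes> g \<otimes> r \<in> N" using r by simp
    have "actX (actX u g) r = actX u (g \<otimes> r)" using uX g r by (simp add: X.act_mult)
    also have "g \<otimes> r = r \<otimes> (inv r \<otimes> g \<otimes> r)" using g r by (simp add: X.m_assoc[symmetric])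
    also have "actX u \<dots> = actX (actX u r) (inv r \<otimes> g \<otimes> r)" using uX g r by (simp add: X.act_mult)
    finally have "F (actX (s (p u)) r) = F (actX (actX u r) (inv r \<otimes> g \<otimes> r))" using g(2) by simp
    also have "\<dots> = F (actX u r)"
      using F n uX r u X.act_closed[OF uX(1) r] X.orbit_act[OF uX(1) r] unfolding corrected_def S'_def by simp
    finally show ?thesis by (simp add: q_def)
  qed
  have "continuous_map (subtopology X S') (menger m) (\<lambda>u. F (actX u r))"
  proof -
    have "continuous_map (subtopology X S') X (\<lambda>u. u)"
      using continuous_map_from_subtopology[OF continuous_map_id] by (simp add: id_def)
    then have "continuous_map (subtopology X S') X (\<lambda>u. actX u r)"
      using r by (rule X.continuous_map_act_const)
    moreover have "p (actX u r) \<in> K" if "u \<in> S'" for u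
      using X.orbit_act[OF _ r, of u] that S'X by (auto simp: S'_def)
    ultimately have "continuous_map (subtopology X S') (subtopology X {x \<in> topspace X. p x \<in> K}) (\<lambda>u. actX u r)"
      using S'X X.act_closed[OF _ r] by (auto simp: continuous_map_in_subtopology)
    moreover have "continuous_map (subtopology X {x \<in> topspace X. p x \<in> K}) (menger m) F"
      using F unfolding corrected_def by blast
    ultimately have "continuous_map (subtopology X S') (menger m) (F \<circ> (\<lambda>u. actX u r))"
      by (rule continuous_map_compose)
    then show ?thesis by (simp add: o_def)
  qed
  then have "continuous_map (subtopology X S') (menger m) (q \<circ> p)"
    by (rule continuous_map_eq) (use qF S'X in auto)
  then have "continuous_map (subtopology B (p ` S')) (menger m) q"
    using \<open>quotient_map (subtopology X S') (subtopology B (p ` S')) p\<close> continuous_compose_quotient_map by blast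
  then have cq: "continuous_map (subtopology B (p ` S \<inter> K)) (menger m) q" unfolding im .
  show ?thesis
  proof (rule that[OF cq])
    show "q (p u) = F (actX u r)" if "u \<in> S" "p u \<in> K" for u
      using qF[of u] that by (simp add: S'_def)
  qed
qed


text \<open>
  Over the base of a slice \<open>S\<close> an \<open>N\<close>-invariant map is the same as one map of the base for
  each coset of \<open>N\<close>, so it can be extended coset by coset: first over \<open>S\<close> itself (near \<open>h\<close>), then
  over its translates (near the translates of the first extension).
\<close>

lemma extend_over_slice:
  assumes N: "small_subgroup e N" and S: "slice N S"
    and h: "continuous_map (subtopology B (p ` S)) (menger m) h"
    and f: "\<And>x. x \<in> topspace X \<Longrightarrow> f x \<in> menger_set m"
    and hf: "\<And>u g. u \<in> S \<Longrightarrow> g \<in> carrier G \<Longrightarrow> near d (actY (h (p u)) g) (f (actX u g))"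
    and K: "closedin B K" and F: "corrected N K a b f F"
    and controlled_ext: "controlled_ext a a'" "controlled_ext (b + d) b'"
    and bounds: "2 * (a' + e) \<le> a2" "a \<le> a2" "a' + e + b' + d \<le> b2" "b \<le> b2"
  shows "\<exists>F. corrected N (K \<union> p ` S) a2 b2 f F"
proof -
  have oN: "openin T N" and sN: "subgroup N G" and conj: "\<And>n g. n \<in> N \<Longrightarrow> g \<in> carrier G \<Longrightarrow> g \<otimes> n \<otimes> inv g \<in> N"
    and nN: "\<And>n y. n \<in> N \<Longrightarrow> y \<in> menger_set m \<Longrightarrow> near e (actY y n) y"
    using N unfolding small_subgroup_def by blast+
  have NG: "n \<in> carrier G" if "n \<in> N" for n using sN subgroup.mem_carrier that by fast
  have cS: "closedin X S" and SN: "\<And>u g. u \<in> S \<Longrightarrow> g \<in> carrier G \<Longrightarrow> actX u g \<in> S \<Longrightarrow> g \<in> N"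
    and NS: "\<And>u n. u \<in> S \<Longrightarrow> n \<in> N \<Longrightarrow> actX u n \<in> S"
    using S unfolding slice_def by blast+
  have SX: "u \<in> topspace X" if "u \<in> S" for u using closedin_subset[OF cS] that by blast
  define Z where "Z = p ` S"
  have cZ: "closedin B Z"
    using X.closed_map_orbit[OF compact_group compact_X Hausdorff_X] cS unfolding closed_map_def Z_def by blast
  have cA: "closedin B (Z \<inter> K)" using cZ K by (rule closedin_Int)
  have ZB: "Z \<subseteq> topspace B" using closedin_subset[OF cZ] .
  have KB: "K \<subseteq> topspace B" using closedin_subset[OF K] .
  have hM: "h z \<in> menger_set m" if "z \<in> Z" for z
    using continuous_map_menger_image[OF h, of z] that ZB by (auto simp: Z_def)
  have FM: "F x \<in> menger_set m" if "x \<in> topspace X" "p x \<in> K" for x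
    using F that continuous_map_menger_image[of _ m F x] unfolding corrected_def by auto
  have FN: "F (actX x n) = F x" if "x \<in> topspace X" "p x \<in> K" "n \<in> N" for x n
    using F that unfolding corrected_def by blast
  have Fa: "near a (F (actX x g)) (actY (F x) g)" if "x \<in> topspace X" "p x \<in> K" "g \<in> carrier G" for x g
    using F that unfolding corrected_def by blast
  have Fb: "near b (F x) (f x)" if "x \<in> topspace X" "p x \<in> K" for x
    using F that unfolding corrected_def by blast

  obtain q1 where q1: "continuous_map (subtopology B (Z \<inter> K)) (menger m) q1"
    "\<And>u. u \<in> S \<Longrightarrow> p u \<in> K \<Longrightarrow> q1 (p u) = F (actX u \<one>)"
    using descend_to_orbits[OF N S X.one_closed K F] unfolding Z_def by blast
  \<comment> \<open>Both maps are compared with \<open>f\<close>: \<open>F\<close> is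
    \<open>b\<close>-near to it and \<open>h\<close> is \<open>d\<close>-near.\<close>
  have "\<forall>z\<in>Z \<inter> K. near (b + d) (q1 z) (h z)"
  proof
    fix z assume "z \<in> Z \<inter> K"
    then obtain u where u: "u \<in> S" "z = p u" "p u \<in> K" by (auto simp: Z_def)
    have "near d (h (p u)) (f u)"
      using hf[OF u(1) X.one_closed] hM[of "p u"] u SX X.act_one by (simp add: menger_act_one Z_def)
    then show "near (b + d) (q1 z) (h z)"
      using near_trans[OF Fb[OF SX[OF u(1)] u(3)] near_sym] q1(2)[OF u(1,3)] u SX X.act_one by simp
  qed
  then obtain t1 where t1: "continuous_map (subtopology B Z) (menger m) t1"
    "\<forall>z\<in>Z \<inter> K. t1 z = q1 z" "\<forall>z\<in>Z. near b' (t1 z) (h z)"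
    using controlled_ext(2)[unfolded controlled_ext_def, rule_format, OF cZ cA Int_lower1 h[folded Z_def] q1(1)] by blast
  have t1M: "t1 z \<in> menger_set m" if "z \<in> Z" for z
    using continuous_map_menger_image[OF t1(1), of z] that ZB by auto
  have t1F: "t1 (p u) = F u" if "u \<in> S" "p u \<in> K" for u
    using t1(2) q1(2)[OF that] X.act_one SX that by (auto simp: Z_def)
  \<comment> \<open>Approximate equivariance makes the copy of \<open>F\<close> on the translate by
    \<open>r\<close> \<open>a\<close>-near to the translate of \<open>t1\<close>, so it extends
    within \<open>a'\<close>.\<close>
  have "\<exists>t. continuous_map (subtopology B Z) (menger m) t \<and> (\<forall>u\<in>S. p u \<in> K \<longrightarrow> t (p u) = F (actX u r)) \<and>
      (\<forall>z\<in>Z. near a' (t z) (actY (t1 z) r))" if r: "r \<in> carrier G" for r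
  proof -
    obtain q where q: "continuous_map (subtopology B (Z \<inter> K)) (menger m) q"
      "\<And>u. u \<in> S \<Longrightarrow> p u \<in> K \<Longrightarrow> q (p u) = F (actX u r)"
      using descend_to_orbits[OF N S r K F] unfolding Z_def by blast
    have ct: "continuous_map (subtopology B Z) (menger m) (\<lambda>z. actY (t1 z) r)"
      using t1(1) r by (rule Y.continuous_map_act_const)
    have "\<forall>z\<in>Z \<inter> K. near a (q z) (actY (t1 z) r)"
    proof
      fix z assume "z \<in> Z \<inter> K"
      then obtain u where u: "u \<in> S" "z = p u" "p u \<in> K" by (auto simp: Z_def)
      then show "near a (q z) (actY (t1 z) r)"
        using Fa[OF SX[OF u(1)] u(3) r] q(2) t1F by simp
    qed
    then obtain t where t: "continuous_map (subtopology B Z) (menger m) t"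
      "\<forall>z\<in>Z \<inter> K. t z = q z" "\<forall>z\<in>Z. near a' (t z) (actY (t1 z) r)"
      using controlled_ext(1)[unfolded controlled_ext_def, rule_format, OF cZ cA Int_lower1 ct q(1)] by blast
    have "\<forall>u\<in>S. p u \<in> K \<longrightarrow> t (p u) = F (actX u r)" using t(2) q(2) by (auto simp: Z_def)
    then show ?thesis using t(1,3) by blast
  qed
  then have "\<forall>r\<in>carrier G. \<exists>t. continuous_map (subtopology B Z) (menger m) t \<and>
      (\<forall>u\<in>S. p u \<in> K \<longrightarrow> t (p u) = F (actX u r)) \<and> (\<forall>z\<in>Z. near a' (t z) (actY (t1 z) r))" by blast
  then obtain t where "\<forall>r\<in>carrier G. continuous_map (subtopology B Z) (menger m) (t r) \<and>
      (\<forall>u\<in>S. p u \<in> K \<longrightarrow> t r (p u) = F (actX u r)) \<and> (\<forall>z\<in>Z. near a' (t r z) (actY (t1 z) r))"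
    by (rule bchoice[THEN exE])
  then have t: "continuous_map (subtopology B Z) (menger m) (t r)"
    "u \<in> S \<Longrightarrow> p u \<in> K \<Longrightarrow> t r (p u) = F (actX u r)" "z \<in> Z \<Longrightarrow> near a' (t r z) (actY (t1 z) r)"
    if "r \<in> carrier G" for r u z
    using that by blast+
  have tM: "t r z \<in> menger_set m" if "r \<in> carrier G" "z \<in> Z" for r z
    using continuous_map_menger_image[OF t(1)[OF that(1)], of z] that ZB by auto

  \<comment> \<open>One representative per coset, so that only finitely many of the maps
    \<open>t r\<close> are involved.\<close>
  define rp where "rp c = (SOME r. r \<in> c)" for c :: "'g set"
  have rp: "rp (coset N g) \<in> coset N g" "rp (coset N g) \<in> carrier G" "coset N (rp (coset N g)) = coset N g"
    if "g \<in> carrier G" for g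
  proof -
    show 1: "rp (coset N g) \<in> coset N g"
      unfolding rp_def using self_in_coset[OF sN that] by (rule someI)
    then show "rp (coset N g) \<in> carrier G" using coset_subset[OF sN that] by blast
    show "coset N (rp (coset N g)) = coset N g" using coset_eq[OF sN that 1] .
  qed
  \<comment> \<open>For \<open>x = actX u g\<close> with \<open>u\<close> in \<open>S\<close> this
    is the coset of \<open>g\<close>, recovered from \<open>x\<close> alone.\<close>
  define kap where "kap x = {g \<in> carrier G. actX x (inv g) \<in> S}" for x
  have kap: "kap (actX u g) = coset N g" if u: "u \<in> S" and g: "g \<in> carrier G" for u g
  proof (intro subset_antisym subsetI)
    fix k assume "k \<in> kap (actX u g)"
    then have k: "k \<in> carrier G" "actX (actX u g) (inv k) \<in> S" by (auto simp: kap_def)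
    then have "actX u (g \<otimes> inv k) \<in> S" using SX[OF u] g by (simp add: X.act_mult)
    then have gk: "g \<otimes> inv k \<in> N" using SN[OF u] g k(1) by simp
    then have "inv (g \<otimes> inv k) \<in> N" using sN subgroup.m_inv_closed by fast
    moreover have "inv (g \<otimes> inv k) \<otimes> g = k" using g k(1) by (simp add: X.inv_mult_group X.m_assoc)
    ultimately show "k \<in> coset N g" unfolding coset_def by (metis image_eqI)
  next
    fix k assume "k \<in> coset N g"
    then obtain n where n: "n \<in> N" "k = n \<otimes> g" by (auto simp: coset_def)
    have "actX (actX u g) (inv k) = actX u (g \<otimes> inv k)" using SX[OF u] g n NG by (simp add: X.act_mult)
    also have "g \<otimes> inv k = inv n" using g n NG
      by (simp add: X.inv_mult_group X.m_assoc[symmetric])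
    finally have "actX (actX u g) (inv k) \<in> S" using NS[OF u] n(1) sN subgroup.m_inv_closed by fastforce
    then show "k \<in> kap (actX u g)" using g n NG by (simp add: kap_def)
  qed
  define F' where "F' x = (if p x \<in> K then F x else t (rp (kap x)) (p x))" for x
  have pu: "p (actX u g) = p u" if "u \<in> S" "g \<in> carrier G" for u g
    using X.orbit_act[OF SX[OF that(1)] that(2)] .
  have F'u: "F' (actX u g) = t (rp (coset N g)) (p u)" if u: "u \<in> S" and g: "g \<in> carrier G" for u g
  proof (cases "p u \<in> K")
    \<comment> \<open>Where \<open>F\<close> is already given, the representative leads to the same
      value, by normality of \<open>N\<close> and \<open>N\<close>-invariance of
      \<open>F\<close>.\<close>
    case True
    let ?r = "rp (coset N g)"
    obtain n where n: "n \<in> N" "?r = n \<otimes> g" using rp(1)[OF g] by (auto simp: coset_def)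
    have "inv g \<otimes> n \<otimes> inv (inv g) \<in> N" using conj[OF n(1), of "inv g"] g by simp
    then have c: "inv g \<otimes> n \<otimes> g \<in> N" using g by simp
    have "n \<otimes> g = g \<otimes> (inv g \<otimes> n \<otimes> g)" using g NG[OF n(1)] by (simp add: X.m_assoc[symmetric])
    then have "actX u ?r = actX (actX u g) (inv g \<otimes> n \<otimes> g)"
      using SX[OF u] g NG[OF n(1)] n(2) by (simp add: X.act_mult[symmetric])
    then have "F (actX u ?r) = F (actX u g)"
      using FN[OF X.act_closed[OF SX[OF u] g] _ c] pu[OF u g] True by simp
    then show ?thesis using t(2)[OF rp(2)[OF g] u True] pu[OF u g] True by (simp add: F'_def)
  next
    case False
    then show ?thesis using pu[OF u g] kap[OF u g] by (simp add: F'_def)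
  qed
  \<comment> \<open>The representative is \<open>n \<otimes> g\<close> with \<open>n\<close> in
    \<open>N\<close>, and \<open>n\<close> moves points of \<open>menger m\<close> by at most
    \<open>e\<close>.\<close>
  have F't: "near (a' + e) (F' (actX u g)) (actY (t1 (p u)) g)" if u: "u \<in> S" and g: "g \<in> carrier G" for u g
  proof -
    have z: "p u \<in> Z" using u by (simp add: Z_def)
    obtain n where n: "n \<in> N" "rp (coset N g) = n \<otimes> g" using rp(1)[OF g] by (auto simp: coset_def)
    have 1: "near a' (F' (actX u g)) (actY (t1 (p u)) (n \<otimes> g))"
      using t(3)[OF rp(2)[OF g] z] F'u[OF u g] n(2) by simp
    have "actY (t1 (p u)) (n \<otimes> g) = actY (actY (t1 (p u)) n) g"
      using menger_act_mult[OF t1M[OF z] NG[OF n(1)] g] .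
    moreover have "near e (actY (actY (t1 (p u)) n) g) (actY (t1 (p u)) g)"
      using nN[OF n(1) t1M[OF z]] t1M[OF z] NG[OF n(1)] g by (intro near_act) auto
    ultimately show ?thesis using near_trans[OF 1] by simp
  qed
  have F'M: "F' (actX u g) \<in> menger_set m" if "u \<in> S" "g \<in> carrier G" for u g
    using F'u[OF that] tM[OF rp(2)[OF that(2)]] that(1) by (simp add: Z_def)
  have Zrep: "\<exists>u\<in>S. \<exists>g\<in>carrier G. x = actX u g" if x: "x \<in> topspace X" "p x \<in> Z" for x
  proof -
    obtain u where "u \<in> S" "p u = p x" using x(2) by (auto simp: Z_def)
    then show ?thesis using X.orbit_eq_iff[OF SX x(1)] by blast
  qed
  have pact: "p (actX x g) = p x" if "x \<in> topspace X" "g \<in> carrier G" for x g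
    using X.orbit_act[OF that] .

  let ?KX = "{x \<in> topspace X. p x \<in> K}"
  \<comment> \<open>The translate of the slice that belongs to the coset \<open>c\<close>. These
    sets are closed and finite in number, which makes pasting possible.\<close>
  define D where "D c = {x \<in> topspace X. actX x (inv (rp c)) \<in> S}" for c
  have cD: "closedin X (D c)" if c: "c \<in> coset N ` carrier G" for c
  proof -
    have "continuous_map X X (\<lambda>x. actX x (inv (rp c)))"
      using c rp(2) continuous_map_id[of X] by (intro X.continuous_map_act_const) (auto simp: id_def)
    then show ?thesis unfolding D_def using cS by (rule closedin_continuous_map_preimage)
  qed
  have Drep: "x = actX (actX x (inv (rp c))) (rp c)" "p x = p (actX x (inv (rp c)))" "actX x (inv (rp c)) \<in> S"
    if "c \<in> coset N ` carrier G" "x \<in> D c" for c x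
    using that rp(2) X.act_inv(2) pact by (auto simp: D_def)
  have contD: "continuous_map (subtopology X (D c)) (menger m) F'" if c: "c \<in> coset N ` carrier G" for c
  proof -
    have r: "rp c \<in> carrier G" "coset N (rp c) = c" using c rp(2,3) by auto
    have pZ: "p x \<in> Z" if "x \<in> D c" for x using Drep[OF c that] by (auto simp: Z_def)
    have "continuous_map (subtopology X (D c)) (subtopology B Z) p"
      using pZ X.continuous_map_orbit by (auto simp: continuous_map_in_subtopology continuous_map_from_subtopology)
    then have "continuous_map (subtopology X (D c)) (menger m) (t (rp c) \<circ> p)"
      using t(1)[OF r(1)] by (rule continuous_map_compose)
    then show ?thesis
    proof (rule continuous_map_eq)
      fix x assume "x \<in> topspace (subtopology X (D c))"
      then have x: "x \<in> D c" by simp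
      have "F' x = t (rp (coset N (rp c))) (p (actX x (inv (rp c))))"
        using F'u[OF Drep(3)[OF c x] r(1)] Drep(1)[OF c x] by simp
      then show "(t (rp c) \<circ> p) x = F' x" using r(2) Drep(2)[OF c x] by simp
    qed
  qed
  have contK: "continuous_map (subtopology X ?KX) (menger m) F'"
    by (rule continuous_map_eq[of _ _ F]) (use F in \<open>auto simp: corrected_def F'_def\<close>)
  have cover: "\<Union> (insert ?KX (D ` (coset N ` carrier G))) = {x \<in> topspace X. p x \<in> K \<union> p ` S}"
  proof (intro subset_antisym subsetI)
    fix x assume "x \<in> \<Union> (insert ?KX (D ` (coset N ` carrier G)))"
    then consider "x \<in> ?KX" | c where "c \<in> coset N ` carrier G" "x \<in> D c" by blast
    then show "x \<in> {x \<in> topspace X. p x \<in> K \<union> p ` S}"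
    proof cases
      case 2
      then show ?thesis using Drep[OF 2] by (auto simp: D_def)
    qed auto
  next
    fix x assume x: "x \<in> {x \<in> topspace X. p x \<in> K \<union> p ` S}"
    show "x \<in> \<Union> (insert ?KX (D ` (coset N ` carrier G)))"
    proof (cases "p x \<in> K")
      case False
      then have "p x \<in> Z" using x by (auto simp: Z_def)
      then obtain u g where ug: "u \<in> S" "g \<in> carrier G" "x = actX u g" using Zrep x by blast
      then have "rp (coset N g) \<in> kap x" using kap[OF ug(1,2)] rp(1)[OF ug(2)] by simp
      then have "x \<in> D (coset N g)" using x by (simp add: kap_def D_def)
      then show ?thesis using ug(2) by blast
    qed (use x in blast)
  qed
  have "continuous_map (subtopology X {x \<in> topspace X. p x \<in> K \<union> p ` S}) (menger m) F'"
    unfolding cover[symmetric]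
  proof (rule continuous_map_closed_cover)
    show "finite (insert ?KX (D ` (coset N ` carrier G)))" using finite_cosets[OF oN sN] by simp
    fix C assume C: "C \<in> insert ?KX (D ` (coset N ` carrier G))"
    then show "closedin X C"
      using cD closedin_continuous_map_preimage[OF X.continuous_map_orbit K] by blast
    show "continuous_map (subtopology X C) (menger m) F'" using C contD contK by blast
  qed
  moreover have "(\<forall>n\<in>N. F' (actX x n) = F' x) \<and> (\<forall>g\<in>carrier G. near a2 (F' (actX x g)) (actY (F' x) g)) \<and> near b2 (F' x) (f x)"
    if x: "x \<in> topspace X" "p x \<in> K \<union> p ` S" for x
  proof (cases "p x \<in> K")
    case True
    have "F' (actX x g) = F (actX x g)" if "g \<in> carrier G" for g using pact[OF x(1) that] True by (simp add: F'_def)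
    moreover have "F' x = F x" using True by (simp add: F'_def)
    ultimately show ?thesis
      using FN[OF x(1) True] near_mono[OF Fa[OF x(1) True] bounds(2)] near_mono[OF Fb[OF x(1) True] bounds(4)] NG
      by simp
  next
    case False
    then have "p x \<in> Z" using x by (auto simp: Z_def)
    then obtain u g where ug: "u \<in> S" "g \<in> carrier G" "x = actX u g" using Zrep x by blast
    have z: "p u \<in> Z" using ug(1) by (simp add: Z_def)
    have uX: "u \<in> topspace X" using SX[OF ug(1)] .
    have xk: "actX x k = actX u (g \<otimes> k)" if "k \<in> carrier G" for k using uX ug that by (simp add: X.act_mult)
    have "F' (actX x n) = F' x" if n: "n \<in> N" for n
    proof -
      have "g \<otimes> n = (g \<otimes> n \<otimes> inv g) \<otimes> g" using ug(2) NG[OF n] by (simp add: X.m_assoc)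
      then have "g \<otimes> n \<in> coset N g" using conj[OF n ug(2)] unfolding coset_def by blast
      then have "coset N (g \<otimes> n) = coset N g" by (rule coset_eq[OF sN ug(2)])
      then show ?thesis using xk[OF NG[OF n]] F'u[OF ug(1)] ug(2,3) NG[OF n] by simp
    qed
    \<comment> \<open>Both sides are compared with the translate of \<open>t1\<close> by
      \<open>g \<otimes> k\<close>, whence the factor 2 in \<open>bounds\<close>.\<close>
    moreover have "near a2 (F' (actX x k)) (actY (F' x) k)" if k: "k \<in> carrier G" for k
    proof -
      have n1: "near (a' + e) (F' (actX x k)) (actY (t1 (p u)) (g \<otimes> k))"
        using F't[OF ug(1), of "g \<otimes> k"] xk[OF k] ug(2) k by simp
      have n2: "near (a' + e) (actY (F' x) k) (actY (actY (t1 (p u)) g) k)"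
        using F't[OF ug(1,2)] F'M[OF ug(1,2)] t1M[OF z] ug k by (intro near_act) auto
      have "actY (t1 (p u)) (g \<otimes> k) = actY (actY (t1 (p u)) g) k"
        using menger_act_mult[OF t1M[OF z] ug(2) k] .
      note act = this
      show ?thesis using near_trans[OF n1[unfolded act] near_sym[OF n2], of a2] bounds(1) by simp
    qed
    moreover have "near b2 (F' x) (f x)"
    proof -
      have 1: "near (a' + e) (F' x) (actY (t1 (p u)) g)" using F't[OF ug(1,2)] ug(3) by simp
      have 2: "near b' (actY (t1 (p u)) g) (actY (h (p u)) g)"
        using t1(3) z t1M[OF z] hM[OF z] ug(2) by (intro near_act) auto
      have 3: "near d (actY (h (p u)) g) (f x)" using hf[OF ug(1,2)] ug(3) by simp
      show ?thesis using near_trans[OF near_trans[OF 1 2 order_refl] 3] bounds(3) by simp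
    qed
    ultimately show ?thesis by blast
  qed
  ultimately have "corrected N (K \<union> p ` S) a2 b2 f F'" unfolding corrected_def by blast
  then show ?thesis by blast
qed


section \<open>Accumulated errors over a sequence of slices\<close>

lemma controlled_ext_antimono:
  assumes e: "controlled_ext a b" and a: "a' \<le> a"
  shows "controlled_ext a' b"
  unfolding controlled_ext_def
proof (intro allI impI)
  fix Z A h f
  assume asm: "closedin B Z" "closedin B A" "A \<subseteq> Z" "continuous_map (subtopology B Z) (menger m) h"
    "continuous_map (subtopology B A) (menger m) f" and n: "\<forall>z\<in>A. near a' (f z) (h z)"
  have "near a (f z) (h z)" if "z \<in> A" for z using near_mono[OF n[rule_format, OF that] a] .
  then show "\<exists>g. continuous_map (subtopology B Z) (menger m) g \<and> (\<forall>z\<in>A. g z = f z) \<and> (\<forall>z\<in>Z. near b (g z) (h z))"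
    by (rule e[unfolded controlled_ext_def, rule_format, OF asm])
qed

lemma small_subgroup_mono:
  assumes "small_subgroup e N" "e \<le> e'"
  shows "small_subgroup e' N"
  using assms(1) near_mono[OF _ assms(2)] unfolding small_subgroup_def by blast

text \<open>
  \<open>correctable J b d\<close>: a map that over each of \<open>J\<close> slices is \<open>d\<close>-close to given local data can be
  changed by at most \<open>b\<close> to a map over the union of their bases that is equivariant up to an
  arbitrarily small error. Crucially \<open>d\<close> does not depend on that error.
\<close>

definition local_data :: "nat \<Rightarrow> real \<Rightarrow> 'g set \<Rightarrow> ('x \<Rightarrow> nat \<Rightarrow> real) \<Rightarrow> (nat \<Rightarrow> 'x set) \<Rightarrow> (nat \<Rightarrow> 'x set \<Rightarrow> nat \<Rightarrow> real) \<Rightarrow> bool"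
  where "local_data J d N f S h \<longleftrightarrow> (\<forall>x\<in>topspace X. f x \<in> menger_set m) \<and>
    (\<forall>j<J. slice N (S j) \<and> continuous_map (subtopology B (p ` S j)) (menger m) (h j) \<and>
      (\<forall>u\<in>S j. \<forall>g\<in>carrier G. near d (actY (h j (p u)) g) (f (actX u g))))"

definition correctable :: "nat \<Rightarrow> real \<Rightarrow> real \<Rightarrow> bool" where
  "correctable J b d \<longleftrightarrow> (\<forall>a>0. \<exists>e>0. \<forall>N f S h. small_subgroup e N \<longrightarrow> local_data J d N f S h \<longrightarrow>
     (\<exists>F. corrected N (\<Union>j<J. p ` S j) a b f F))"

lemma correctable_0: "correctable 0 b d"
proof -
  have "corrected N {} a b f F" for N a f F
    by (simp add: corrected_def)
  then show ?thesis unfolding correctable_def by (auto intro!: exI[of _ 1])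
qed

text \<open>\<open>b0\<close>, \<open>b'\<close> and \<open>d\<close> are fixed before the final
  error \<open>a\<close> is given; \<open>a'\<close>, \<open>\<alpha>\<close> and \<open>e\<close>
  are then chosen for \<open>a\<close>. The smaller error this demands over the first
  \<open>J\<close> slices is available, because the induction hypothesis permits any.\<close>

lemma correctable_Suc:
  assumes J: "correctable J b0 d0" and controlled_ext: "controlled_ext (b0 + d) b'" and d: "d \<le> d0" and b: "b0 \<le> b" "b' + d \<le> b / 2" "b > 0"
  shows "correctable (Suc J) b d"
  unfolding correctable_def
proof (intro allI impI)
  fix a :: real assume a: "a > 0"
  define a' where "a' = min (a / 4) (b / 4)"
  have a': "a' > 0" "a' \<le> a / 4" "a' \<le> b / 4" using a b(3) by (auto simp: a'_def)
  obtain \<alpha> where \<alpha>: "\<alpha> > 0" "controlled_ext \<alpha> a'" using controlled_ext_small[OF a'(1)] by blast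
  \<comment> \<open>\<open>\<alpha>\<close> is what the extension over the new slice tolerates,
    \<open>a\<close> bounds the error over the old ones.\<close>
  have "min \<alpha> a > 0" using \<alpha>(1) a by simp
  then have "\<exists>e>0. \<forall>N f S h. small_subgroup e N \<longrightarrow> local_data J d0 N f S h \<longrightarrow>
      (\<exists>F. corrected N (\<Union>j<J. p ` S j) (min \<alpha> a) b0 f F)"
    using J unfolding correctable_def by simp
  then obtain e0 where e0: "e0 > 0" "\<forall>N f S h. small_subgroup e0 N \<longrightarrow> local_data J d0 N f S h \<longrightarrow>
      (\<exists>F. corrected N (\<Union>j<J. p ` S j) (min \<alpha> a) b0 f F)"
    by (elim exE conjE)
  define e where "e = min e0 (min (a / 4) (b / 4))"
  have e: "e > 0" "e \<le> e0" "e \<le> a / 4" "e \<le> b / 4" using e0(1) a b(3) by (auto simp: e_def)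
  show "\<exists>e>0. \<forall>N f S h. small_subgroup e N \<longrightarrow> local_data (Suc J) d N f S h \<longrightarrow>
     (\<exists>F. corrected N (\<Union>j<Suc J. p ` S j) a b f F)"
  proof (intro exI[of _ e] conjI e(1) allI impI)
    fix N f S h
    assume N: "small_subgroup e N" and fit: "local_data (Suc J) d N f S h"
    have f: "f x \<in> menger_set m" if "x \<in> topspace X" for x using fit that unfolding local_data_def by blast
    have sl: "slice N (S j)" "continuous_map (subtopology B (p ` S j)) (menger m) (h j)"
        "u \<in> S j \<Longrightarrow> g \<in> carrier G \<Longrightarrow> near d (actY (h j (p u)) g) (f (actX u g))" if "j < Suc J" for j u g
      using fit that unfolding local_data_def by blast+
    have "local_data J d0 N f S h"
      unfolding local_data_def using f sl near_mono[OF sl(3) d] by (simp add: less_SucI)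
    then obtain F where F: "corrected N (\<Union>j<J. p ` S j) (min \<alpha> a) b0 f F"
      using e0(2) small_subgroup_mono[OF N e(2)] by blast
    have S: "slice N (S j)" if "j \<le> J" for j using sl(1) that by simp
    have "closedin X (S j)" if "j \<le> J" for j using S[OF that] by (simp add: slice_def)
    then have "closedin B (p ` S j)" if "j \<le> J" for j
      using X.closed_map_orbit[OF compact_group compact_X Hausdorff_X] that unfolding closed_map_def by blast
    then have K: "closedin B (\<Union>j<J. p ` S j)" by (intro closedin_Union) auto
    have "\<exists>F. corrected N ((\<Union>j<J. p ` S j) \<union> p ` S J) a b f F"
    proof (rule extend_over_slice[OF N S _ _ _ K F _ controlled_ext])
      show "continuous_map (subtopology B (p ` S J)) (menger m) (h J)" using sl(2) by simp
      show "near d (actY (h J (p u)) g) (f (actX u g))" if "u \<in> S J" "g \<in> carrier G" for u g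
        using sl(3) that by simp
      show "controlled_ext (min \<alpha> a) a'" using controlled_ext_antimono[OF \<alpha>(2)] by simp
      show "2 * (a' + e) \<le> a" using add_mono[OF a'(2) e(3)] by (simp add: field_simps)
      show "a' + e + b' + d \<le> b" using add_mono[OF add_mono[OF a'(3) e(4)] b(2)] by (simp add: field_simps)
    qed (use f b in auto)
    moreover have "(\<Union>j<Suc J. p ` S j) = (\<Union>j<J. p ` S j) \<union> p ` S J" by (auto simp: lessThan_Suc)
    ultimately show "\<exists>F. corrected N (\<Union>j<Suc J. p ` S j) a b f F" by simp
  qed
qed

text \<open>The last slice is budgeted first: \<open>\<beta>\<close> is the deviation that its
  extension tolerates. Half of it is left to the displacement over the earlier slices and half to
  \<open>d\<close>.\<close>

lemma correctable_exists: "b > 0 \<Longrightarrow> \<exists>d>0. correctable J b d"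
proof (induction J arbitrary: b)
  case 0
  show ?case using correctable_0 by (intro exI[of _ 1]) simp
next
  case (Suc J)
  have "b / 4 > 0" using Suc.prems by simp
  then obtain \<beta> where \<beta>: "\<beta> > 0" "controlled_ext \<beta> (b / 4)" using controlled_ext_small by blast
  have "min b (\<beta> / 2) > 0" using \<beta>(1) Suc.prems by simp
  then obtain d0 where d0: "d0 > 0" "correctable J (min b (\<beta> / 2)) d0" using Suc.IH by blast
  define d where "d = min d0 (min (\<beta> / 2) (b / 4))"
  have d: "d > 0" "d \<le> d0" "d \<le> \<beta> / 2" "d \<le> b / 4" using d0(1) \<beta>(1) Suc.prems by (auto simp: d_def)
  have "controlled_ext (min b (\<beta> / 2) + d) (b / 4)" using d(3) by (intro controlled_ext_antimono[OF \<beta>(2)]) linarith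
  from correctable_Suc[OF d0(2) this d(2), of b] show ?case using d(1,4) Suc.prems by (intro exI[of _ d]) simp
qed

text \<open>Coarse constants for the first correction. \<open>improve_equivariance\<close> asks for
  equivariance up to \<open>d / 4\<close>, and with \<open>d = 4\<close> every map qualifies by
  \<open>near_one\<close>; then \<open>1 + d \<le> b / 2\<close> holds for
  \<open>b = 16\<close>.\<close>

lemma correctable_start: "correctable J 16 4"
proof (induction J)
  case (Suc J)
  show ?case by (rule correctable_Suc[OF Suc controlled_ext_one]) auto
qed (rule correctable_0)

section \<open>Existence of slices\<close>

lemma openin_compact_many:
  assumes U: "openin X U" and C: "compactin T C"
  shows "openin X {x \<in> topspace X. \<forall>g\<in>C. actX x g \<in> U}"
proof (subst openin_subopen, intro ballI)
  fix x assume x: "x \<in> {x \<in> topspace X. \<forall>g\<in>C. actX x g \<in> U}"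
  have CT: "C \<subseteq> topspace T" using C compactin_subset_topspace by blast
  let ?W = "{q \<in> topspace (prod_topology X T). (\<lambda>(x, g). actX x g) q \<in> U}"
  have W: "openin (prod_topology X T) ?W"
    using X.continuous_act U by (rule openin_continuous_map_preimage)
  have sub: "{x} \<times> C \<subseteq> ?W" using x CT by auto
  have "x \<in> topspace X" using x by blast
  from tube_lemma_right[OF W C this sub]
  obtain V V' where V: "openin X V" "openin T V'" "x \<in> V" "C \<subseteq> V'" "V \<times> V' \<subseteq> ?W" by (elim exE conjE)
  have "V \<subseteq> {x \<in> topspace X. \<forall>g\<in>C. actX x g \<in> U}"
  proof
    fix y assume y: "y \<in> V"
    have "actX y g \<in> U" if "g \<in> C" for g
    proof -
      have "(y, g) \<in> ?W" using y that V(4,5) by blast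
      then show ?thesis by simp
    qed
    then show "y \<in> {x \<in> topspace X. \<forall>g\<in>C. actX x g \<in> U}" using y openin_subset[OF V(1)] by blast
  qed
  then show "\<exists>V. openin X V \<and> x \<in> V \<and> V \<subseteq> {x \<in> topspace X. \<forall>g\<in>C. actX x g \<in> U}" using V(1,3) by blast
qed

text \<open>By freeness the translates of \<open>x0\<close> by \<open>N\<close> and by its
  complement form disjoint compact sets, which have disjoint neighbourhoods; the tube lemma gives a
  \<open>V\<close> whose points behave like \<open>x0\<close>. The bound \<open>3 * d\<close> adds
  the size of a neighbourhood, the defect of equivariance and the motion by
  \<open>N\<close>.\<close>

lemma local_slice:
  assumes N: "small_subgroup e N" and f: "continuous_map X (menger m) f"
    and eq: "\<And>x g. x \<in> topspace X \<Longrightarrow> g \<in> carrier G \<Longrightarrow> near d (f (actX x g)) (actY (f x) g)"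
    and d: "e \<le> d" "d > 0" and x0: "x0 \<in> topspace X"
  shows "\<exists>V. openin X V \<and> x0 \<in> V \<and> (\<forall>u\<in>V. \<forall>n\<in>N. actX u n \<in> V) \<and>
    (\<forall>u\<in>V. \<forall>g\<in>carrier G. actX u g \<in> V \<longrightarrow> g \<in> N) \<and> (\<forall>u\<in>V. near (3 * d) (f u) (f x0))"
proof -
  have oN: "openin T N" and sN: "subgroup N G" and nN: "\<And>n y. n \<in> N \<Longrightarrow> y \<in> menger_set m \<Longrightarrow> near e (actY y n) y"
    using N unfolding small_subgroup_def by blast+
  have NG: "N \<subseteq> carrier G" using subgroup.subset[OF sN] .
  have cT: "compactin T (topspace T)" using compact_group by (simp add: compact_space_def)
  have "closedin T (topspace T - N)" using oN by blast
  then have cC: "compactin T (topspace T - N)" using closedin_compact_space[OF compact_group] by blast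
  have "topspace T - N = \<Union>(coset N ` (carrier G - N))"
  proof (intro subset_antisym subsetI)
    fix g assume "g \<in> topspace T - N"
    then show "g \<in> \<Union>(coset N ` (carrier G - N))" using self_in_coset[OF sN, of g] by (auto simp: X.topspace_eq_carrier)
  next
    fix h assume "h \<in> \<Union>(coset N ` (carrier G - N))"
    then obtain g where g: "g \<in> carrier G" "g \<notin> N" "h \<in> coset N g" by blast
    have "h \<notin> N"
    proof
      assume "h \<in> N"
      moreover obtain n where "n \<in> N" "h = n \<otimes> g" using g(3) by (auto simp: coset_def)
      ultimately have "inv n \<otimes> (n \<otimes> g) \<in> N" using sN subgroup.m_closed subgroup.m_inv_closed by fast
      moreover have "inv n \<otimes> (n \<otimes> g) = g" using \<open>n \<in> N\<close> NG g(1) by (simp add: X.m_assoc[symmetric] subset_iff)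
      ultimately show False using g(2) by simp
    qed
    then show "h \<in> topspace T - N" using coset_subset[OF sN g(1)] g(3) by (auto simp: X.topspace_eq_carrier)
  qed
  then have "openin T (topspace T - N)" using openin_coset[OF oN sN] by auto
  then have "closedin T N" using NG by (simp add: closedin_def X.topspace_eq_carrier)
  then have cN: "compactin T N" using closedin_compact_space[OF compact_group] by blast
  have cx: "continuous_map T X (actX x0)"
    using X.continuous_map_act[of T "\<lambda>g. x0" "\<lambda>g. g"] x0 continuous_map_id[of T] by (simp add: id_def)
  have "disjnt (actX x0 ` N) (actX x0 ` (topspace T - N))"
    unfolding disjnt_iff
  proof (intro allI notI)
    fix y assume "y \<in> actX x0 ` N \<and> y \<in> actX x0 ` (topspace T - N)"
    then obtain n g where ng: "n \<in> N" "g \<in> carrier G" "g \<notin> N" "actX x0 n = actX x0 g"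
      by (auto simp: X.topspace_eq_carrier)
    have nG: "n \<in> carrier G" using ng(1) NG by blast
    have "actX x0 (n \<otimes> inv g) = x0" using ng(2,4) nG x0 by (simp add: X.act_mult)
    then have "n \<otimes> inv g = \<one>" using X.free[OF x0, of "n \<otimes> inv g"] nG ng(2) by simp
    then have "n = g" using nG ng(2) X.inv_equality[of n "inv g"] by simp
    then show False using ng by simp
  qed
  then obtain U1 U2 where U: "openin X U1" "openin X U2" "actX x0 ` N \<subseteq> U1" "actX x0 ` (topspace T - N) \<subseteq> U2" "disjnt U1 U2"
    using Hausdorff_X[unfolded Hausdorff_space_compact_sets] image_compactin[OF cN cx] image_compactin[OF cC cx] by meson
  have fM: "f x \<in> menger_set m" if "x \<in> topspace X" for x using continuous_map_menger_image[OF f that] .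
  have "\<exists>W. openin X W \<and> actX x0 n \<in> W \<and> (\<forall>u\<in>W. near (3 * d) (f u) (f x0))" if n: "n \<in> N" for n
  proof -
    have nG: "n \<in> carrier G" using n NG by blast
    have xn: "actX x0 n \<in> topspace X" using X.act_closed[OF x0 nG] .
    obtain V where V: "openin (menger m) V" "f (actX x0 n) \<in> V" "\<And>z. z \<in> V \<Longrightarrow> near d z (f (actX x0 n))"
      using near_open[OF fM[OF xn] d(2)] by blast
    have "near (3 * d) (f u) (f x0)" if "f u \<in> V" for u
    proof -
      have "near (d + d) (f u) (actY (f x0) n)"
        using near_trans[OF V(3)[OF that] eq[OF x0 nG]] by simp
      moreover have "near d (actY (f x0) n) (f x0)" using near_mono[OF nN[OF n fM[OF x0]] d(1)] .
      ultimately show ?thesis using near_trans by simp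
    qed
    moreover have "openin X {x \<in> topspace X. f x \<in> V}" using f V(1) by (rule openin_continuous_map_preimage)
    ultimately show ?thesis using V(2) xn by (intro exI[of _ "{x \<in> topspace X. f x \<in> V}"]) auto
  qed
  then have "\<forall>n\<in>N. \<exists>W. openin X W \<and> actX x0 n \<in> W \<and> (\<forall>u\<in>W. near (3 * d) (f u) (f x0))" by blast
  then obtain W where W: "\<forall>n\<in>N. openin X (W n) \<and> actX x0 n \<in> W n \<and> (\<forall>u\<in>W n. near (3 * d) (f u) (f x0))"
    by (rule bchoice[THEN exE])
  define U where "U = U1 \<inter> (\<Union>n\<in>N. W n)"
  have "openin X (\<Union>n\<in>N. W n)" using W by (intro openin_Union) auto
  then have oU: "openin X U" unfolding U_def using U(1) by (rule openin_Int[rotated])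
  \<comment> \<open>Quantifying over all of \<open>N\<close> and of its complement makes
    \<open>V\<close> invariant, since both are stable under multiplication by
    \<open>N\<close>.\<close>
  define V where "V = {x \<in> topspace X. \<forall>n\<in>N. actX x n \<in> U} \<inter> {x \<in> topspace X. \<forall>g\<in>topspace T - N. actX x g \<in> U2}"
  have VU: "u \<in> U" if "u \<in> V" for u
  proof -
    have "actX u \<one> \<in> U" using that subgroup.one_closed[OF sN] unfolding V_def by blast
    then show ?thesis using that by (simp add: V_def X.act_one)
  qed
  have v1: "openin X V" unfolding V_def
    by (intro openin_Int openin_compact_many oU U(2) cN cC)
  have v2: "x0 \<in> V" using x0 U(3,4) W unfolding V_def U_def by blast
  have v3: "actX u n \<in> V" if u: "u \<in> V" and n: "n \<in> N" for u n
  proof -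
    have uX: "u \<in> topspace X" and nG: "n \<in> carrier G" using u n NG by (auto simp: V_def)
    have 1: "actX (actX u n) k = actX u (n \<otimes> k)" if "k \<in> carrier G" for k using uX nG that by (simp add: X.act_mult)
    have "actX (actX u n) k \<in> U" if k: "k \<in> N" for k
    proof -
      have "n \<otimes> k \<in> N" using n k sN subgroup.m_closed by fast
      moreover have "k \<in> carrier G" using k NG by blast
      ultimately show ?thesis using u 1 unfolding V_def by simp
    qed
    moreover have "actX (actX u n) k \<in> U2" if k: "k \<in> topspace T - N" for k
    proof -
      have kG: "k \<in> carrier G" using k by (simp add: X.topspace_eq_carrier)
      have "n \<otimes> k \<notin> N"
      proof
        assume "n \<otimes> k \<in> N"
        then have "inv n \<otimes> (n \<otimes> k) \<in> N" using n sN subgroup.m_closed subgroup.m_inv_closed by fast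
        moreover have "inv n \<otimes> (n \<otimes> k) = k" using nG kG by (simp add: X.m_assoc[symmetric])
        ultimately show False using k by simp
      qed
      then have "n \<otimes> k \<in> topspace T - N" using nG kG by (simp add: X.topspace_eq_carrier)
      then show ?thesis using u 1[OF kG] unfolding V_def by simp
    qed
    ultimately show ?thesis using X.act_closed[OF uX nG] by (simp add: V_def)
  qed
  have v4: "g \<in> N" if u: "u \<in> V" and g: "g \<in> carrier G" and ug: "actX u g \<in> V" for u g
  proof (rule ccontr)
    assume "g \<notin> N"
    then have "actX u g \<in> U2" using u g unfolding V_def by (simp add: X.topspace_eq_carrier)
    moreover have "actX u g \<in> U1" using VU[OF ug] by (simp add: U_def)
    ultimately show False using U(5) by (auto simp: disjnt_iff)
  qed
  have v5: "near (3 * d) (f u) (f x0)" if u: "u \<in> V" for u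
    using VU[OF u] W unfolding U_def by blast
  show ?thesis
    by (intro exI[of _ V] conjI ballI impI v1 v2 v3 v5) (assumption | rule v4)+
qed


text \<open>\<open>V\<close> is only open, but over \<open>C\<close> its complement consists of the
  points that some element outside \<open>N\<close> carries into \<open>V\<close>, and these form an
  open set as well.\<close>

lemma slice_over_closed:
  assumes N: "small_subgroup e N" and V: "openin X V"
    and VN: "\<And>u n. u \<in> V \<Longrightarrow> n \<in> N \<Longrightarrow> actX u n \<in> V"
    and NV: "\<And>u g. u \<in> V \<Longrightarrow> g \<in> carrier G \<Longrightarrow> actX u g \<in> V \<Longrightarrow> g \<in> N"
    and C: "closedin B C" "C \<subseteq> p ` V"
  shows "closedin X {u \<in> V. p u \<in> C}"
proof -
  have sN: "subgroup N G" using N unfolding small_subgroup_def by blast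
  have NG: "n \<in> carrier G" if "n \<in> N" for n using sN subgroup.mem_carrier that by fast
  have VX: "u \<in> topspace X" if "u \<in> V" for u using openin_subset[OF V] that by blast
  have op: "openin X {x \<in> topspace X. actX x g \<in> V}" if "g \<in> carrier G" for g
    using X.continuous_map_act_const[OF _ that, of X "\<lambda>x. x"] V by (intro openin_continuous_map_preimage) auto
  have "openin X (\<Union>g\<in>carrier G - N. {x \<in> topspace X. actX x g \<in> V})" using op by (intro openin_Union) auto
  moreover have "closedin X {x \<in> topspace X. p x \<in> C}"
    using closedin_continuous_map_preimage[OF X.continuous_map_orbit C(1)] .
  ultimately have "closedin X ({x \<in> topspace X. p x \<in> C} - (\<Union>g\<in>carrier G - N. {x \<in> topspace X. actX x g \<in> V}))"
    by (intro closedin_diff)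
  also have "\<dots> = {u \<in> V. p u \<in> C}"
  proof (intro subset_antisym subsetI)
    fix x assume x: "x \<in> {x \<in> topspace X. p x \<in> C} - (\<Union>g\<in>carrier G - N. {x \<in> topspace X. actX x g \<in> V})"
    then have xX: "x \<in> topspace X" "p x \<in> C" by auto
    then obtain u where u: "u \<in> V" "p x = p u" using C(2) by blast
    then obtain g where g: "g \<in> carrier G" "u = actX x g" using X.orbit_eq_iff[OF xX(1) VX[OF u(1)]] by blast
    have gN: "g \<in> N" using x g u(1) by auto
    then have "inv g \<in> N" using sN subgroup.m_inv_closed by fast
    then have "actX u (inv g) \<in> V" using VN u(1) by blast
    then show "x \<in> {u \<in> V. p u \<in> C}" using g xX by simp
  next
    fix x assume "x \<in> {u \<in> V. p u \<in> C}"
    then show "x \<in> {x \<in> topspace X. p x \<in> C} - (\<Union>g\<in>carrier G - N. {x \<in> topspace X. actX x g \<in> V})"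
      using NV VX by auto
  qed
  finally show ?thesis .
qed

text \<open>Over each small set \<open>C\<close> the local data are constant with value
  \<open>f (x C)\<close>. The tolerance \<open>d\<close> splits into \<open>3 * (d / 4)\<close> for
  the variation of \<open>f\<close> on a slice and \<open>d / 4\<close> for its defect of
  equivariance.\<close>

lemma improve_equivariance:
  assumes correctable: "correctable (Suc m) b d" and d: "d > 0" and a: "a > 0"
    and f: "continuous_map X (menger m) f"
    and eq: "\<And>x g. x \<in> topspace X \<Longrightarrow> g \<in> carrier G \<Longrightarrow> near (d / 4) (f (actX x g)) (actY (f x) g)"
  obtains F where "continuous_map X (menger m) F"
    "\<And>x g. x \<in> topspace X \<Longrightarrow> g \<in> carrier G \<Longrightarrow> near a (F (actX x g)) (actY (F x) g)"
    "\<And>x. x \<in> topspace X \<Longrightarrow> near b (F x) (f x)"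
proof -
  obtain e0 where e0: "e0 > 0" "\<forall>N f S h. small_subgroup e0 N \<longrightarrow> local_data (Suc m) d N f S h \<longrightarrow>
     (\<exists>F. corrected N (\<Union>j<Suc m. p ` S j) a b f F)"
    using correctable a unfolding correctable_def by (elim allE[of _ a]) auto
  define e where "e = min e0 (d / 4)"
  have e: "e > 0" "e \<le> e0" "e \<le> d / 4" using e0(1) d by (auto simp: e_def)
  obtain N where "openin T N" "subgroup N G" "\<And>n g. n \<in> N \<Longrightarrow> g \<in> carrier G \<Longrightarrow> g \<otimes> n \<otimes> inv g \<in> N"
    "\<And>n y. n \<in> N \<Longrightarrow> y \<in> menger_set m \<Longrightarrow> near e (actY y n) y"
    using near_small_subgroup[OF e(1)] by blast
  then have N: "small_subgroup e N" by (simp add: small_subgroup_def)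
  have fM: "f x \<in> menger_set m" if "x \<in> topspace X" for x using continuous_map_menger_image[OF f that] .
  have d4: "d / 4 > 0" using d by simp
  have "\<forall>x\<in>topspace X. \<exists>V. openin X V \<and> x \<in> V \<and> (\<forall>u\<in>V. \<forall>n\<in>N. actX u n \<in> V) \<and>
      (\<forall>u\<in>V. \<forall>g\<in>carrier G. actX u g \<in> V \<longrightarrow> g \<in> N) \<and> (\<forall>u\<in>V. near (3 * (d / 4)) (f u) (f x))"
    using local_slice[OF N f eq e(3) d4] by blast
  then obtain V where "\<forall>x\<in>topspace X. openin X (V x) \<and> x \<in> V x \<and> (\<forall>u\<in>V x. \<forall>n\<in>N. actX u n \<in> V x) \<and>
      (\<forall>u\<in>V x. \<forall>g\<in>carrier G. actX u g \<in> V x \<longrightarrow> g \<in> N) \<and> (\<forall>u\<in>V x. near (3 * (d / 4)) (f u) (f x))"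
    by (rule bchoice[THEN exE])
  then have V: "openin X (V x)" "x \<in> V x" "u \<in> V x \<Longrightarrow> n \<in> N \<Longrightarrow> actX u n \<in> V x"
    "u \<in> V x \<Longrightarrow> g \<in> carrier G \<Longrightarrow> actX u g \<in> V x \<Longrightarrow> g \<in> N" "u \<in> V x \<Longrightarrow> near (3 * (d / 4)) (f u) (f x)"
    if "x \<in> topspace X" for x u n g
    using that by blast+
  define s where "s z = (SOME x. x \<in> topspace X \<and> z = p x)" for z
  have s: "s z \<in> topspace X" "p (s z) = z" if z: "z \<in> topspace B" for z
  proof -
    have "\<exists>x. x \<in> topspace X \<and> z = p x" using X.orbit_surj[OF z] by blast
    then have "s z \<in> topspace X \<and> z = p (s z)" unfolding s_def by (rule someI_ex)
    then show "s z \<in> topspace X" "p (s z) = z" by auto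
  qed
  have opU: "openin B (p ` V (s z)) \<and> z \<in> p ` V (s z)" if z: "z \<in> topspace B" for z
    using X.open_map_orbit V(1,2)[OF s(1)[OF z]] s(2)[OF z] unfolding open_map_def by (metis imageI)
  obtain E where E: "finite E" "E \<subseteq> topspace B" "topspace B \<subseteq> (\<Union>z\<in>E. p ` V (s z))"
    by (rule compact_space_points[OF compact_B opU]) (assumption | rule that)+
  have cov: "open_cover B ((\<lambda>z. p ` V (s z)) ` E)"
    unfolding open_cover_def
  proof (intro conjI ballI)
    show op: "openin B U" if "U \<in> (\<lambda>z. p ` V (s z)) ` E" for U using that opU E(2) by blast
    show "\<Union> ((\<lambda>z. p ` V (s z)) ` E) = topspace B"
      using E(3) openin_subset[OF op] by (intro subset_antisym Union_least) auto
  qed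
  obtain \<F> :: "nat \<Rightarrow> 'x set set set" where F: "\<And>j. j \<le> m \<Longrightarrow> finite (\<F> j)" "\<And>j. j \<le> m \<Longrightarrow> pairwise disjnt (\<F> j)"
    "\<And>j C. j \<le> m \<Longrightarrow> C \<in> \<F> j \<Longrightarrow> closedin B C"
    "\<And>j C. j \<le> m \<Longrightarrow> C \<in> \<F> j \<Longrightarrow> \<exists>U\<in>(\<lambda>z. p ` V (s z)) ` E. C \<subseteq> U" "topspace B = (\<Union>j\<le>m. \<Union>(\<F> j))"
    by (rule coloredE[OF colored_orbits finite_imageI[OF E(1)] cov]) (assumption | rule that)+
  define x where "x C = s (SOME z. z \<in> E \<and> C \<subseteq> p ` V (s z))" for C
  have x: "x C \<in> topspace X" "C \<subseteq> p ` V (x C)" if "j \<le> m" "C \<in> \<F> j" for j C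
  proof -
    have "\<exists>z. z \<in> E \<and> C \<subseteq> p ` V (s z)" using F(4)[OF that] by blast
    then have "(SOME z. z \<in> E \<and> C \<subseteq> p ` V (s z)) \<in> E \<and> C \<subseteq> p ` V (x C)" unfolding x_def by (rule someI_ex)
    then show "x C \<in> topspace X" "C \<subseteq> p ` V (x C)" using s(1) E(2) by (auto simp: x_def)
  qed
  \<comment> \<open>Slices over the members of one family have disjoint bases, so their union is a
    slice again.\<close>
  define S where "S j = (\<Union>C\<in>\<F> j. {u \<in> V (x C). p u \<in> C})" for j
  have pS: "p ` S j = \<Union>(\<F> j)" if j: "j \<le> m" for j
  proof (intro subset_antisym subsetI)
    fix z assume "z \<in> \<Union>(\<F> j)"
    then obtain C where C: "C \<in> \<F> j" "z \<in> C" by blast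
    then obtain u where "u \<in> V (x C)" "z = p u" using x(2)[OF j C(1)] by blast
    then show "z \<in> p ` S j" using C unfolding S_def by blast
  qed (auto simp: S_def)
  have "\<exists>h. continuous_map (subtopology B (p ` S j)) (menger m) h \<and> (\<forall>C\<in>\<F> j. \<forall>z\<in>C. h z = f (x C))" if j: "j \<le> m" for j
  proof -
    have "f (x C) \<in> topspace (menger m)" if "C \<in> \<F> j" for C using fM[OF x(1)[OF j that]] by (simp add: topspace_menger)
    then obtain h where "continuous_map (subtopology B (\<Union>(\<F> j))) (menger m) h" "\<And>C z. C \<in> \<F> j \<Longrightarrow> z \<in> C \<Longrightarrow> h z = f (x C)"
      using continuous_piecewise_const[OF F(1-3)[OF j], of "\<lambda>C. f (x C)" "menger m"] by blast
    then show ?thesis using pS[OF j] by auto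
  qed
  then have "\<forall>j\<in>{..m}. \<exists>h. continuous_map (subtopology B (p ` S j)) (menger m) h \<and> (\<forall>C\<in>\<F> j. \<forall>z\<in>C. h z = f (x C))" by simp
  then obtain h where "\<forall>j\<in>{..m}. continuous_map (subtopology B (p ` S j)) (menger m) (h j) \<and> (\<forall>C\<in>\<F> j. \<forall>z\<in>C. h j z = f (x C))"
    by (rule bchoice[THEN exE])
  then have h: "continuous_map (subtopology B (p ` S j)) (menger m) (h j)" "C \<in> \<F> j \<Longrightarrow> z \<in> C \<Longrightarrow> h j z = f (x C)"
    if "j \<le> m" for j C z
    using that by blast+
  have SV: "\<exists>C\<in>\<F> j. u \<in> V (x C) \<and> p u \<in> C" if "u \<in> S j" for u j using that by (auto simp: S_def)
  have NG: "n \<in> carrier G" if "n \<in> N" for n using N subgroup.mem_carrier that unfolding small_subgroup_def by fast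
  have SX: "u \<in> topspace X" if "u \<in> S j" "j \<le> m" for u j
    using SV[OF that(1)] V(1)[OF x(1)[OF that(2)]] openin_subset by blast
  have sl: "slice N (S j)" if j: "j \<le> m" for j
    unfolding slice_def
  proof (intro conjI ballI impI)
    show "closedin X (S j)"
      unfolding S_def
    proof (rule closedin_Union)
      show "finite ((\<lambda>C. {u \<in> V (x C). p u \<in> C}) ` \<F> j)" using F(1)[OF j] by simp
      fix A assume "A \<in> (\<lambda>C. {u \<in> V (x C). p u \<in> C}) ` \<F> j"
      then obtain C where C: "C \<in> \<F> j" "A = {u \<in> V (x C). p u \<in> C}" by blast
      note xC = x[OF j C(1)]
      show "closedin X A" unfolding C(2)
        by (rule slice_over_closed[OF N V(1)[OF xC(1)] _ _ F(3)[OF j C(1)] xC(2)]) (use V(3,4)[OF xC(1)] in blast)+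
    qed
    fix u assume u: "u \<in> S j"
    obtain C where C: "C \<in> \<F> j" "u \<in> V (x C)" "p u \<in> C" using SV[OF u] by blast
    note xC = x[OF j C(1)]
    show "actX u n \<in> S j" if n: "n \<in> N" for n
      using V(3)[OF xC(1) C(2) n] X.orbit_act[OF SX[OF u j] NG[OF n]] C by (auto simp: S_def)
    show "g \<in> N" if g: "g \<in> carrier G" "actX u g \<in> S j" for g
    proof -
      obtain C' where C': "C' \<in> \<F> j" "actX u g \<in> V (x C')" "p (actX u g) \<in> C'" using SV[OF g(2)] by blast
      have "p u \<in> C'" using C'(3) X.orbit_act[OF SX[OF u j] g(1)] by simp
      then have "C' = C" using F(2)[OF j] C(1,3) C'(1) by (metis disjnt_iff pairwiseD)
      then show ?thesis using V(4)[OF xC(1) C(2) g(1)] C'(2) by simp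
    qed
  qed
  have "local_data (Suc m) d N f S h"
    unfolding local_data_def
  proof (intro conjI ballI allI impI fM)
    fix j assume "j < Suc m"
    then have j: "j \<le> m" by simp
    show "slice N (S j)" using sl[OF j] .
    show "continuous_map (subtopology B (p ` S j)) (menger m) (h j)" using h(1)[OF j] .
    fix u g assume u: "u \<in> S j" and g: "g \<in> carrier G"
    obtain C where C: "C \<in> \<F> j" "u \<in> V (x C)" "p u \<in> C" using SV[OF u] by blast
    note xC = x[OF j C(1)]
    have 1: "near (3 * (d / 4)) (actY (f (x C)) g) (actY (f u) g)"
      using near_act[OF near_sym[OF V(5)[OF xC(1) C(2)]] fM[OF xC(1)] fM[OF SX[OF u j]] g] .
    have 2: "near (d / 4) (actY (f u) g) (f (actX u g))" using near_sym[OF eq[OF SX[OF u j] g]] .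
    show "near d (actY (h j (p u)) g) (f (actX u g))"
      using near_trans[OF 1 2, of d] h(2)[OF j C(1,3)] by simp
  qed
  then obtain F where F: "corrected N (\<Union>j<Suc m. p ` S j) a b f F"
    using e0(2) small_subgroup_mono[OF N e(2)] by blast
  have "(\<Union>j<Suc m. p ` S j) = (\<Union>j\<le>m. \<Union>(\<F> j))" using pS by (simp add: lessThan_Suc_atMost)
  then have B: "(\<Union>j<Suc m. p ` S j) = topspace B" using F(1) \<open>topspace B = _\<close> by simp
  have all: "{x \<in> topspace X. p x \<in> topspace B} = topspace X" using X.orbit_in_orbits by blast
  show ?thesis
    by (rule that[of F]) (use F[unfolded B corrected_def all] X.orbit_in_orbits in auto)
qed

text \<open>The tolerances \<open>d n\<close> are known in advance, so each correction can aim at a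
  defect below what the next one tolerates. Its displacement \<open>2 / 3 ^ n\<close> is summable no
  matter how small that defect has to be.\<close>

theorem equivariant_map_exists: "\<exists>f. equivariant_map G X actX (menger m) actY f"
proof -
  define t where "t n = 1 / (3::real) ^ n" for n :: nat
  have t: "t n > 0" for n by (simp add: t_def)
  have "\<forall>n. \<exists>d>0. correctable (Suc m) (2 * t n) d" using correctable_exists[of "2 * t _" "Suc m"] t by simp
  then obtain d where d: "\<And>n. d n > 0" "\<And>n. correctable (Suc m) (2 * t n) (d n)" by metis
  \<comment> \<open>\<open>d n / 4\<close> is what correction \<open>n\<close> asks of its input,
    \<open>t n\<close> makes the defects tend to 0.\<close>
  define r where "r n = min (d n / 4) (t n)" for n
  have r: "r n > 0" "r n \<le> d n / 4" "r n \<le> t n" for n using d(1) t by (auto simp: r_def)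
  define P where "P n f \<longleftrightarrow> continuous_map X (menger m) f \<and>
    (\<forall>x\<in>topspace X. \<forall>g\<in>carrier G. near (r n) (f (actX x g)) (actY (f x) g))" for n f
  have "\<exists>f. \<forall>n. P n (f n) \<and> (\<forall>x\<in>topspace X. near (2 * t n) (f (Suc n) x) (f n x))"
  proof (rule dependent_nat_choice)
    have z: "(\<lambda>_. 0) \<in> menger_set m" using zero_in_menger topspace_menger by blast
    have c: "continuous_map X (menger m) (\<lambda>x _. 0)" using zero_in_menger by simp
    \<comment> \<open>\<open>4 / 4\<close> is the \<open>d / 4\<close> of
      \<open>improve_equivariance\<close> at \<open>d = 4\<close>; all points are that near.\<close>
    have n: "near (4 / 4) ((\<lambda>x _. 0) (actX x g)) (actY ((\<lambda>x _. 0) x) g)" if "x \<in> topspace X" "g \<in> carrier G" for x g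
      using z that(2) by (intro near_one) auto
    have "(4::real) > 0" by simp
    obtain F where "continuous_map X (menger m) F"
      "\<And>x g. x \<in> topspace X \<Longrightarrow> g \<in> carrier G \<Longrightarrow> near (r 0) (F (actX x g)) (actY (F x) g)"
      by (rule improve_equivariance[OF correctable_start \<open>(4::real) > 0\<close> r(1)[of 0] c n]) (assumption | rule that)+
    then have "P 0 F" by (simp add: P_def)
    then show "\<exists>f. P 0 f" by (rule exI[of "P 0"])
    fix f n assume f: "P n f"
    have eq: "near (d n / 4) (f (actX x g)) (actY (f x) g)" if "x \<in> topspace X" "g \<in> carrier G" for x g
      using near_mono[OF _ r(2)] f that unfolding P_def by blast
    have cf: "continuous_map X (menger m) f" using f unfolding P_def by blast
    show "\<exists>F. P (Suc n) F \<and> (\<forall>x\<in>topspace X. near (2 * t n) (F x) (f x))"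
      by (rule improve_equivariance[OF d(2) d(1) r(1)[of "Suc n"] cf eq]) (auto simp: P_def)
  qed
  then obtain f where f: "\<And>n. P n (f n)" "\<And>n x. x \<in> topspace X \<Longrightarrow> near (2 * t n) (f (Suc n) x) (f n x)" by blast
  have cf: "continuous_map X (menger m) (f n)" for n using f(1)[of n] unfolding P_def by blast
  have fM: "f n x \<in> menger_set m" if "x \<in> topspace X" for n x using continuous_map_menger_image[OF cf that] .
  have "\<exists>L. \<forall>n. \<bar>f n x i - L\<bar> \<le> 3 * (1 / 3 ^ n)" if x: "x \<in> topspace X" and i: "i < 2 * m + 1" for x i
    using near_coordinate[OF f(2)[OF x] fM[OF x] fM[OF x] i] unfolding t_def by (intro geometric_limit) auto
  then obtain L where L: "\<And>x i n. x \<in> topspace X \<Longrightarrow> i < 2 * m + 1 \<Longrightarrow> \<bar>f n x i - L x i\<bar> \<le> 3 * t n"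
    unfolding t_def by metis
  define F where "F x i = (if i < 2 * m + 1 then L x i else 0)" for x i
  have FL: "\<bar>f n x i - F x i\<bar> \<le> 3 * t n" if "x \<in> topspace X" "i < 2 * m + 1" for n x i
    using L[OF that] that(2) by (simp add: F_def)
  have small: "\<exists>n. 3 * t n \<le> e" if "e > 0" for e :: real
  proof -
    obtain n where n: "3 / e < 3 ^ n" using real_arch_pow[of 3 "3 / e"] by auto
    then show ?thesis using \<open>e > 0\<close> by (intro exI[of _ n]) (simp add: t_def field_simps)
  qed
  have FM: "F x \<in> menger_set m" if x: "x \<in> topspace X" for x
  proof (rule menger_set_limit)
    fix e :: real and k assume "e > 0"
    then obtain n where "3 * t n \<le> e" using small by blast
    then have "\<forall>i<2 * m + 1. \<bar>f n x i - F x i\<bar> \<le> e" using FL[OF x, of _ n] by (auto intro: order_trans)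
    then show "\<exists>z\<in>menger_stage m k. \<forall>i<2 * m + 1. \<bar>z i - F x i\<bar> \<le> e"
      using menger_set_in_stage[OF fM[OF x]] by blast
  qed (simp add: F_def)
  have "continuous_map X euclideanreal (\<lambda>x. F x i)" if i: "i < 2 * m + 1" for i
  proof (rule continuous_map_uniform_limit_real)
    fix e :: real assume "e > 0"
    then obtain n where "3 * t n \<le> e" using small by blast
    then have "\<forall>x\<in>topspace X. \<bar>f n x i - F x i\<bar> \<le> e" using FL[OF _ i, of _ n] by (auto intro: order_trans)
    then show "\<exists>g. continuous_map X euclideanreal g \<and> (\<forall>x\<in>topspace X. \<bar>g x - F x i\<bar> \<le> e)"
      using continuous_map_menger_coordinate[OF cf] by blast
  qed
  then have "continuous_map X (menger m) F" using FM by (simp add: continuous_map_menger)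
  moreover have "F (actX x g) = actY (F x) g" if x: "x \<in> topspace X" and g: "g \<in> carrier G" for x g
  proof
    fix i
    have xg: "actX x g \<in> topspace X" using X.act_closed[OF x g] .
    show "F (actX x g) i = actY (F x) g i"
    proof (cases "i < 2 * m + 1")
      case i: True
      have "\<bar>F (actX x g) i - actY (F x) g i\<bar> \<le> 0"
      proof (rule field_le_epsilon)
        fix e :: real assume e: "e > 0"
        then have "e / 3 > 0" by simp
        \<comment> \<open>Convergence survives the action by uniform equicontinuity. This takes one
          third of \<open>e\<close>; the defect of \<open>f n\<close> and its distance from the
          limit take the others.\<close>
        then obtain \<delta> where \<delta>: "\<delta> > 0" "\<And>y z. \<lbrakk>y \<in> menger_set m; z \<in> menger_set m;
          \<And>i. i < 2 * m + 1 \<Longrightarrow> \<bar>y i - z i\<bar> \<le> \<delta>\<rbrakk> \<Longrightarrow> near (e / 3) y z"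
          using near_of_coordinates by blast
        obtain n where n: "3 * t n \<le> min \<delta> (e / 3)" using small[of "min \<delta> (e / 3)"] \<delta>(1) e by auto
        have "near (e / 3) (f n x) (F x)"
          using FL[OF x, of _ n] n by (intro \<delta>(2) fM FM x) (auto intro: order_trans)
        then have 1: "\<bar>actY (f n x) g i - actY (F x) g i\<bar> \<le> e / 3" using g i unfolding near_def by blast
        have "near (r n) (f n (actX x g)) (actY (f n x) g)" using f(1)[of n] x g unfolding P_def by blast
        then have "\<bar>f n (actX x g) i - actY (f n x) g i\<bar> \<le> r n"
          using near_coordinate fM[OF xg] menger_act[OF fM[OF x] g] i by blast
        moreover have "r n \<le> e / 3" using r(3)[of n] n t[of n] by simp
        moreover have "\<bar>f n (actX x g) i - F (actX x g) i\<bar> \<le> e / 3" using FL[OF xg i, of n] n by simp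
        ultimately show "\<bar>F (actX x g) i - actY (F x) g i\<bar> \<le> 0 + e" using 1 by linarith
      qed
      then show ?thesis by simp
    next
      case False
      then show ?thesis using menger_bounds(2)[OF FM[OF xg], of i] menger_bounds(2)[OF menger_act[OF FM[OF x] g], of i] by simp
    qed
  qed
  ultimately show ?thesis unfolding equivariant_map_def by blast
qed

end


section \<open>Maps from joins\<close>

lemma menger_null_homotopy:
  assumes "n < m" and \<psi>: "continuous_map (menger n) (menger m) \<psi>" and c: "c \<in> topspace (menger m)"
  obtains H where "continuous_map (prod_topology (menger n) (top_of_set {0..1::real})) (menger m) H"
    "\<And>x. x \<in> topspace (menger n) \<Longrightarrow> H (x, 0) = c" "\<And>x. x \<in> topspace (menger n) \<Longrightarrow> H (x, 1) = \<psi> x"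
proof -
  let ?P = "prod_topology (menger n) (top_of_set {0..1::real})"
  have P: "compact_space ?P" "Hausdorff_space ?P"
    by (auto simp: compact_space_prod_topology Hausdorff_space_prod_topology compact_menger Hausdorff_menger
        compact_space_subtopology Hausdorff_space_subtopology)
  define A where "A s = topspace (menger n) \<times> {s::real}" for s
  have cA: "closedin ?P (A s)" if "s \<in> {0, 1}" for s
  proof -
    have "closedin (top_of_set {0..1::real}) {s}" using that by (intro closed_subset) auto
    then show ?thesis by (simp add: A_def closedin_prod_Times_iff)
  qed
  define F where "F q = (if snd q = 0 then c else \<psi> (fst q))" for q :: "(nat \<Rightarrow> real) \<times> real"
  have F: "continuous_map (subtopology ?P (\<Union>{A 0, A 1})) (menger m) F"
  proof (rule continuous_map_closed_cover)
    fix C assume C: "C \<in> {A 0, A 1}"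
    then show "closedin ?P C" using cA by auto
    from C consider "C = A 0" | "C = A 1" by blast
    then show "continuous_map (subtopology ?P C) (menger m) F"
    proof cases
      case 1
      have "continuous_map (subtopology ?P C) (menger m) (\<lambda>q. c)" using c by simp
      then show ?thesis by (rule continuous_map_eq) (simp add: 1 A_def F_def mem_Times_iff)
    next
      case 2
      have "continuous_map (subtopology ?P C) (menger m) (\<psi> \<circ> fst)"
        using continuous_map_from_subtopology[OF continuous_map_fst] \<psi> by (rule continuous_map_compose)
      then show ?thesis by (rule continuous_map_eq) (simp add: 2 A_def F_def mem_Times_iff)
    qed
  qed simp
  have cU: "closedin ?P (\<Union>{A 0, A 1})" using cA by (intro closedin_Union) auto
  obtain H where H: "continuous_map ?P (menger m) H" "\<And>q. q \<in> \<Union>{A 0, A 1} \<Longrightarrow> H q = F q"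
    by (rule menger_extensor[OF P colored_menger_interval[OF assms(1)] cU F]) (assumption | rule that)+
  show ?thesis
  proof (rule that[OF H(1)])
    fix x assume x: "x \<in> topspace (menger n)"
    show "H (x, 0) = c" using H(2)[of "(x, 0)"] x by (simp add: A_def F_def)
    show "H (x, 1) = \<psi> x" using H(2)[of "(x, 1)"] x by (simp add: A_def F_def)
  qed
qed

text \<open>The formula respects the identifications of the join: at \<open>t = 0\<close> its value
  is \<open>actY c h\<close>, independent of \<open>x\<close>; at \<open>t = 1\<close> equivariance
  of \<open>\<psi>\<close> cancels the two occurrences of \<open>h\<close> and leaves
  \<open>\<psi> x\<close>.\<close>

lemma equivariant_map_from_join:
  assumes X: "continuous_right_action G T X actX" and Y: "continuous_right_action G T Y actY"
    and \<psi>: "equivariant_map G X actX Y actY \<psi>"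
    and H: "continuous_map (prod_topology X (top_of_set {0..1::real})) Y H"
    and H0: "\<And>x. x \<in> topspace X \<Longrightarrow> H (x, 0) = c" and H1: "\<And>x. x \<in> topspace X \<Longrightarrow> H (x, 1) = \<psi> x"
  shows "\<exists>\<Psi>. equivariant_map G (join_space X T) (join_act actX (\<lambda>h g. h \<otimes>\<^bsub>G\<^esub> g)) Y actY \<Psi>"
proof -
  interpret X: continuous_right_action G T X actX by (rule X)
  interpret Y: continuous_right_action G T Y actY by (rule Y)
  interpret R: free_right_action G T T "\<lambda>h g. h \<otimes>\<^bsub>G\<^esub> g" by (rule X.right_multiplication_action)
  let ?J = "join_cylinder X T"
  define \<Phi> where "\<Phi> q = actY (H (actX (fst q) (inv\<^bsub>G\<^esub> fst (snd q)), snd (snd q))) (fst (snd q))" for q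
  have "continuous_map ?J X fst" "continuous_map ?J T (\<lambda>q. fst (snd q))"
    "continuous_map ?J (top_of_set {0..1::real}) (\<lambda>q. snd (snd q))"
    unfolding join_cylinder_def
    using continuous_map_fst continuous_map_compose[OF continuous_map_snd continuous_map_fst]
      continuous_map_compose[OF continuous_map_snd continuous_map_snd]
    by (auto simp: o_def)
  note pr = this
  have "continuous_map ?J T (\<lambda>q. inv\<^bsub>G\<^esub> fst (snd q))"
    using continuous_map_compose[OF pr(2) X.continuous_inv] by (simp add: o_def)
  then have "continuous_map ?J (prod_topology X (top_of_set {0..1::real}))
      (\<lambda>q. (actX (fst q) (inv\<^bsub>G\<^esub> fst (snd q)), snd (snd q)))"
    by (intro continuous_map_pairedI X.continuous_map_act pr)
  then have "continuous_map ?J Y (\<lambda>q. H (actX (fst q) (inv\<^bsub>G\<^esub> fst (snd q)), snd (snd q)))"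
    using continuous_map_compose[OF _ H] by (simp add: o_def)
  then have c\<Phi>: "continuous_map ?J Y \<Phi>"
    unfolding \<Phi>_def[abs_def] by (intro Y.continuous_map_act pr)
  have resp: "\<Phi> q = \<Phi> q'" if r: "(q, q') \<in> join_rel X T" for q q'
  proof -
    obtain x h t where q: "q = (x, h, t)" by (cases q)
    obtain x' h' t' where q': "q' = (x', h', t')" by (cases q')
    have top: "x \<in> topspace X" "h \<in> carrier G" "x' \<in> topspace X" "h' \<in> carrier G"
      using r by (auto simp: q q' join_rel_def join_cylinder_def X.topspace_eq_carrier)
    have \<psi>h: "\<Phi> (x, h, 1) = \<psi> x" if "x \<in> topspace X" "h \<in> carrier G" for x h
    proof -
      have "\<Phi> (x, h, 1) = actY (\<psi> (actX x (inv\<^bsub>G\<^esub> h))) h"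
        using that by (simp add: \<Phi>_def H1 X.act_closed)
      also have "\<dots> = \<psi> (actX (actX x (inv\<^bsub>G\<^esub> h)) h)"
      proof -
        have "actX x (inv\<^bsub>G\<^esub> h) \<in> topspace X" using that by (simp add: X.act_closed)
        then have "\<psi> (actX (actX x (inv\<^bsub>G\<^esub> h)) h) = actY (\<psi> (actX x (inv\<^bsub>G\<^esub> h))) h"
          using \<psi> that(2) unfolding equivariant_map_def by blast
        then show ?thesis by (rule sym)
      qed
      finally show ?thesis using that by simp
    qed
    consider "q = q'" | "t = 0" "t' = 0" "h = h'" | "t = 1" "t' = 1" "x = x'"
      using r unfolding q q' join_rel_def by auto
    then show ?thesis
    proof cases
      case 2
      then show ?thesis using top by (simp add: q q' \<Phi>_def H0 X.act_closed)
    next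
      case 3
      then show ?thesis using \<psi>h top by (simp add: q q')
    qed simp
  qed
  define cls where "cls q = join_rel X T `` {q}" for q
  define \<Psi> where "\<Psi> C = \<Phi> (SOME q. q \<in> C)" for C
  have \<Psi>: "\<Psi> (cls q) = \<Phi> q" if q: "q \<in> topspace ?J" for q
  proof -
    have "q \<in> cls q" unfolding cls_def using equiv_class_self[OF equiv_join_rel q] .
    then have "(SOME q'. q' \<in> cls q) \<in> cls q" by (rule someI)
    then have "(q, SOME q'. q' \<in> cls q) \<in> join_rel X T" by (simp add: cls_def)
    then show ?thesis using resp unfolding \<Psi>_def by metis
  qed
  have quo: "quotient_map ?J (join_space X T) cls"
    unfolding cls_def[abs_def] join_space_def by (rule quotient_map_quotient_space[OF equiv_join_rel])
  have "continuous_map ?J Y (\<Psi> \<circ> cls)"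
    by (rule continuous_map_eq[OF c\<Phi>]) (simp add: \<Psi>)
  then have "continuous_map (join_space X T) Y \<Psi>"
    using quo continuous_compose_quotient_map by blast
  moreover have "\<Psi> (join_act actX (\<lambda>h g. h \<otimes>\<^bsub>G\<^esub> g) C g) = actY (\<Psi> C) g"
    if C: "C \<in> topspace (join_space X T)" and g: "g \<in> carrier G" for C g
  proof -
    obtain q where q: "q \<in> topspace ?J" "C = cls q"
      using C quotient_imp_surjective_map[OF quo] by blast
    obtain x h t where xht: "q = (x, h, t)" by (cases q)
    have top: "x \<in> topspace X" "h \<in> carrier G" "t \<in> {0..1}"
      using q by (auto simp: xht join_cylinder_def X.topspace_eq_carrier)
    have qg: "(actX x g, h \<otimes>\<^bsub>G\<^esub> g, t) \<in> topspace ?J"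
      using top g X.act_closed by (simp add: join_cylinder_def X.topspace_eq_carrier)
    have "join_act actX (\<lambda>h g. h \<otimes>\<^bsub>G\<^esub> g) C g = cls (actX x g, h \<otimes>\<^bsub>G\<^esub> g, t)"
      using join_act_class[OF X R.continuous_right_action_axioms q(1)[unfolded xht] g] by (simp add: q(2) xht cls_def)
    then have "\<Psi> (join_act actX (\<lambda>h g. h \<otimes>\<^bsub>G\<^esub> g) C g) = \<Phi> (actX x g, h \<otimes>\<^bsub>G\<^esub> g, t)"
      using \<Psi>[OF qg] by simp
    \<comment> \<open>The translate of \<open>x\<close> by the inverse of \<open>h\<close> is
      unchanged when \<open>g\<close> acts on both, so only the outer action sees
      \<open>g\<close>.\<close>
    also have "\<dots> = actY (\<Phi> (x, h, t)) g"
    proof -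
      have "g \<otimes>\<^bsub>G\<^esub> inv\<^bsub>G\<^esub> (h \<otimes>\<^bsub>G\<^esub> g) = inv\<^bsub>G\<^esub> h"
        using top g by (simp add: X.inv_mult_group X.m_assoc[symmetric])
      then have "actX (actX x g) (inv\<^bsub>G\<^esub> (h \<otimes>\<^bsub>G\<^esub> g)) = actX x (inv\<^bsub>G\<^esub> h)"
        using top g by (simp add: X.act_mult[symmetric])
      moreover have "H (actX x (inv\<^bsub>G\<^esub> h), t) \<in> topspace Y"
        using continuous_map_image_subset_topspace[OF H] top X.act_closed[of x "inv\<^bsub>G\<^esub> h"] by auto
      ultimately show ?thesis
        using top g by (simp add: \<Phi>_def Y.act_mult)
    qed
    also have "\<Phi> (x, h, t) = \<Psi> C" using \<Psi>[OF q(1)] q(2) xht by simp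
    finally show ?thesis .
  qed
  ultimately show ?thesis unfolding equivariant_map_def by blast
qed

theorem theorem2p14:
  fixes m n :: nat
    and G :: "('g, 'b) monoid_scheme" and T :: "'g topology"
    and act_m act_n :: "(nat \<Rightarrow> real) \<Rightarrow> 'g \<Rightarrow> (nat \<Rightarrow> real)"
  assumes "m > n"
    and "topological_group G T"
    and "compact_space T"
    and "covering_dim_le T 0"
    and "carrier G \<noteq> {\<one>\<^bsub>G\<^esub>}"
    and "free_right_action G T (menger m) act_m"
    and "free_right_action G T (menger n) act_n"
    and "covering_dim_le (orbit_space G (menger n) act_n) m"
    and "\<not> (\<exists>f. equivariant_map G
               (join_space (menger n) T) (join_act act_n (\<lambda>h g. h \<otimes>\<^bsub>G\<^esub> g))
               (menger n) act_n f)"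
  shows "\<not> (\<exists>f. equivariant_map G (menger m) act_m (menger n) act_n f)"
proof
  assume "\<exists>f. equivariant_map G (menger m) act_m (menger n) act_n f"
  then obtain f where f: "equivariant_map G (menger m) act_m (menger n) act_n f" by blast
  interpret M: free_right_action G T "menger m" act_m by fact
  interpret N: free_right_action G T "menger n" act_n by fact
  have "colored (orbit_space G (menger n) act_n) m"
    by (intro colored_of_covering_dim N.orbits_compact_Hausdorff compact_menger Hausdorff_menger assms)
  then interpret L: equivariant_lifting G T "menger n" act_n m act_m
    by unfold_locales (use assms in \<open>auto simp: compact_menger Hausdorff_menger\<close>)
  obtain \<psi> where \<psi>: "equivariant_map G (menger n) act_n (menger m) act_m \<psi>"
    using L.equivariant_map_exists by blast
  obtain H where "continuous_map (prod_topology (menger n) (top_of_set {0..1::real})) (menger m) H"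
    "\<And>x. x \<in> topspace (menger n) \<Longrightarrow> H (x, 0) = (\<lambda>_. 0)"
    "\<And>x. x \<in> topspace (menger n) \<Longrightarrow> H (x, 1) = \<psi> x"
    by (rule menger_null_homotopy[OF assms(1) _ zero_in_menger, of \<psi>])
      (use \<psi> in \<open>auto simp: equivariant_map_def\<close>)
  from equivariant_map_from_join[OF N.continuous_right_action_axioms M.continuous_right_action_axioms \<psi> this]
  obtain \<Psi> where \<Psi>: "equivariant_map G (join_space (menger n) T) (join_act act_n (\<lambda>h g. h \<otimes>\<^bsub>G\<^esub> g)) (menger m) act_m \<Psi>"
    by blast
  have "continuous_map (join_space (menger n) T) (menger n) (f \<circ> \<Psi>)"
    using \<Psi> f continuous_map_compose unfolding equivariant_map_def by blast
  moreover have "\<Psi> c \<in> topspace (menger m)" if "c \<in> topspace (join_space (menger n) T)" for c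
    using \<Psi> that continuous_map_image_subset_topspace unfolding equivariant_map_def by blast
  ultimately have "equivariant_map G (join_space (menger n) T) (join_act act_n (\<lambda>h g. h \<otimes>\<^bsub>G\<^esub> g)) (menger n) act_n (f \<circ> \<Psi>)"
    using \<Psi> f unfolding equivariant_map_def by simp
  then show False using assms(9) by blast
qed


end
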